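(* Let $M$ be a finitely generated commutative monoid, let $S$ be a finite generating set of $M$, and let $K\geq 1$ be an integer. Then there is a function $R\colon(0,\infty)\to[0,\infty)$, depending only on $M,S,K$, such that for every bounded-to-one action $M\curvearrowright X$ on a set $X$ satisfying \[ \sup_{x\in X,\ s\in S}|s^{-1}(x)|\leq K , \] we have \[ \operatorname{asdim}(M\curvearrowright X)\leq \operatorname{rk}(M) \] with control function $R$. Moreover, the dimension bound is sharp: for every integer $n\ge 0$ there are a finitely generated commutative monoid $M$ with $\operatorname{rk}(M)=n$ and a bounded-to-one action $M\curvearrowright X$ with $\operatorname{asdim}(M\curvearrowright X)=n$ (namely the translation action $\mathbb N^n\curvearrowright\mathbb Z^n$).
   Context: An action of a monoid $M$ on a set $X$ assigns to each $a\in M$ a map $x\mapsto ax$ with $1x=x$ and $(ab)x=a(bx)$; $s^{-1}(x)=\{y\in X: sy=x\}$. The action is bounded-to-one if for every $a\in M$ there is a finite upper bound (depending on $a$) on the cardinalities of the fibers of $x\mapsto ax$. Schreier graph: for a finite generating set $S$, the graph $G_S^X$ has vertex set $X$ and undirected edges $\{x,sx\}$ ($x\in X$, $s\in S$), loops discarded. $X$ carries its path metric $d$, with value $\infty$ between different connected components. Asymptotic dimension: let $(X,d)$ be a metric space, possibly with infinite distances. The $r$-components of a subset are the equivalence classes generated by $r$-chains, i.e. finite sequences of points of the subset with successive distances at most $r$. The space has asymptotic dimension at most $n$ with control function $R$ if for every $r>0$ there is a cover $U_0,\dots,U_n$ of $X$ (empty members allowed) such that every $r$-component of each $U_i$ has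 diameter at most $R(r)<\infty$. $\operatorname{asdim}(M\curvearrowright X)$ is the asymptotic dimension of $(X,d)$; it does not depend on the finite generating set. In the statement, the control function refers to the metric given by $S$. Rank: $M^{\mathrm{gp}}$ is the group completion of $M$ (the abelian group of formal fractions $[a,b]$, $a,b\in M$, with $[a,b]=[a',b']$ iff $ab'c=a'bc$ for some $c\in M$). For finitely generated $M$, $M^{\mathrm{gp}}\cong\mathbb Z^n\oplus T$ with $T$ finite, and $\operatorname{rk}(M):=n$. *)

theory Defs
  imports "HOL-Algebra.Product_Groups" "HOL-Library.Extended_Nonnegative_Real"
begin

section \<open>Finitely generated commutative monoids and their rank\<close>

definition monoid_generated_by :: "('m, 'b) monoid_scheme \<Rightarrow> 'm set \<Rightarrow> bool" where
  "monoid_generated_by M S \<longleftrightarrow>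
     S \<subseteq> carrier M \<and> (\<lambda>H. submonoid H M) hull S = carrier M"

definition finitely_generated_monoid :: "('m, 'b) monoid_scheme \<Rightarrow> bool" where
  "finitely_generated_monoid M \<longleftrightarrow> (\<exists>S. finite S \<and> monoid_generated_by M S)"

definition fraction_rel :: "('m, 'b) monoid_scheme \<Rightarrow> (('m \<times> 'm) \<times> ('m \<times> 'm)) set" where
  "fraction_rel M =
     {((a, b), (a', b')). a \<in> carrier M \<and> b \<in> carrier M \<and> a' \<in> carrier M \<and> b' \<in> carrier M \<and>
        (\<exists>c\<in>carrier M. a \<otimes>\<^bsub>M\<^esub> b' \<otimes>\<^bsub>M\<^esub> c = a' \<otimes>\<^bsub>M\<^esub> b \<otimes>\<^bsub>M\<^esub> c)}"

definition group_completion :: "('m, 'b) monoid_scheme \<Rightarrow> ('m \<times> 'm) set monoid" where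
  "group_completion M =
     \<lparr>carrier = (carrier M \<times> carrier M) // fraction_rel M,
      monoid.mult = (\<lambda>P Q. \<Union>(a, b)\<in>P. \<Union>(a', b')\<in>Q.
        fraction_rel M `` {(a \<otimes>\<^bsub>M\<^esub> a', b \<otimes>\<^bsub>M\<^esub> b')}),
      one = fraction_rel M `` {(\<one>\<^bsub>M\<^esub>, \<one>\<^bsub>M\<^esub>)}\<rparr>"

abbreviation int_vectors :: "nat \<Rightarrow> (nat \<Rightarrow> int) monoid" where
  "int_vectors n \<equiv> product_group {..<n} (\<lambda>_. integer_group)"

text \<open>
  The finite group \<open>T\<close> is isomorphic to the torsion subgroup of the completion, so it is no
  restriction to take it on the same element type.
\<close>
definition rk :: "('m, 'b) monoid_scheme \<Rightarrow> nat" where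
  "rk M = (THE n. \<exists>T :: ('m \<times> 'm) set monoid.
     comm_group T \<and> finite (carrier T) \<and> group_completion M \<cong> int_vectors n \<times>\<times> T)"


section \<open>Actions and Schreier graphs\<close>

definition monoid_action ::
  "('m, 'b) monoid_scheme \<Rightarrow> 'x set \<Rightarrow> ('m \<Rightarrow> 'x \<Rightarrow> 'x) \<Rightarrow> bool" where
  "monoid_action M X act \<longleftrightarrow>
     (\<forall>a\<in>carrier M. \<forall>x\<in>X. act a x \<in> X) \<and>
     (\<forall>x\<in>X. act \<one>\<^bsub>M\<^esub> x = x) \<and>
     (\<forall>a\<in>carrier M. \<forall>b\<in>carrier M. \<forall>x\<in>X. act (a \<otimes>\<^bsub>M\<^esub> b) x = act a (act b x))"

definition fiber :: "'x set \<Rightarrow> ('m \<Rightarrow> 'x \<Rightarrow> 'x) \<Rightarrow> 'm \<Rightarrow> 'x \<Rightarrow> 'x set" where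
  "fiber X act a x = {y \<in> X. act a y = x}"

definition bounded_to_one_action ::
  "('m, 'b) monoid_scheme \<Rightarrow> 'x set \<Rightarrow> ('m \<Rightarrow> 'x \<Rightarrow> 'x) \<Rightarrow> bool" where
  "bounded_to_one_action M X act \<longleftrightarrow> monoid_action M X act \<and>
     (\<forall>a\<in>carrier M. \<exists>N. \<forall>x\<in>X. finite (fiber X act a x) \<and> card (fiber X act a x) \<le> N)"

definition schreier_edges :: "'m set \<Rightarrow> 'x set \<Rightarrow> ('m \<Rightarrow> 'x \<Rightarrow> 'x) \<Rightarrow> 'x set set" where
  "schreier_edges S X act = {{x, act s x} | x s. x \<in> X \<and> s \<in> S \<and> act s x \<noteq> x}"

text \<open>The infimum over the empty set of path lengths is \<open>\<infinity>\<close>.\<close>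
definition schreier_dist :: "'m set \<Rightarrow> 'x set \<Rightarrow> ('m \<Rightarrow> 'x \<Rightarrow> 'x) \<Rightarrow> 'x \<Rightarrow> 'x \<Rightarrow> ennreal" where
  "schreier_dist S X act x y =
     (INF k\<in>{k. (x, y) \<in> {(u, v). {u, v} \<in> schreier_edges S X act} ^^ k}. of_nat k)"


section \<open>Asymptotic dimension\<close>

definition chain_rel :: "('x \<Rightarrow> 'x \<Rightarrow> ennreal) \<Rightarrow> real \<Rightarrow> 'x set \<Rightarrow> ('x \<times> 'x) set" where
  "chain_rel d r A =
     {(u, v). u \<in> A \<and> v \<in> A \<and> (u, v) \<in> {(p, q). p \<in> A \<and> q \<in> A \<and> d p q \<le> ennreal r}\<^sup>*}"

definition r_components :: "('x \<Rightarrow> 'x \<Rightarrow> ennreal) \<Rightarrow> real \<Rightarrow> 'x set \<Rightarrow> 'x set set" where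
  "r_components d r A = A // chain_rel d r A"

definition ext_diameter :: "('x \<Rightarrow> 'x \<Rightarrow> ennreal) \<Rightarrow> 'x set \<Rightarrow> ennreal" where
  "ext_diameter d A = (SUP x\<in>A. SUP y\<in>A. d x y)"

definition asdim_le_with_control ::
  "'x set \<Rightarrow> ('x \<Rightarrow> 'x \<Rightarrow> ennreal) \<Rightarrow> nat \<Rightarrow> (real \<Rightarrow> real) \<Rightarrow> bool" where
  "asdim_le_with_control X d n R \<longleftrightarrow>
     (\<forall>r>0. 0 \<le> R r \<and>
        (\<exists>U :: nat \<Rightarrow> 'x set. (\<Union>i\<le>n. U i) = X \<and>
           (\<forall>i\<le>n. \<forall>C\<in>r_components d r (U i). ext_diameter d C \<le> ennreal (R r))))"

definition asdim :: "'x set \<Rightarrow> ('x \<Rightarrow> 'x \<Rightarrow> ennreal) \<Rightarrow> enat" where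
  "asdim X d = (INF n\<in>{n. \<exists>R. asdim_le_with_control X d n R}. enat n)"

text \<open>
  A control function that depends on \<open>M\<close>, \<open>S\<close>, \<open>K\<close> only. In HOL, an existential quantifier over
  \<open>R\<close> in front of a quantifier over sets \<open>X\<close> of type \<open>'x set\<close> would still allow \<open>R\<close> to depend
  on the type \<open>'x\<close>. A constant in whose type \<open>'x\<close> does not occur excludes this. It picks some
  control function that works for all actions on countable sets; this suffices because the
  Schreier graphs in question have countable connected components.
\<close>
definition uniform_control :: "('m, 'b) monoid_scheme \<Rightarrow> 'm set \<Rightarrow> nat \<Rightarrow> real \<Rightarrow> real" where
  "uniform_control M S K = (SOME R. (\<forall>r>0. 0 \<le> R r) \<and>
     (\<forall>(X :: nat set) act.
        bounded_to_one_action M X act \<and>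
        (\<forall>x\<in>X. \<forall>s\<in>S. finite (fiber X act s x) \<and> card (fiber X act s x) \<le> K) \<longrightarrow>
        asdim_le_with_control X (schreier_dist S X act) (rk M) R))"


section \<open>The translation action of \<open>\<nat>\<^sup>n\<close> on \<open>\<int>\<^sup>n\<close>\<close>

definition nat_vectors :: "nat \<Rightarrow> (nat \<Rightarrow> nat) monoid" where
  "nat_vectors n =
     product_group {..<n} (\<lambda>_. \<lparr>carrier = UNIV, monoid.mult = (+), one = 0\<rparr>)"

definition translation :: "nat \<Rightarrow> (nat \<Rightarrow> nat) \<Rightarrow> (nat \<Rightarrow> int) \<Rightarrow> (nat \<Rightarrow> int)" where
  "translation n a x = (\<lambda>i\<in>{..<n}. int (a i) + x i)"

end

theory Submission
  imports Defs "HOL-Library.Function_Algebras" "HOL-Library.Multiset" "HOL-Library.Countable_Set"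
    "HOL-Algebra.Multiplicative_Group" "HOL-Analysis.Brouwer_Fixpoint"
begin

text \<open>
  The upper bound is proved by induction on the rank \<open>n\<close>. Fix a scale \<open>r\<close> and a large \<open>L\<close>. The points
  at which two words of length at most \<open>L\<close> and of different height in \<open>\<int>\<^sup>n\<close> act alike form finitely many
  invariant sets, on each of which the monoid acts through a quotient of smaller rank. Near any
  other point the space looks like a piece of \<open>\<int>\<^sup>n\<close> (up to the finite torsion) with trees attached
  that are directed towards it, so any local rule that colours \<open>\<int>\<^sup>n\<close> can be evaluated by looking only
  forward, at the images of the point under long words. Such a rule needs an input that breaks the
  symmetry of \<open>\<int>\<^sup>n\<close>: a proper colouring of the Schreier graph with finitely many colours, which exists
  because all fibres are bounded. A greedy algorithm turns it into a separated net with
  boundedly many labels; the balls around the points with one label are coloured by boxes with \<open>n + 1\<close>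
  colours, and the finitely many labels are merged by the union theorem for asymptotic dimension.
  Uniformity comes for free by applying the result to the disjoint union of all actions.
\<close>

section \<open>Colourings with bounded monochromatic chains\<close>

text \<open>Two circularities shape the constants. The separation \<open>D\<close> of the net must
  exceed the bound obtained by merging all labels, so the number of labels must not depend on
  \<open>D\<close>: a net point competes only with those within \<open>4 * D\<close>, and a packing
  count at ratio four bounds their number by \<open>9 ^ card I\<close>. The radius to which the rule
  looks grows with the number of input colours, so the input may be required to be proper only at a
  scale fixed beforehand. The net is there because a box colouring needs an origin, and
  \<open>\<int>\<^sup>n\<close> offers none; nearby points share the net point that serves as origin
  only if its label is the same for both. Torsion is handled by replacing a point with the finite
  set of its images under representatives of all torsion classes. The rank enters through a maximal
  system of integer characters of the group completion: their common kernel is finite, and they are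
  the coordinates of the heights. Sharpness is a discrete Lebesgue covering theorem: a large cube in
  \<open>\<int>\<^sup>n\<close> covered by \<open>n\<close> sets with bounded components contradicts
  Kuhn's lemma.\<close>

definition mono_chain ::
  "(nat \<Rightarrow> 'p \<Rightarrow> 'p \<Rightarrow> bool) \<Rightarrow> ('p \<Rightarrow> nat) \<Rightarrow> 'p set \<Rightarrow> nat \<Rightarrow> ('p \<times> 'p) set" where
  "mono_chain N col A r = {(p, q). p \<in> A \<and> q \<in> A \<and> col p = col q \<and> N r p q}\<^sup>*"

text \<open>A cover by \<open>n + 1\<close> sets is encoded as one function with values at most
  \<open>n\<close>, so its pieces are disjoint and the colours outside \<open>A\<close> do not
  matter.\<close>

definition good_col ::
  "(nat \<Rightarrow> 'p \<Rightarrow> 'p \<Rightarrow> bool) \<Rightarrow> ('p \<Rightarrow> nat) \<Rightarrow> 'p set \<Rightarrow> nat \<Rightarrow> nat \<Rightarrow> bool" where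
  "good_col N col A r R \<longleftrightarrow> (\<forall>p q. (p, q) \<in> mono_chain N col A r \<longrightarrow> N R p q)"

text \<open>An extended pseudometric with integer values, given by its closed balls:
  \<open>N k p q\<close> stands for distance at most \<open>k\<close>, and infinite distance means
  that no \<open>k\<close> works.\<close>

locale coarse =
  fixes N :: "nat \<Rightarrow> 'p \<Rightarrow> 'p \<Rightarrow> bool"
  assumes near_refl: "N k p p"
    and near_sym: "N k p q \<Longrightarrow> N k q p"
    and near_add: "N j p q \<Longrightarrow> N k q t \<Longrightarrow> N (j + k) p t"
    and near_mono: "N j p q \<Longrightarrow> j \<le> k \<Longrightarrow> N k p q"
begin

lemma mono_chain_end: "(p, q) \<in> mono_chain N col A r \<Longrightarrow> p = q \<or> (p \<in> A \<and> q \<in> A \<and> col p = col q)"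
  unfolding mono_chain_def by (induction rule: rtrancl_induct) auto

lemma mono_chain_step:
  "(p, q) \<in> mono_chain N col A r \<Longrightarrow> q \<in> A \<Longrightarrow> t \<in> A \<Longrightarrow> col q = col t \<Longrightarrow> N r q t \<Longrightarrow>
   (p, t) \<in> mono_chain N col A r"
  unfolding mono_chain_def by (rule rtrancl_into_rtrancl) auto

lemma mono_chain_refl: "(p, p) \<in> mono_chain N col A r"
  unfolding mono_chain_def by simp

lemma good_col_subset:
  assumes "good_col N col A r R" "B \<subseteq> A" "\<And>p. p \<in> B \<Longrightarrow> col' p = col p" "r' \<le> r" "R \<le> R'"
  shows "good_col N col' B r' R'"
proof -
  have "mono_chain N col' B r' \<subseteq> mono_chain N col A r"
    unfolding mono_chain_def using assms(2,3,4) near_mono by (intro rtrancl_mono) fastforce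
  then show ?thesis using assms(1,5) near_mono unfolding good_col_def by blast
qed

text \<open>This is the union theorem. A stretch of the chain in \<open>A\<close> moves by at most
  \<open>RA\<close>, so the visits to \<open>B\<close> just before and after it are within
  \<open>RA + 2 * r\<close>; the visits to \<open>B\<close> thus form a chain at the scale at which
  \<open>B\<close> is good. The stretches at the two ends of the chain cost \<open>RA + r\<close>
  each.\<close>

lemma good_col_Un:
  assumes A: "good_col N col A r RA" and B: "good_col N col B (RA + 2 * r) RB"
  shows "good_col N col (A \<union> B) r (RB + 2 * RA + 2 * r)"
  unfolding good_col_def
proof (intro allI impI)
  fix p q assume "(p, q) \<in> mono_chain N col (A \<union> B) r"
  \<comment> \<open>Invariant along the chain: either it has run in \<open>A\<close> so far, or
    \<open>b\<close> and \<open>b'\<close> are the first and the last recorded visit to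
    \<open>B\<close>, and \<open>q\<close> is \<open>b'\<close> itself or lies on a stretch in
    \<open>A\<close> entered from \<open>b'\<close>.\<close>
  define reach where "reach q \<longleftrightarrow> (p, q) \<in> mono_chain N col A r \<or>
    (\<exists>b b'. b \<in> B \<and> b' \<in> B \<and> N (RA + r) p b \<and> (b, b') \<in> mono_chain N col B (RA + 2 * r) \<and>
      col b' = col q \<and> (q = b' \<or> (\<exists>a\<in>A. N r b' a \<and> (a, q) \<in> mono_chain N col A r)))" for q
  have A': "N RA x y" if "(x, y) \<in> mono_chain N col A r" for x y
    using A that unfolding good_col_def by blast
  have "reach q"
    using \<open>(p, q) \<in> mono_chain N col (A \<union> B) r\<close> unfolding mono_chain_def[of N col "A \<union> B"]
  proof (induction rule: rtrancl_induct)
    case base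
    show ?case unfolding reach_def using mono_chain_refl by blast
  next
    case (step q t)
    then have qt: "q \<in> A \<union> B" "t \<in> A \<union> B" "col q = col t" "N r q t" by auto
    from step.IH consider (1) "(p, q) \<in> mono_chain N col A r"
      | (2) b b' where "b \<in> B" "b' \<in> B" "N (RA + r) p b" "(b, b') \<in> mono_chain N col B (RA + 2 * r)"
        "col b' = col q" "q = b' \<or> (\<exists>a\<in>A. N r b' a \<and> (a, q) \<in> mono_chain N col A r)"
      unfolding reach_def by blast
    then show ?case
    proof cases
      case chain: 1
      consider "t \<in> B" | "t \<in> A" "q \<in> A" | "t \<in> A" "q \<in> B" "q \<notin> A" using qt by blast
      then show ?thesis
      proof cases
        case 1
        have "N (RA + r) p t" using A'[OF chain] qt(4) near_add by blast
        then show ?thesis unfolding reach_def using 1 mono_chain_refl by blast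
      next
        case 2
        then show ?thesis unfolding reach_def using chain mono_chain_step qt by blast
      next
        case 3
        \<comment> \<open>A chain in \<open>A\<close> that ends outside \<open>A\<close> is trivial,
          so the starting point itself is the first visit to \<open>B\<close>.\<close>
        then have "p = q" using mono_chain_end[OF chain] by blast
        then show ?thesis unfolding reach_def using 3 qt near_refl mono_chain_refl by metis
      qed
    next
      case 2
      show ?thesis
      proof (cases "t \<in> B")
        case True
        have "N (RA + 2 * r) b' t"
          using 2(6)
        proof
          assume "q = b'" then show ?thesis using qt(4) near_mono by auto
        next
          assume "\<exists>a\<in>A. N r b' a \<and> (a, q) \<in> mono_chain N col A r"
          then obtain a where "N r b' a" "N RA a q" using A' by blast
          then have "N (r + RA + r) b' t" using near_add qt(4) by blast
          then show ?thesis using near_mono by (simp add: add.commute mult_2)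
        qed
        then have "(b, t) \<in> mono_chain N col B (RA + 2 * r)"
          using mono_chain_step 2(2,4,5) True qt(3) by metis
        then show ?thesis unfolding reach_def using 2 True by blast
      next
        case False
        then have "t \<in> A" using qt by blast
        from 2(6) have "\<exists>a\<in>A. N r b' a \<and> (a, t) \<in> mono_chain N col A r"
        proof
          assume "q = b'" then show ?thesis using \<open>t \<in> A\<close> qt(4) mono_chain_refl by blast
        next
          assume "\<exists>a\<in>A. N r b' a \<and> (a, q) \<in> mono_chain N col A r"
          then obtain a where a: "a \<in> A" "N r b' a" "(a, q) \<in> mono_chain N col A r" by blast
          then have "q \<in> A" using mono_chain_end by blast
          then show ?thesis using a mono_chain_step \<open>t \<in> A\<close> qt by blast
        qed
        moreover have "col b' = col t" using 2(5) qt(3) by simp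
        ultimately show ?thesis unfolding reach_def using 2(1-4) by blast
      qed
    qed
  qed
  then show "N (RB + 2 * RA + 2 * r) p q"
    unfolding reach_def
  proof
    assume "(p, q) \<in> mono_chain N col A r"
    then have "N RA p q" by (rule A')
    then show ?thesis by (rule near_mono) simp
  next
    assume "\<exists>b b'. b \<in> B \<and> b' \<in> B \<and> N (RA + r) p b \<and> (b, b') \<in> mono_chain N col B (RA + 2 * r) \<and>
      col b' = col q \<and> (q = b' \<or> (\<exists>a\<in>A. N r b' a \<and> (a, q) \<in> mono_chain N col A r))"
    then obtain b b' where b: "N (RA + r) p b" "(b, b') \<in> mono_chain N col B (RA + 2 * r)"
      "q = b' \<or> (\<exists>a\<in>A. N r b' a \<and> (a, q) \<in> mono_chain N col A r)" by blast
    have "N RB b b'" using B b(2) unfolding good_col_def by blast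
    moreover have "N (r + RA) b' q" using b(3) A' near_add near_refl by blast
    ultimately have "N (RA + r + RB + (r + RA)) p q" using b(1) near_add by blast
    then show ?thesis by (rule near_mono) simp
  qed
qed

end

section \<open>Integer vectors with the supremum norm, and colourings by boxes\<close>

definition bnd :: "nat \<Rightarrow> (nat \<Rightarrow> int) \<Rightarrow> bool" where
  "bnd k q \<longleftrightarrow> (\<forall>i. \<bar>q i\<bar> \<le> int k)"

lemma bnd_0 [simp]: "bnd k 0"
  by (simp add: bnd_def)

lemma bnd_uminus [simp]: "bnd k (- q) = bnd k q"
  by (simp add: bnd_def)

lemma bnd_add: "bnd j p \<Longrightarrow> bnd k q \<Longrightarrow> bnd (j + k) (p + q)"
  unfolding bnd_def by (auto intro: order_trans[OF abs_triangle_ineq] add_mono)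

lemma bnd_diff: "bnd j p \<Longrightarrow> bnd k q \<Longrightarrow> bnd (j + k) (p - q)"
  using bnd_add[of j p k "- q"] by simp

lemma bnd_mono: "bnd j p \<Longrightarrow> j \<le> k \<Longrightarrow> bnd k p"
  unfolding bnd_def by (meson of_nat_le_iff order_trans)

lemma bnd_minus_commute: "bnd k (p - q) = bnd k (q - p)"
  using bnd_uminus[of k "p - q"] by simp

abbreviation vnear :: "nat \<Rightarrow> (nat \<Rightarrow> int) \<Rightarrow> (nat \<Rightarrow> int) \<Rightarrow> bool" where
  "vnear \<equiv> \<lambda>k p q. bnd k (p - q)"

interpretation vec: coarse vnear
proof
  show "bnd (j + k) (p - t)" if "bnd j (p - q)" "bnd k (q - t)" for j k p q t
    using bnd_add[OF that] by (simp add: algebra_simps)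
qed (auto simp: bnd_minus_commute intro: bnd_mono)

lemma finite_bnd:
  assumes "finite I"
  shows "finite {q. (\<forall>i. i \<notin> I \<longrightarrow> q i = 0) \<and> bnd k q}"
proof -
  have "{q. (\<forall>i. i \<notin> I \<longrightarrow> q i = 0) \<and> bnd k q} \<subseteq>
        {q. \<forall>i. (i \<in> I \<longrightarrow> q i \<in> {- int k..int k}) \<and> (i \<notin> I \<longrightarrow> q i = 0)}"
    unfolding bnd_def by (auto simp: abs_le_iff) (metis add.inverse_inverse neg_le_iff_le)
  then show ?thesis
    by (rule finite_subset) (rule finite_set_of_finite_funs[OF assms], simp)
qed

text \<open>A coordinate can exclude only one colour, so one of the \<open>card I + 1\<close> colours survives; the
  walls of thickness \<open>t + 1\<close> that it leaves around the blocks cannot be jumped.\<close>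
definition box_col :: "nat set \<Rightarrow> nat \<Rightarrow> (nat \<Rightarrow> int) \<Rightarrow> nat" where
  "box_col I t q = (LEAST i. \<forall>j\<in>I. (q j div (int t + 1)) mod (int (card I) + 1) \<noteq> int i)"

lemma box_col:
  assumes "finite I"
  shows "box_col I t q \<le> card I"
    and "j \<in> I \<Longrightarrow> (q j div (int t + 1)) mod (int (card I) + 1) \<noteq> int (box_col I t q)"
proof -
  let ?A = "(\<lambda>j. nat ((q j div (int t + 1)) mod (int (card I) + 1))) ` I"
  have "card ?A < card {..card I}"
    using card_image_le[OF assms] by (subst card_atMost) (rule le_imp_less_Suc)
  then have "\<not> {..card I} \<subseteq> ?A" using assms card_mono[of ?A "{..card I}"] by auto
  then obtain i where i: "i \<le> card I" "i \<notin> ?A" by auto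
  have P: "\<forall>j\<in>I. (q j div (int t + 1)) mod (int (card I) + 1) \<noteq> int i"
  proof
    fix j assume "j \<in> I"
    then show "(q j div (int t + 1)) mod (int (card I) + 1) \<noteq> int i"
      using i(2) by (metis (no_types, lifting) image_eqI nat_int)
  qed
  show "box_col I t q \<le> card I"
    unfolding box_col_def by (rule order_trans[OF Least_le i(1)]) (rule P)
  show "j \<in> I \<Longrightarrow> (q j div (int t + 1)) mod (int (card I) + 1) \<noteq> int (box_col I t q)"
    unfolding box_col_def
    using LeastI[of "\<lambda>i. \<forall>j\<in>I. (q j div (int t + 1)) mod (int (card I) + 1) \<noteq> int i", OF P] by blast
qed

lemma div_add_one_eq:
  fixes b m :: int
  assumes "m > 0" "(b + 1) mod m \<noteq> 0"
  shows "(b + 1) div m = b div m"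
proof -
  have "0 \<le> (b + 1) mod m - 1" "(b + 1) mod m - 1 < m"
    using assms pos_mod_sign[OF assms(1), of "b + 1"] pos_mod_bound[OF assms(1), of "b + 1"] by linarith+
  moreover have "b = m * ((b + 1) div m) + ((b + 1) mod m - 1)"
    using div_mult_mod_eq[of "b + 1" m] by (simp add: algebra_simps)
  ultimately show ?thesis using int_div_pos_eq by metis
qed

lemma abs_diff_less_if_div_eq:
  fixes a b c :: int
  assumes "c > 0" "a div c = b div c"
  shows "\<bar>a - b\<bar> < c"
proof -
  have "a - b = a mod c - b mod c"
    using div_mult_mod_eq[of a c] div_mult_mod_eq[of b c] assms(2) by (metis add_diff_cancel_left)
  then show ?thesis
    using pos_mod_sign[OF assms(1), of a] pos_mod_bound[OF assms(1), of a]
      pos_mod_sign[OF assms(1), of b] pos_mod_bound[OF assms(1), of b] by linarith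
qed

text \<open>In a step shorter than \<open>w\<close> the block index moves by at most one, and after
  the shift by \<open>i\<close> the quotient by \<open>m\<close> changes only where the index enters
  or leaves the residue \<open>i\<close>. Neither end has that residue.\<close>

lemma block_eq:
  fixes x y :: int
  assumes "w > 0" "m > 0" "0 \<le> i" "i < m" "\<bar>x - y\<bar> < w"
    and "(x div w) mod m \<noteq> i" "(y div w) mod m \<noteq> i"
  shows "(x div w - i) div m = (y div w - i) div m"
proof -
  have main: "(a - i) div m = (b - i) div m" if "b = a \<or> b = a + 1" "b mod m \<noteq> i" for a b :: int
  proof (cases "b = a")
    case False
    then have b: "b - i = (a - i) + 1" using that by simp
    have "b mod m = i" if "(b - i) mod m = 0"
    proof -
      have "b mod m = i mod m" using that by (simp add: mod_eq_dvd_iff dvd_eq_mod_eq_0)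
      then show ?thesis using assms(3,4) by simp
    qed
    then have "(b - i) mod m \<noteq> 0" using that(2) by metis
    then have "(a - i + 1) mod m \<noteq> 0" unfolding b .
    then have "(b - i) div m = (a - i) div m" unfolding b by (rule div_add_one_eq[OF assms(2)])
    then show ?thesis ..
  qed simp
  have step: "y div w = x div w \<or> y div w = x div w + 1" if "x \<le> y" "y < x + w" for x y
  proof -
    have "x div w \<le> y div w" using that assms(1) by (simp add: zdiv_mono1)
    moreover have "y div w \<le> (x + w) div w" using that assms(1) by (intro zdiv_mono1) simp_all
    moreover have "(x + w) div w = x div w + 1" using assms(1) by simp
    ultimately show ?thesis by linarith
  qed
  show ?thesis
  proof (cases "x \<le> y")
    case True
    then have "y div w = x div w \<or> y div w = x div w + 1" using step assms(5) by simp
    then show ?thesis using assms(7) by (rule main)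
  next
    case False
    then have "x div w = y div w \<or> x div w = y div w + 1" using step assms(5) by simp
    then show ?thesis using assms(6) by (rule main[symmetric])
  qed
qed

lemma block_dist:
  fixes x y :: int
  assumes "w > 0" "m > 0" "(x div w - i) div m = (y div w - i) div m"
  shows "\<bar>x - y\<bar> \<le> m * w"
proof -
  have "(x - i * w) div (w * m) = (y - i * w) div (w * m)"
    using assms zdiv_zmult2_eq[of m "x - i * w" w] zdiv_zmult2_eq[of m "y - i * w" w]
      div_mult_self1[of w x "- i"] div_mult_self1[of w y "- i"] by simp
  then have "\<bar>(x - i * w) - (y - i * w)\<bar> < w * m"
    using assms by (intro abs_diff_less_if_div_eq) simp_all
  then show ?thesis by (simp add: mult.commute)
qed

text \<open>Along a chain of one colour every coordinate stays between the same two walls of that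
  colour; the number of this interval is the invariant. Such an interval spans at most
  \<open>card I + 1\<close> blocks of width \<open>t + 1\<close>.\<close>

lemma box_col_good:
  assumes "finite I"
  shows "good_col vnear (box_col I t) {q. \<forall>i. i \<notin> I \<longrightarrow> q i = 0} t ((card I + 1) * (t + 1))"
  unfolding good_col_def
proof (intro allI impI)
  fix p q
  let ?V = "{q. \<forall>i. i \<notin> I \<longrightarrow> q i = (0::int)}"
  let ?w = "int t + 1" and ?m = "int (card I) + 1"
  assume "(p, q) \<in> mono_chain vnear (box_col I t) ?V t"
  then have "p = q \<or> (p \<in> ?V \<and> q \<in> ?V \<and> box_col I t p = box_col I t q \<and>
      (\<forall>j\<in>I. (p j div ?w - int (box_col I t p)) div ?m = (q j div ?w - int (box_col I t p)) div ?m))"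
    unfolding mono_chain_def
  proof (induction rule: rtrancl_induct)
    case (step q s)
    then have qs: "q \<in> ?V" "s \<in> ?V" "box_col I t q = box_col I t s" "bnd t (q - s)" by auto
    have "(q j div ?w - int (box_col I t q)) div ?m = (s j div ?w - int (box_col I t q)) div ?m"
      if "j \<in> I" for j
    proof (rule block_eq)
      show "int (box_col I t q) < ?m" using box_col(1)[OF assms, of t q] by simp
      show "\<bar>q j - s j\<bar> < ?w" using qs(4) unfolding bnd_def by (metis fun_diff_def zle_add1_eq_le)
      show "s j div ?w mod ?m \<noteq> int (box_col I t q)" using box_col(2)[OF assms that, of s t] qs(3) by simp
      show "q j div ?w mod ?m \<noteq> int (box_col I t q)" using box_col(2)[OF assms that, of q t] by simp
    qed auto
    then show ?case using step.IH qs by auto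
  qed simp
  then show "bnd ((card I + 1) * (t + 1)) (p - q)"
  proof
    assume *: "p \<in> ?V \<and> q \<in> ?V \<and> box_col I t p = box_col I t q \<and>
      (\<forall>j\<in>I. (p j div ?w - int (box_col I t p)) div ?m = (q j div ?w - int (box_col I t p)) div ?m)"
    show ?thesis
      unfolding bnd_def
    proof
      fix j
      show "\<bar>(p - q) j\<bar> \<le> int ((card I + 1) * (t + 1))"
      proof (cases "j \<in> I")
        case True
        then have "(p j div ?w - int (box_col I t p)) div ?m = (q j div ?w - int (box_col I t p)) div ?m"
          using * by blast
        then have "\<bar>p j - q j\<bar> \<le> ?m * ?w" by (intro block_dist) auto
        then show ?thesis by (simp add: algebra_simps)
      next
        case False
        then have "p j = 0" "q j = 0" using * by auto
        then show ?thesis by simp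
      qed
    qed
  qed simp
qed


section \<open>A local colouring rule for integer vectors\<close>

text \<open>A greedy net: stage \<open>j\<close> decides on the positions of colour \<open>j\<close>, and label \<open>0\<close> means outside the net.\<close>
primrec lab :: "(nat \<Rightarrow> int) set \<Rightarrow> nat \<Rightarrow> ((nat \<Rightarrow> int) \<Rightarrow> nat) \<Rightarrow> nat \<Rightarrow> (nat \<Rightarrow> int) \<Rightarrow> nat" where
  "lab G D \<phi> 0 q = 0"
| "lab G D \<phi> (Suc j) q =
    (if \<phi> q = j \<and> (\<forall>e\<in>G. bnd D e \<longrightarrow> lab G D \<phi> j (q + e) = 0)
     then LEAST l. 1 \<le> l \<and> (\<forall>e\<in>G. bnd (4 * D) e \<longrightarrow> lab G D \<phi> j (q + e) \<noteq> l)
     else lab G D \<phi> j q)"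

declare lab.simps(2) [simp del]

locale vec_group =
  fixes I :: "nat set" and G :: "(nat \<Rightarrow> int) set"
  assumes fin_I: "finite I"
    and zero_G: "0 \<in> G"
    and add_G: "p \<in> G \<Longrightarrow> q \<in> G \<Longrightarrow> p + q \<in> G"
    and uminus_G: "q \<in> G \<Longrightarrow> - q \<in> G"
    and supp_G: "q \<in> G \<Longrightarrow> i \<notin> I \<Longrightarrow> q i = 0"
begin

lemma diff_G: "p \<in> G \<Longrightarrow> q \<in> G \<Longrightarrow> p - q \<in> G"
  using add_G[of p "- q"] uminus_G by simp

lemma finite_ball: "finite {q \<in> G. bnd k q}"
  by (rule finite_subset[OF _ finite_bnd[OF fin_I, of k]]) (use supp_G in auto)

text \<open>Each stage looks no further than \<open>4 * D\<close>, so the label after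
  \<open>j\<close> stages is decided by the colours within \<open>4 * D * j\<close>. Comparing two
  colourings at two positions gives locality and translation equivariance at once.\<close>

lemma lab_shift:
  assumes "\<And>d. d \<in> G \<Longrightarrow> bnd (4 * D * j) d \<Longrightarrow> \<phi> (q + d) = \<phi>' (q' + d)" "q \<in> G" "q' \<in> G"
  shows "lab G D \<phi> j q = lab G D \<phi>' j q'"
  using assms
proof (induction j arbitrary: q q')
  case (Suc j)
  have e: "lab G D \<phi> j (q + e) = lab G D \<phi>' j (q' + e)" if "e \<in> G" "bnd (4 * D) e" for e
  proof (rule Suc.IH)
    fix d assume d: "d \<in> G" "bnd (4 * D * j) d"
    have "bnd (4 * D * Suc j) (e + d)" using bnd_add[OF that(2) d(2)] by simp
    then show "\<phi> (q + e + d) = \<phi>' (q' + e + d)"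
      unfolding add.assoc by (intro Suc.prems(1) add_G that(1) d(1))
  qed (use that add_G Suc.prems in blast)+
  have "\<phi> (q + 0) = \<phi>' (q' + 0)" by (intro Suc.prems(1) zero_G bnd_0)
  then have "\<phi> q = \<phi>' q'" by simp
  moreover have "lab G D \<phi> j q = lab G D \<phi>' j q'" using e[of 0] zero_G by simp
  moreover have "(\<forall>e\<in>G. bnd D e \<longrightarrow> lab G D \<phi> j (q + e) = 0) \<longleftrightarrow>
      (\<forall>e\<in>G. bnd D e \<longrightarrow> lab G D \<phi>' j (q' + e) = 0)"
    using e bnd_mono[of D _ "4 * D"] by auto
  moreover have "(\<forall>e\<in>G. bnd (4 * D) e \<longrightarrow> lab G D \<phi> j (q + e) \<noteq> l) \<longleftrightarrow>
      (\<forall>e\<in>G. bnd (4 * D) e \<longrightarrow> lab G D \<phi>' j (q' + e) \<noteq> l)" for l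
    using e by auto
  ultimately show ?case unfolding lab.simps by (simp only:)
qed simp

lemma ex_free_label:
  assumes "finite (A :: nat set)"
  shows "\<exists>l. 1 \<le> l \<and> l \<notin> A \<and> l \<le> card A + 1"
proof (rule ccontr)
  assume "\<not> ?thesis"
  then have "{1..card A + 1} \<subseteq> A" by auto
  then have "card A + 1 \<le> card A" using card_mono[OF assms, of "{1..card A + 1}"] by simp
  then show False by simp
qed

lemma lab_new:
  assumes "\<phi> q = j" "\<And>e. e \<in> G \<Longrightarrow> bnd D e \<Longrightarrow> lab G D \<phi> j (q + e) = 0"
  shows "1 \<le> lab G D \<phi> (Suc j) q"
    and "e \<in> G \<Longrightarrow> bnd (4 * D) e \<Longrightarrow> lab G D \<phi> j (q + e) \<noteq> lab G D \<phi> (Suc j) q"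
    and "lab G D \<phi> (Suc j) q \<le> card {e \<in> G. bnd (4 * D) e \<and> lab G D \<phi> j (q + e) \<noteq> 0} + 1"
proof -
  let ?Z = "{e \<in> G. bnd (4 * D) e \<and> lab G D \<phi> j (q + e) \<noteq> 0}"
  let ?P = "\<lambda>l. 1 \<le> l \<and> (\<forall>e\<in>G. bnd (4 * D) e \<longrightarrow> lab G D \<phi> j (q + e) \<noteq> l)"
  have fin: "finite ?Z" using finite_ball[of "4 * D"] by (rule finite_subset[rotated]) auto
  obtain l where l: "1 \<le> l" "l \<notin> (\<lambda>e. lab G D \<phi> j (q + e)) ` ?Z" "l \<le> card ((\<lambda>e. lab G D \<phi> j (q + e)) ` ?Z) + 1"
    using ex_free_label[of "(\<lambda>e. lab G D \<phi> j (q + e)) ` ?Z"] fin by blast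
  then have P: "?P l" by (fastforce simp: image_iff)
  have eq: "lab G D \<phi> (Suc j) q = (LEAST l. ?P l)" using assms by (simp add: lab.simps(2))
  have L: "?P (LEAST l. ?P l)" using P by (rule LeastI)
  show "1 \<le> lab G D \<phi> (Suc j) q" unfolding eq using L by blast
  show "e \<in> G \<Longrightarrow> bnd (4 * D) e \<Longrightarrow> lab G D \<phi> j (q + e) \<noteq> lab G D \<phi> (Suc j) q"
    unfolding eq using L by blast
  have "(LEAST l. ?P l) \<le> l" using P by (rule Least_le)
  also have "\<dots> \<le> card ?Z + 1" using l(3) card_image_le[OF fin, of "\<lambda>e. lab G D \<phi> j (q + e)"] by linarith
  finally show "lab G D \<phi> (Suc j) q \<le> card ?Z + 1" unfolding eq .
qed

lemma lab_old:
  assumes "\<not> (\<phi> q = j \<and> (\<forall>e\<in>G. bnd D e \<longrightarrow> lab G D \<phi> j (q + e) = 0))"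
  shows "lab G D \<phi> (Suc j) q = lab G D \<phi> j q"
  unfolding lab.simps by (rule if_not_P[OF assms])

lemma lab_Suc_nonzero:
  assumes "lab G D \<phi> j q \<noteq> 0"
  shows "lab G D \<phi> (Suc j) q = lab G D \<phi> j q"
proof (rule lab_old)
  show "\<not> (\<phi> q = j \<and> (\<forall>e\<in>G. bnd D e \<longrightarrow> lab G D \<phi> j (q + e) = 0))"
    using assms zero_G bnd_0[of D] by fastforce
qed

text \<open>When the colour of \<open>q\<close> has its turn, either a net point within
  \<open>D\<close> is already there or \<open>q\<close> enters the net itself; labels once given are
  kept.\<close>

lemma lab_dense:
  assumes "\<phi> q < j"
  shows "\<exists>e\<in>G. bnd D e \<and> lab G D \<phi> j (q + e) \<noteq> 0"
  using assms
proof (induction j)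
  case (Suc j)
  consider (1) "\<phi> q = j" "\<forall>e\<in>G. bnd D e \<longrightarrow> lab G D \<phi> j (q + e) = 0"
    | (2) "\<exists>e\<in>G. bnd D e \<and> lab G D \<phi> j (q + e) \<noteq> 0"
    using Suc by (metis less_Suc_eq)
  then show ?case
  proof cases
    case 1
    then have "1 \<le> lab G D \<phi> (Suc j) (q + 0)" using lab_new(1)[of \<phi> q j D] by simp
    then show ?thesis using zero_G bnd_0[of D] by (metis not_one_le_zero)
  next
    case 2
    then show ?thesis using lab_Suc_nonzero by metis
  qed
qed simp

text \<open>Pairs are compared only inside the ball of radius \<open>E\<close>, because the inputs
  will come from points that resemble the lattice only up to a finite radius. The margins between
  radii below stem from this.\<close>

definition proper :: "nat \<Rightarrow> nat \<Rightarrow> ((nat \<Rightarrow> int) \<Rightarrow> nat) \<Rightarrow> bool" where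
  "proper E \<Lambda> \<phi> \<longleftrightarrow> (\<forall>q\<in>G. \<forall>q'\<in>G. bnd E q \<and> bnd E q' \<and> q \<noteq> q' \<and> bnd \<Lambda> (q' - q) \<longrightarrow> \<phi> q \<noteq> \<phi> q')"

text \<open>Positions within \<open>4 * D\<close> have different colours, so they never decide at
  the same stage. The later one sees the earlier one: it avoids its label and, if closer than
  \<open>D\<close> or at \<open>D\<close>, stays out of the net.\<close>

lemma lab_separated:
  assumes "proper E (4 * D) \<phi>" "q \<in> G" "q' \<in> G" "bnd E q" "bnd E q'" "q \<noteq> q'" "bnd (4 * D) (q' - q)"
    "lab G D \<phi> j q \<noteq> 0" "lab G D \<phi> j q' \<noteq> 0"
  shows "lab G D \<phi> j q \<noteq> lab G D \<phi> j q' \<and> \<not> bnd D (q' - q)"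
  using assms(2-)
proof (induction j arbitrary: q q')
  case (Suc j)
  let ?new = "\<lambda>q. \<phi> q = j \<and> (\<forall>e\<in>G. bnd D e \<longrightarrow> lab G D \<phi> j (q + e) = 0)"
  have neq: "\<phi> q \<noteq> \<phi> q'" using assms(1) Suc.prems unfolding proper_def by blast
  have new: "lab G D \<phi> (Suc j) q \<noteq> lab G D \<phi> (Suc j) q' \<and> \<not> bnd D (q' - q)"
    if *: "?new q" "\<not> ?new q'" "q \<in> G" "q' \<in> G" "bnd (4 * D) (q' - q)" "lab G D \<phi> (Suc j) q' \<noteq> 0" for q q'
  proof -
    have q': "lab G D \<phi> (Suc j) q' = lab G D \<phi> j q'" using *(2) by (rule lab_old)
    have d: "q' - q \<in> G" "q + (q' - q) = q'" using *(3,4) diff_G by auto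
    note n = *(1)[THEN conjunct1] *(1)[THEN conjunct2, rule_format]
    have "lab G D \<phi> j (q + (q' - q)) \<noteq> lab G D \<phi> (Suc j) q"
      using n d(1) *(5) by (rule lab_new(2))
    then have "lab G D \<phi> j q' \<noteq> lab G D \<phi> (Suc j) q" unfolding d(2) .
    moreover have "bnd D (q' - q) \<Longrightarrow> lab G D \<phi> j (q + (q' - q)) = 0"
      using d(1) by (rule n(2))
    then have "\<not> bnd D (q' - q)" unfolding d(2) using *(6) q' by auto
    ultimately show ?thesis using q' by simp
  qed
  show ?case
  proof (cases "?new q")
    case True
    then have "\<phi> q' \<noteq> j" using neq by simp
    then have "\<not> ?new q'" by simp
    with True show ?thesis using Suc.prems(1,2,6,8) by (rule new)
  next
    case old: False
    show ?thesis
    proof (cases "?new q'")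
      case True
      have "bnd (4 * D) (q - q')" using Suc.prems(6) by (subst bnd_minus_commute)
      with True old Suc.prems(2,1) have "lab G D \<phi> (Suc j) q' \<noteq> lab G D \<phi> (Suc j) q \<and> \<not> bnd D (q - q')"
        using Suc.prems(7) by (rule new)
      then show ?thesis unfolding bnd_minus_commute[of D q q'] by (metis (lifting))
    next
      case False
      show ?thesis
        using Suc.prems(7,8) unfolding lab_old[OF old] lab_old[OF False] by (rule Suc.IH[OF Suc.prems(1-6)])
    qed
  qed
qed simp

text \<open>The range from \<open>- 4 * D\<close> to \<open>4 * D\<close> of each coordinate is cut
  into intervals of length \<open>D\<close>. There are nine of them, the last one met only by the
  end point \<open>4 * D\<close>, and two points in one cell would be within
  \<open>D\<close>.\<close>

lemma card_separated:
  assumes "1 \<le> D" "Z \<subseteq> {e \<in> G. bnd (4 * D) e}" "\<And>e e'. e \<in> Z \<Longrightarrow> e' \<in> Z \<Longrightarrow> e \<noteq> e' \<Longrightarrow> \<not> bnd D (e' - e)"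
  shows "card Z \<le> 9 ^ card I"
proof -
  let ?f = "\<lambda>e. restrict (\<lambda>i. (e i + 4 * int D) div int D) I"
  have "inj_on ?f Z"
  proof (rule inj_onI)
    fix e e' assume e: "e \<in> Z" "e' \<in> Z" "?f e = ?f e'"
    have "\<bar>(e' - e) i\<bar> \<le> int D" for i
    proof (cases "i \<in> I")
      case True
      then have "(e' i + 4 * int D) div int D = (e i + 4 * int D) div int D"
        using fun_cong[OF e(3), of i] by simp
      then show ?thesis using abs_diff_less_if_div_eq[of "int D" "e' i + 4 * int D" "e i + 4 * int D"] assms(1) by simp
    next
      case False
      then have "e i = 0" "e' i = 0" using supp_G e(1,2) assms(2) by blast+
      then show ?thesis by simp
    qed
    then show "e = e'" using assms(3) e unfolding bnd_def by blast
  qed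
  moreover have "?f ` Z \<subseteq> PiE I (\<lambda>_. {0..8})"
  proof -
    have "(e i + 4 * int D) div int D \<in> {0..8}" if "e \<in> Z" for e i
    proof -
      have "\<bar>e i\<bar> \<le> 4 * int D" using that assms(2) unfolding bnd_def by auto
      then have "0 \<le> e i + 4 * int D" "e i + 4 * int D \<le> 8 * int D" by linarith+
      moreover have "(8 * int D) div int D = 8" using assms(1) by simp
      ultimately show ?thesis
        using assms(1) zdiv_mono1[of "e i + 4 * int D" "8 * int D" "int D"]
          pos_imp_zdiv_nonneg_iff[of "int D" "e i + 4 * int D"] by (simp only: atLeastAtMost_iff)
    qed
    then show ?thesis by auto
  qed
  moreover have "finite (PiE I (\<lambda>_. {0..8::int}))" using fin_I by (simp add: finite_PiE)
  ultimately have "card Z \<le> card (PiE I (\<lambda>_. {0..8::int}))" by (rule card_inj_on_le)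
  also have "\<dots> = 9 ^ card I" using fin_I by (simp add: card_PiE)
  finally show ?thesis .
qed

text \<open>The occupied positions within \<open>4 * D\<close> of \<open>q\<close> are
  \<open>D\<close>-separated, so a new label has at most \<open>9 ^ card I\<close> others to avoid.
  The margin \<open>4 * D\<close> keeps these positions where \<phi> is proper.\<close>

lemma lab_le:
  assumes "1 \<le> D" "proper E (4 * D) \<phi>" "E' + 4 * D \<le> E" "bnd E' q" "q \<in> G"
  shows "lab G D \<phi> j q \<le> 9 ^ card I + 1"
proof (induction j)
  case (Suc j)
  let ?new = "\<phi> q = j \<and> (\<forall>e\<in>G. bnd D e \<longrightarrow> lab G D \<phi> j (q + e) = 0)"
  let ?Z = "{e \<in> G. bnd (4 * D) e \<and> lab G D \<phi> j (q + e) \<noteq> 0}"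
  show ?case
  proof (cases ?new)
    case True
    have inE: "bnd E (q + e)" if "bnd (4 * D) e" for e
      using bnd_mono[OF bnd_add[OF assms(4) that] assms(3)] .
    have "card ?Z \<le> 9 ^ card I"
    proof (rule card_separated[OF assms(1)])
      fix e e' assume e: "e \<in> ?Z" "e' \<in> ?Z" "e \<noteq> e'"
      show "\<not> bnd D (e' - e)"
      proof
        assume b: "bnd D (e' - e)"
        have "bnd (4 * D) (q + e' - (q + e))" using bnd_mono[OF b, of "4 * D"] by simp
        then have "\<not> bnd D (q + e' - (q + e))"
          using lab_separated[OF assms(2), of "q + e" "q + e'" j] e add_G assms(5) inE by simp
        then show False using b by simp
      qed
    qed auto
    then show ?thesis using lab_new(3)[of \<phi> q j D] True by fastforce
  next
    case False
    then show ?thesis using lab_old[OF False] Suc by simp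
  qed
qed simp

text \<open>Bound after merging the first \<open>l\<close> labels. The first product is the box
  bound at scale \<open>rad \<rho> l + 2 * \<rho>\<close>; the other summands are the cost of the
  union theorem.\<close>

primrec rad :: "nat \<Rightarrow> nat \<Rightarrow> nat" where
  "rad \<rho> 0 = 0"
| "rad \<rho> (Suc l) = (card I + 1) * (rad \<rho> l + 2 * \<rho> + 1) + 2 * rad \<rho> l + 2 * \<rho>"

lemma rad_mono: "l \<le> m \<Longrightarrow> rad \<rho> l \<le> rad \<rho> m"
  by (rule lift_Suc_mono_le[of "rad \<rho>"]) simp_all

text \<open>Here \<open>z\<close> is an offset: the position to be coloured is the origin.\<close>

definition center :: "nat \<Rightarrow> nat \<Rightarrow> ((nat \<Rightarrow> int) \<Rightarrow> nat) \<Rightarrow> nat \<Rightarrow> (nat \<Rightarrow> int) \<Rightarrow> bool" where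
  "center D N \<phi> l z \<longleftrightarrow> z \<in> G \<and> bnd D z \<and> lab G D \<phi> N z = l"

definition level :: "nat \<Rightarrow> nat \<Rightarrow> ((nat \<Rightarrow> int) \<Rightarrow> nat) \<Rightarrow> nat" where
  "level D N \<phi> = (LEAST l. 1 \<le> l \<and> (\<exists>z. center D N \<phi> l z))"

text \<open>A net point of least label within \<open>D\<close> serves as origin of the boxes, and
  \<open>- z\<close> is the coloured position relative to it. The scale grows with the label, as the
  union theorem demands when labels are merged in increasing order.\<close>

definition out :: "nat \<Rightarrow> nat \<Rightarrow> nat \<Rightarrow> ((nat \<Rightarrow> int) \<Rightarrow> nat) \<Rightarrow> nat" where
  "out \<rho> D N \<phi> = box_col I (rad \<rho> (level D N \<phi> - 1) + 2 * \<rho>) (- (SOME z. center D N \<phi> (level D N \<phi>) z))"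

lemma out_le: "out \<rho> D N \<phi> \<le> card I"
  unfolding out_def by (rule box_col(1)[OF fin_I])

lemma out_local:
  assumes "\<And>d. d \<in> G \<Longrightarrow> bnd (4 * D * N + D) d \<Longrightarrow> \<phi> d = \<phi>' d"
  shows "out \<rho> D N \<phi> = out \<rho> D N \<phi>'"
proof -
  have "center D N \<phi> l z = center D N \<phi>' l z" for l z
  proof (cases "z \<in> G \<and> bnd D z")
    case True
    have "lab G D \<phi> N z = lab G D \<phi>' N z"
    proof (rule lab_shift)
      fix d assume "d \<in> G" "bnd (4 * D * N) d"
      then show "\<phi> (z + d) = \<phi>' (z + d)"
        using True bnd_add[of D z "4 * D * N" d] by (intro assms add_G) (simp_all only: add.commute)
    qed (use True in blast)+
    then show ?thesis unfolding center_def by simp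
  qed (auto simp: center_def)
  then have "center D N \<phi> = center D N \<phi>'" by blast
  then show ?thesis unfolding out_def level_def by simp
qed

text \<open>On one label the origin cannot change along a chain with small steps, so the chain is
  one of the box colouring; the labels are then added one by one. Of the margin
  \<open>5 * D\<close>, one \<open>D\<close> reaches the net point and \<open>4 * D\<close> serves
  to bound its label.\<close>

lemma out_good:
  assumes D: "1 \<le> D" "\<And>l. l < 9 ^ card I + 1 \<Longrightarrow> rad \<rho> l + 2 * \<rho> \<le> D"
    and proper: "proper E (4 * D) \<phi>" and E: "E0 + 5 * D \<le> E"
    and N: "\<And>q. q \<in> G \<Longrightarrow> bnd E q \<Longrightarrow> \<phi> q < N"
  shows "good_col vnear (\<lambda>q. out \<rho> D N (\<lambda>d. \<phi> (q + d))) {q \<in> G. bnd E0 q} \<rho>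
    (rad \<rho> (9 ^ card I + 1))"
proof -
  define m where "m = (9::nat) ^ card I + 1"
  define lv where "lv q = level D N (\<lambda>d. \<phi> (q + d))" for q
  define c where "c q = q + (SOME z. center D N (\<lambda>d. \<phi> (q + d)) (lv q) z)" for q
  define sc where "sc l = rad \<rho> (l - 1) + 2 * \<rho>" for l
  define col where "col q = out \<rho> D N (\<lambda>d. \<phi> (q + d))" for q
  have shift: "lab G D (\<lambda>d. \<phi> (q + d)) N z = lab G D \<phi> N (q + z)" if "q \<in> G" "z \<in> G" for q z
    by (rule lab_shift) (use that add_G in \<open>simp_all only: add.assoc\<close>)
  have col_eq: "col q = box_col I (sc (lv q)) (q - c q)" for q
  proof -
    have "- z = q - (q + z)" for z by simp
    then have "- (SOME z. center D N (\<lambda>d. \<phi> (q + d)) (lv q) z) = q - c q"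
      unfolding c_def .
    then show ?thesis unfolding col_def out_def sc_def lv_def by (simp only:)
  qed
  have props: "1 \<le> lv q" "c q \<in> G" "bnd D (c q - q)" "lab G D \<phi> N (c q) = lv q" "lv q \<le> m"
    if q: "q \<in> G" "bnd E0 q" for q
  proof -
    let ?P = "\<lambda>l. 1 \<le> l \<and> (\<exists>z. center D N (\<lambda>d. \<phi> (q + d)) l z)"
    let ?z = "SOME z. center D N (\<lambda>d. \<phi> (q + d)) (lv q) z"
    have "bnd E q" using q(2) E by (elim bnd_mono) simp
    then have "\<phi> q < N" using N q(1) by blast
    then obtain e where e: "e \<in> G" "bnd D e" "lab G D \<phi> N (q + e) \<noteq> 0"
      using lab_dense by blast
    have "?P (lab G D \<phi> N (q + e))"
      using e shift[OF q(1) e(1)] unfolding center_def by (metis less_one not_le)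
    then have P: "?P (lv q)" unfolding lv_def level_def by (rule LeastI)
    then have "center D N (\<lambda>d. \<phi> (q + d)) (lv q) ?z" by (metis someI_ex)
    then have z: "?z \<in> G" "bnd D ?z" "lab G D (\<lambda>d. \<phi> (q + d)) N ?z = lv q"
      unfolding center_def by blast+
    show "1 \<le> lv q" using P by blast
    show cG: "c q \<in> G" unfolding c_def using q(1) z(1) by (rule add_G)
    have "c q - q = ?z" unfolding c_def by (rule add_diff_cancel_left')
    then show "bnd D (c q - q)" using z(2) by metis
    show lab: "lab G D \<phi> N (c q) = lv q" using shift[OF q(1) z(1)] z(3) unfolding c_def by metis
    have "bnd (E0 + D) (c q)" unfolding c_def using q(2) z(2) by (rule bnd_add)
    moreover have "E0 + D + 4 * D \<le> E" using E by simp
    ultimately have "lab G D \<phi> N (c q) \<le> 9 ^ card I + 1"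
      using lab_le[OF D(1) proper _ _ cG] by blast
    then show "lv q \<le> m" unfolding lab m_def .
  qed
  let ?A = "\<lambda>l. {q. q \<in> G \<and> bnd E0 q \<and> lv q = l}"
  \<comment> \<open>The two net points are at most \<open>D + D + D\<close> apart, hence within
    \<open>4 * D\<close>, where equal labels force equality.\<close>
  have sep: "c q = c q'" if q: "q \<in> ?A l" and q': "q' \<in> ?A l" and b: "bnd D (q - q')" for q q' l
  proof (rule ccontr)
    assume ne: "c q \<noteq> c q'"
    have qq: "q \<in> G" "bnd E0 q" "q' \<in> G" "bnd E0 q'" "lv q = lv q'" using q q' by auto
    have inE: "bnd E (c q)" if "q \<in> G" "bnd E0 q" for q
    proof -
      have "bnd (E0 + D) (q + (c q - q))" using that(2) props(3)[OF that] by (rule bnd_add)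
      moreover have "q + (c q - q) = c q" by simp
      ultimately have "bnd (E0 + D) (c q)" by metis
      then show ?thesis using E by (elim bnd_mono) simp
    qed
    have 1: "bnd D (c q' - q')" "bnd D (q' - q)" "bnd D (q - c q)"
      using props(3)[OF qq(3,4)] props(3)[OF qq(1,2)] b by (simp_all only: bnd_minus_commute)
    have "bnd (D + D + D) (c q' - c q)"
      using vec.near_add[OF vec.near_add[OF 1(1,2)] 1(3)] .
    then have "bnd (4 * D) (c q' - c q)" by (rule bnd_mono) simp
    then have "lab G D \<phi> N (c q) \<noteq> lab G D \<phi> N (c q')"
      using lab_separated[OF proper props(2)[OF qq(1,2)] props(2)[OF qq(3,4)] inE[OF qq(1,2)] inE[OF qq(3,4)] ne]
        props(1)[OF qq(1,2)] props(4)[OF qq(1,2)] props(1)[OF qq(3,4)] props(4)[OF qq(3,4)] by (metis not_one_le_zero)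
    then show False using props(4)[OF qq(1,2)] props(4)[OF qq(3,4)] qq(5) by simp
  qed
  have scD: "sc l \<le> D" if "1 \<le> l" "l \<le> m" for l
    unfolding sc_def using that by (intro D(2)) (simp add: m_def)
  have piece: "good_col vnear col (?A l) (sc l) ((card I + 1) * (sc l + 1))"
    if l: "1 \<le> l" "l \<le> m" for l
    unfolding good_col_def
  proof (intro allI impI)
    fix p q
    let ?V = "{q. \<forall>i. i \<notin> I \<longrightarrow> q i = (0::int)}"
    assume "(p, q) \<in> mono_chain vnear col (?A l) (sc l)"
    then have "p = q \<or> (c p = c q \<and> (p - c p, q - c p) \<in> mono_chain vnear (box_col I (sc l)) ?V (sc l))"
      unfolding mono_chain_def[of _ col]
    proof (induction rule: rtrancl_induct)
      case (step q s)
      then have qs: "q \<in> ?A l" "s \<in> ?A l" "col q = col s" "bnd (sc l) (q - s)" by auto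
      have "bnd D (q - s)" using qs(4) scD[OF l] by (rule bnd_mono)
      then have cc: "c q = c s" by (rule sep[OF qs(1,2)])
      have V: "x - c x \<in> ?V" if "x \<in> ?A l" for x
      proof -
        have "x \<in> G" "bnd E0 x" using that by auto
        then have "x - c x \<in> G" using props(2) diff_G by blast
        then show ?thesis using supp_G by blast
      qed
      have cp: "c p = c q" "(p - c p, q - c p) \<in> mono_chain vnear (box_col I (sc l)) ?V (sc l)"
        using step.IH vec.mono_chain_refl[of "p - c p"] by (auto simp only: disj_not1)
      have lvl: "lv q = l" "lv s = l" using qs(1,2) by auto
      have "(p - c p, s - c p) \<in> mono_chain vnear (box_col I (sc l)) ?V (sc l)"
      proof (rule vec.mono_chain_step[OF cp(2)])
        show "q - c p \<in> ?V" unfolding cp(1) using qs(1) by (rule V)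
        show "s - c p \<in> ?V" unfolding cp(1) cc using qs(2) by (rule V)
        show "box_col I (sc l) (q - c p) = box_col I (sc l) (s - c p)"
          using qs(3) unfolding col_eq lvl cp(1) cc .
        have "q - c p - (s - c p) = q - s" by simp
        then show "bnd (sc l) (q - c p - (s - c p))" using qs(4) by metis
      qed
      moreover have "c p = c s" using cp(1) cc by (rule trans)
      ultimately show ?case by (intro disjI2 conjI)
    qed simp
    then show "bnd ((card I + 1) * (sc l + 1)) (p - q)"
    proof
      assume "c p = c q \<and> (p - c p, q - c p) \<in> mono_chain vnear (box_col I (sc l)) ?V (sc l)"
      then have "bnd ((card I + 1) * (sc l + 1)) (p - c p - (q - c p))"
        using box_col_good[OF fin_I, of "sc l"] unfolding good_col_def by blast
      moreover have "p - c p - (q - c p) = p - q" by simp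
      ultimately show ?thesis by metis
    next
      assume "p = q"
      then show ?thesis using vec.near_refl by blast
    qed
  qed
  have "good_col vnear col (\<Union>l\<in>{1..j}. ?A l) \<rho> (rad \<rho> j)" if "j \<le> m" for j
    using that
  proof (induction j)
    case 0
    show ?case unfolding good_col_def
    proof (intro allI impI)
      fix p q assume "(p, q) \<in> mono_chain vnear col (\<Union>l\<in>{1..0}. ?A l) \<rho>"
      then have "p = q" by (simp add: mono_chain_def)
      then show "bnd (rad \<rho> 0) (p - q)" using vec.near_refl by blast
    qed
  next
    case (Suc j)
    have "sc (Suc j) = rad \<rho> j + 2 * \<rho>" unfolding sc_def by simp
    then have "good_col vnear col (?A (Suc j)) (rad \<rho> j + 2 * \<rho>) ((card I + 1) * (rad \<rho> j + 2 * \<rho> + 1))"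
      using piece[of "Suc j"] Suc.prems by (metis le_add1 plus_1_eq_Suc)
    from vec.good_col_Un[OF Suc.IH this]
    have "good_col vnear col ((\<Union>l\<in>{1..j}. ?A l) \<union> ?A (Suc j)) \<rho> (rad \<rho> (Suc j))"
      using Suc.prems by simp
    moreover have "(\<Union>l\<in>{1..Suc j}. ?A l) = (\<Union>l\<in>{1..j}. ?A l) \<union> ?A (Suc j)"
      using atLeastAtMostSuc_conv[of 1 j] by auto
    ultimately show ?case by (simp only:)
  qed
  from this[OF order_refl] show ?thesis
    unfolding col_def[symmetric] m_def[symmetric]
  proof (rule vec.good_col_subset)
    show "{q \<in> G. bnd E0 q} \<subseteq> (\<Union>l\<in>{1..m}. ?A l)" using props(1,5) by auto
  qed simp_all
qed

text \<open>The order of the quantifiers is the point: \<Lambda> and \<open>R\<close> are fixed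
  before the number \<open>N\<close> of input colours, and only the radius \<open>E\<close> depends
  on \<open>N\<close>. The ball of radius \<open>R + \<rho>\<close> suffices, since a monochromatic
  chain from the origin stays within \<open>R\<close> and one more step cannot leave that
  ball.\<close>

lemma local_rule:
  obtains \<Lambda> R where "\<And>N. \<exists>E out. (\<forall>\<phi>. out \<phi> \<le> card I) \<and>
    (\<forall>\<phi> \<phi>'. (\<forall>d\<in>G. bnd E d \<longrightarrow> \<phi> d = \<phi>' d) \<longrightarrow> out \<phi> = out \<phi>') \<and>
    (\<forall>\<phi>. proper E \<Lambda> \<phi> \<longrightarrow> (\<forall>d\<in>G. bnd E d \<longrightarrow> \<phi> d < N) \<longrightarrow>
      good_col vnear (\<lambda>q. out (\<lambda>d. \<phi> (q + d))) {q \<in> G. bnd (R + \<rho>) q} \<rho> R)"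
proof -
  define R where "R = rad \<rho> (9 ^ card I + 1)"
  define D where "D = R + 2 * \<rho> + 1"
  have D: "1 \<le> D" "rad \<rho> l + 2 * \<rho> \<le> D" if "l < 9 ^ card I + 1" for l
    using rad_mono[of l "9 ^ card I + 1" \<rho>] that unfolding D_def R_def by simp_all
  show ?thesis
  proof (rule that[of "4 * D" R], intro exI conjI allI impI)
    fix N and \<phi> \<phi>' :: "(nat \<Rightarrow> int) \<Rightarrow> nat"
    \<comment> \<open>\<open>R + \<rho> + 5 * D\<close> is the radius that boundedness requires;
      \<open>4 * D * N\<close> is the reach of the \<open>N\<close> stages of the net.\<close>
    let ?E = "R + \<rho> + 5 * D + 4 * D * N"
    show "out \<rho> D N \<phi> \<le> card I" by (rule out_le)
    show "out \<rho> D N \<phi> = out \<rho> D N \<phi>'" if "\<forall>d\<in>G. bnd ?E d \<longrightarrow> \<phi> d = \<phi>' d"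
    proof (rule out_local)
      fix d assume "d \<in> G" "bnd (4 * D * N + D) d"
      then show "\<phi> d = \<phi>' d" using that bnd_mono[of "4 * D * N + D" d ?E] by simp
    qed
    show "good_col vnear (\<lambda>q. out \<rho> D N (\<lambda>d. \<phi> (q + d))) {q \<in> G. bnd (R + \<rho>) q} \<rho> R"
      if "proper ?E (4 * D) \<phi>" "\<forall>d\<in>G. bnd ?E d \<longrightarrow> \<phi> d < N"
      unfolding R_def[symmetric]
      using out_good[OF _ _ that(1), of \<rho> "R + \<rho>" N] D that(2) unfolding R_def[symmetric] by auto
  qed
qed

end


section \<open>Commuting maps and heights of words\<close>

definition act_word :: "('m \<Rightarrow> 'x \<Rightarrow> 'x) \<Rightarrow> 'm multiset \<Rightarrow> 'x \<Rightarrow> 'x" where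
  "act_word f w x = fold_mset f x w"

locale commuting =
  fixes S :: "'m set" and f :: "'m \<Rightarrow> 'x \<Rightarrow> 'x"
  assumes fin_S: "finite S"
    and comm: "f s (f t x) = f t (f s x)"
begin

sublocale comp_fun_commute f
  by standard (simp add: fun_eq_iff comm)

lemma act_empty [simp]: "act_word f {#} x = x"
  by (simp add: act_word_def)

lemma act_add_mset [simp]: "act_word f (add_mset s w) x = f s (act_word f w x)"
  by (simp add: act_word_def)

lemma act_union: "act_word f (u + v) x = act_word f u (act_word f v x)"
  by (induction u) simp_all

lemma act_commute: "act_word f u (act_word f v x) = act_word f v (act_word f u x)"
  by (metis act_union add.commute)

definition W :: "'m multiset set" where
  "W = {w. set_mset w \<subseteq> S}"

lemma W_empty [simp]: "{#} \<in> W"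
  by (simp add: W_def)

lemma W_union [simp]: "u + v \<in> W \<longleftrightarrow> u \<in> W \<and> v \<in> W"
  by (auto simp: W_def)

lemma W_add_mset [simp]: "add_mset s w \<in> W \<longleftrightarrow> s \<in> S \<and> w \<in> W"
  by (auto simp: W_def)

lemma W_sum: "(\<And>a. a \<in> A \<Longrightarrow> g a \<in> W) \<Longrightarrow> sum g A \<in> W"
  by (induction A rule: infinite_finite_induct) auto

lemma W_repeat: "w \<in> W \<Longrightarrow> repeat_mset k w \<in> W"
  by (induction k) simp_all

lemma finite_W: "finite {w \<in> W. size w \<le> k}"
proof (rule finite_subset)
  show "{w \<in> W. size w \<le> k} \<subseteq> mset ` {xs. set xs \<subseteq> S \<and> length xs \<le> k}"
  proof
    fix w assume "w \<in> {w \<in> W. size w \<le> k}"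
    moreover obtain xs where "w = mset xs" by (metis ex_mset)
    ultimately show "w \<in> mset ` {xs. set xs \<subseteq> S \<and> length xs \<le> k}" by (auto simp: W_def)
  qed
qed (simp add: fin_S finite_lists_length_le)

text \<open>The witness contains every generator \<open>r\<close> times. Acting by \<open>U\<close>
  factors through the action of any \<open>u\<close> of length at most \<open>r\<close>, which later
  absorbs a step to a neighbouring point.\<close>

lemma ex_W_cover: "\<exists>U\<in>W. \<forall>u\<in>W. size u \<le> r \<longrightarrow> u \<subseteq># U"
proof (intro bexI ballI impI)
  show "repeat_mset r (mset_set S) \<in> W"
    by (rule W_repeat) (simp add: W_def fin_S)
  fix u assume u: "u \<in> W" "size u \<le> r"
  show "u \<subseteq># repeat_mset r (mset_set S)"
  proof (rule mset_subset_eqI)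
    fix s
    have "count u s \<le> r" using u(2) count_le_size[of u s] by linarith
    moreover have "count u s = 0" if "s \<notin> S" using u(1) that by (auto simp: W_def count_eq_zero_iff)
    ultimately show "count u s \<le> count (repeat_mset r (mset_set S)) s"
      using fin_S by (cases "s \<in> S") auto
  qed
qed

text \<open>For commuting maps a path can be rearranged to go forward first and backward afterwards,
  so this describes the path metric of the Schreier graph.\<close>

definition near :: "nat \<Rightarrow> 'x \<Rightarrow> 'x \<Rightarrow> bool" where
  "near k x y \<longleftrightarrow> (\<exists>u\<in>W. \<exists>v\<in>W. size u + size v \<le> k \<and> act_word f u x = act_word f v y)"

sublocale near: coarse near
proof
  show "near k x x" for k x unfolding near_def using W_empty by (intro bexI[of _ "{#}"]) auto
  show "near k x y \<Longrightarrow> near k y x" for k x y unfolding near_def by (metis add.commute)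
  show "near j x y \<Longrightarrow> j \<le> k \<Longrightarrow> near k x y" for j k x y unfolding near_def by (meson order_trans)
  show "near (j + k) x z" if xy: "near j x y" and yz: "near k y z" for j k x y z
  proof -
    obtain u v where u: "u \<in> W" "v \<in> W" "size u + size v \<le> j" "act_word f u x = act_word f v y"
      using xy unfolding near_def by blast
    obtain u' v' where v: "u' \<in> W" "v' \<in> W" "size u' + size v' \<le> k" "act_word f u' y = act_word f v' z"
      using yz unfolding near_def by blast
    have "act_word f (u' + u) x = act_word f (v + v') z"
      using u(4) v(4) by (metis act_union act_commute)
    moreover have "size (u' + u) + size (v + v') \<le> j + k" using u(3) v(3) by simp
    ultimately show ?thesis unfolding near_def using u v by (metis W_union)
  qed
qed

lemma nearI: "u \<in> W \<Longrightarrow> v \<in> W \<Longrightarrow> size u + size v \<le> k \<Longrightarrow> act_word f u x = act_word f v y \<Longrightarrow> near k x y"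
  unfolding near_def by blast

lemma fiber_act:
  assumes fib: "\<And>s x. s \<in> S \<Longrightarrow> finite {y. f s y = x} \<and> card {y. f s y = x} \<le> K" and "w \<in> W"
  shows "finite {y. act_word f w y = x} \<and> card {y. act_word f w y = x} \<le> K ^ size w"
  using assms(2)
proof (induction w arbitrary: x)
  case (add s w)
  have eq: "{y. act_word f (add_mset s w) y = x} = (\<Union>z\<in>{z. f s z = x}. {y. act_word f w y = z})" by auto
  have s: "s \<in> S" "w \<in> W" using add.prems by auto
  have "card {y. act_word f (add_mset s w) y = x} \<le> (\<Sum>z\<in>{z. f s z = x}. card {y. act_word f w y = z})"
    unfolding eq using fib[OF s(1)] by (intro card_UN_le) blast
  also have "\<dots> \<le> card {z. f s z = x} * K ^ size w"
    using sum_bounded_above[of "{z. f s z = x}" "\<lambda>z. card {y. act_word f w y = z}" "K ^ size w"] add.IH[OF s(2)] by simp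
  also have "\<dots> \<le> K * K ^ size w" using fib[OF s(1)] by (intro mult_right_mono) auto
  finally have "card {y. act_word f (add_mset s w) y = x} \<le> K ^ size (add_mset s w)" by simp
  moreover have "finite {y. act_word f (add_mset s w) y = x}"
    unfolding eq using fib[OF s(1)] add.IH[OF s(2)] by blast
  ultimately show ?case by blast
qed simp

text \<open>A point within \<open>k\<close> of \<open>x\<close> lies in the fibre of a short word
  over the image of \<open>x\<close> under another short word; there are finitely many words, and
  their fibres are bounded by \<open>fiber_act\<close>.\<close>

lemma ball_bound:
  assumes fib: "\<And>s x. s \<in> S \<Longrightarrow> finite {y. f s y = x} \<and> card {y. f s y = x} \<le> K"
  obtains N where "\<And>x. finite {y. near k x y} \<and> card {y. near k x y} \<le> N"
proof -
  let ?W = "{w \<in> W. size w \<le> k}"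
  have fin: "finite (?W \<times> ?W)" using finite_W by blast
  have F: "finite {y. act_word f v y = z} \<and> card {y. act_word f v y = z} \<le> (K + 1) ^ k" if "v \<in> ?W" for v z
  proof -
    have "K ^ size v \<le> (K + 1) ^ size v" by (rule power_mono) simp_all
    also have "\<dots> \<le> (K + 1) ^ k" using that by (intro power_increasing) simp_all
    finally have "K ^ size v \<le> (K + 1) ^ k" .
    moreover have "finite {y. act_word f v y = z} \<and> card {y. act_word f v y = z} \<le> K ^ size v"
      using that by (intro fiber_act[OF fib]) simp_all
    ultimately show ?thesis by linarith
  qed
  have B: "finite {y. near k x y} \<and> card {y. near k x y} \<le> card (?W \<times> ?W) * (K + 1) ^ k" for x
  proof -
    let ?B = "\<Union>(u, v)\<in>?W \<times> ?W. {y. act_word f v y = act_word f u x}"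
    have sub: "{y. near k x y} \<subseteq> ?B"
    proof
      fix y assume "y \<in> {y. near k x y}"
      then obtain u v where "u \<in> W" "v \<in> W" "size u + size v \<le> k" "act_word f u x = act_word f v y"
        unfolding near_def by blast
      then have "(u, v) \<in> ?W \<times> ?W" "act_word f v y = act_word f u x" by auto
      then show "y \<in> ?B" by blast
    qed
    have finB: "finite ?B" using F fin by auto
    have "card ?B \<le> (\<Sum>(u, v)\<in>?W \<times> ?W. card {y. act_word f v y = act_word f u x})"
      using card_UN_le[OF fin, of "\<lambda>(u, v). {y. act_word f v y = act_word f u x}"] by (simp add: case_prod_unfold)
    also have "\<dots> \<le> card (?W \<times> ?W) * (K + 1) ^ k"
      using sum_bounded_above[of "?W \<times> ?W" "\<lambda>(u, v). card {y. act_word f v y = act_word f u x}" "(K + 1) ^ k"] F by auto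
    finally have "card ?B \<le> card (?W \<times> ?W) * (K + 1) ^ k" .
    then show ?thesis using card_mono[OF finB sub] finite_subset[OF sub finB] by linarith
  qed
  show thesis by (rule that) (rule B)
qed

end

text \<open>Greedy choice along a well-order of the whole type: at most \<open>N\<close> earlier
  neighbours leave one of the \<open>N + 1\<close> colours free.\<close>

lemma ex_proper_colouring:
  fixes adj :: "'x \<Rightarrow> 'x \<Rightarrow> bool"
  assumes sym: "\<And>x y. adj x y \<Longrightarrow> adj y x"
    and deg: "\<And>x. finite {y. adj x y} \<and> card {y. adj x y} \<le> N"
  obtains \<kappa> :: "'x \<Rightarrow> nat" where "\<And>x. \<kappa> x \<le> N" "\<And>x y. adj x y \<Longrightarrow> x \<noteq> y \<Longrightarrow> \<kappa> x \<noteq> \<kappa> y"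
proof -
  obtain r :: "'x rel" where r: "well_order_on UNIV r" using well_order_on by blast
  define R where "R = r - Id"
  have wf: "wf R" using r unfolding well_order_on_def R_def by blast
  have tot: "(x, y) \<in> R \<or> (y, x) \<in> R" if "x \<noteq> y" for x y
    using r that unfolding well_order_on_def linear_order_on_def total_on_def R_def by blast
  let ?P = "\<lambda>\<kappa> x c. c \<le> N \<and> (\<forall>y. (y, x) \<in> R \<and> adj x y \<longrightarrow> \<kappa> y \<noteq> (c :: nat))"
  have "\<exists>\<kappa>. \<forall>x. ?P \<kappa> x (\<kappa> x)"
  proof (rule dependent_wf_choice[OF wf])
    fix x and \<kappa> :: "'x \<Rightarrow> nat"
    have fin: "finite (\<kappa> ` {y. adj x y})" using deg by blast
    have "card (\<kappa> ` {y. adj x y}) \<le> N" using card_image_le[of "{y. adj x y}" \<kappa>] deg[of x] by linarith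
    then have "card (\<kappa> ` {y. adj x y}) < card {..N}" by simp
    then have "\<not> {..N} \<subseteq> \<kappa> ` {y. adj x y}" using card_mono[OF fin, of "{..N}"] by linarith
    then obtain c where "c \<le> N" "c \<notin> \<kappa> ` {y. adj x y}" by auto
    then show "\<exists>c. ?P \<kappa> x c" by blast
  qed metis
  then obtain \<kappa> where \<kappa>: "\<And>x. ?P \<kappa> x (\<kappa> x)" by blast
  show thesis
  proof (rule that[of \<kappa>])
    show "\<kappa> x \<noteq> \<kappa> y" if "adj x y" "x \<noteq> y" for x y
      using tot[OF that(2)] \<kappa>[of x] \<kappa>[of y] that(1) sym[OF that(1)] by metis
  qed (use \<kappa> in blast)
qed

section \<open>Words that agree after a common continuation\<close>

context commuting
begin

text \<open>For words over \<open>S\<close> this is equality in the group completion of the monoid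
  of maps that they generate, hence the cancellation law below.\<close>

definition ev :: "'m multiset \<Rightarrow> 'm multiset \<Rightarrow> bool" where
  "ev u v \<longleftrightarrow> (\<exists>c\<in>W. \<forall>x. act_word f (c + u) x = act_word f (c + v) x)"

lemma ev_sym: "ev u v \<Longrightarrow> ev v u"
  unfolding ev_def by metis

lemma ev_trans:
  assumes "ev u v" "ev v w"
  shows "ev u w"
proof -
  obtain c d where c: "c \<in> W" "\<And>x. act_word f (c + u) x = act_word f (c + v) x"
    and d: "d \<in> W" "\<And>x. act_word f (d + v) x = act_word f (d + w) x" using assms unfolding ev_def by blast
  have "act_word f (c + d + u) x = act_word f (c + d + w) x" for x
  proof -
    have "act_word f (c + d + u) x = act_word f (c + u) (act_word f d x)" by (simp add: act_union[symmetric] ac_simps)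
    also have "\<dots> = act_word f (d + v) (act_word f c x)" unfolding c(2) by (simp add: act_union[symmetric] ac_simps)
    also have "\<dots> = act_word f (c + d + w) x" unfolding d(2) by (simp add: act_union[symmetric] ac_simps)
    finally show ?thesis .
  qed
  then show ?thesis unfolding ev_def using c d by (metis W_union)
qed

lemma ev_add: "ev u v \<Longrightarrow> ev (u + z) (v + z)"
  unfolding ev_def by (metis act_union add.assoc)

lemma ev_cancel: "ev (u + z) (v + z) \<Longrightarrow> z \<in> W \<Longrightarrow> ev u v"
proof -
  assume "ev (u + z) (v + z)" and z: "z \<in> W"
  then obtain c where c: "c \<in> W" "\<And>x. act_word f (c + (u + z)) x = act_word f (c + (v + z)) x"
    unfolding ev_def by blast
  have eq: "c + z + w = c + (w + z)" for w by (simp add: ac_simps)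
  show "ev u v" unfolding ev_def
    using c(1) z by (intro bexI[of _ "c + z"]) (auto simp only: W_union eq c(2))
qed

text \<open>A witness may be prolonged by any word of \<open>W\<close>, so the sum of the witnesses
  serves finitely many pairs at once.\<close>

lemma common_witness:
  assumes "finite F" "\<And>u v. (u, v) \<in> F \<Longrightarrow> ev u v"
  obtains c where "c \<in> W" "\<And>u v x. (u, v) \<in> F \<Longrightarrow> act_word f (c + u) x = act_word f (c + v) x"
proof -
  have "\<exists>c\<in>W. \<forall>(u, v)\<in>F. \<forall>x. act_word f (c + u) x = act_word f (c + v) x"
    using assms
  proof (induction F rule: finite_induct)
    case empty
    show ?case using W_empty by blast
  next
    case (insert p F)
    obtain u v where p: "p = (u, v)" by force
    obtain c where c: "c \<in> W" "\<And>a b x. (a, b) \<in> F \<Longrightarrow> act_word f (c + a) x = act_word f (c + b) x"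
      using insert.IH insert.prems by fastforce
    obtain d where d: "d \<in> W" "\<And>x. act_word f (d + u) x = act_word f (d + v) x"
      using insert.prems[of u v] p unfolding ev_def by blast
    have "act_word f (c + d + a) x = act_word f (c + d + b) x" if "(a, b) \<in> insert p F" for a b x
    proof (cases "(a, b) \<in> F")
      case True
      have "act_word f (c + d + a) x = act_word f d (act_word f (c + a) x)" by (simp only: act_union act_commute[of d])
      also have "\<dots> = act_word f (c + d + b) x" by (simp only: c(2)[OF True]) (simp only: act_union act_commute[of d])
      finally show ?thesis .
    next
      case False
      then have "a = u" "b = v" using that p by auto
      then show ?thesis using d(2) by (metis act_union add.assoc)
    qed
    then show ?case using c(1) d(1) by (intro bexI[of _ "c + d"]) auto
  qed
  then show thesis using that by blast
qed

lemma common_witness_size: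
  obtains c where "c \<in> W" "\<And>u v x. u \<in> W \<Longrightarrow> v \<in> W \<Longrightarrow> size u \<le> m \<Longrightarrow> size v \<le> m \<Longrightarrow> ev u v \<Longrightarrow>
    act_word f (c + u) x = act_word f (c + v) x"
proof -
  let ?F = "{(u, v) \<in> {w \<in> W. size w \<le> m} \<times> {w \<in> W. size w \<le> m}. ev u v}"
  have "finite ?F" by (rule finite_subset[of _ "{w \<in> W. size w \<le> m} \<times> {w \<in> W. size w \<le> m}"]) (use finite_W in auto)
  then show thesis by (rule common_witness) (use that in auto)
qed

end

text \<open>\<open>p s\<close> is the height of the generator \<open>s\<close>. An arbitrary finite
  index set \<open>I\<close>, in place of an initial segment, lets the induction remove a coordinate
  without renumbering.\<close>

locale heights = commuting S f for S :: "'m set" and f :: "'m \<Rightarrow> 'x \<Rightarrow> 'x" +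
  fixes I :: "nat set" and p :: "'m \<Rightarrow> nat \<Rightarrow> int"
  assumes fin_I: "finite I"
    and supp_p: "s \<in> S \<Longrightarrow> i \<notin> I \<Longrightarrow> p s i = 0"
begin

definition hgt :: "'m multiset \<Rightarrow> nat \<Rightarrow> int" where
  "hgt w = (\<lambda>i. \<Sum>s\<in>#w. p s i)"

lemma hgt_empty [simp]: "hgt {#} = 0"
  by (simp add: hgt_def fun_eq_iff)

lemma hgt_union: "hgt (u + v) = hgt u + hgt v"
  by (simp add: hgt_def fun_eq_iff)

lemma hgt_add_mset: "hgt (add_mset s w) i = p s i + hgt w i"
  by (simp add: hgt_def)

lemma hgt_repeat: "hgt (repeat_mset k w) i = int k * hgt w i"
  by (induction k) (simp_all add: hgt_union algebra_simps)

lemma hgt_supp: "w \<in> W \<Longrightarrow> i \<notin> I \<Longrightarrow> hgt w i = 0"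
  by (induction w) (simp_all add: hgt_add_mset supp_p)

definition Grp :: "(nat \<Rightarrow> int) set" where
  "Grp = {q. \<exists>u\<in>W. \<exists>v\<in>W. q = hgt u - hgt v}"

lemma GrpI: "u \<in> W \<Longrightarrow> v \<in> W \<Longrightarrow> hgt u - hgt v \<in> Grp"
  unfolding Grp_def by blast

sublocale vec_group I Grp
proof
  show "0 \<in> Grp" unfolding Grp_def using W_empty by (intro CollectI bexI[of _ "{#}"]) simp_all
  show "q + q' \<in> Grp" if q: "q \<in> Grp" "q' \<in> Grp" for q q'
  proof -
    obtain u v u' v' where w: "u \<in> W" "v \<in> W" "q = hgt u - hgt v" "u' \<in> W" "v' \<in> W" "q' = hgt u' - hgt v'"
      using q unfolding Grp_def by blast
    have "q + q' = hgt (u + u') - hgt (v + v')" unfolding w(3,6) hgt_union by simp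
    then show ?thesis using GrpI[of "u + u'" "v + v'"] w by simp
  qed
  show "- q \<in> Grp" if "q \<in> Grp" for q
  proof -
    obtain u v where w: "u \<in> W" "v \<in> W" "q = hgt u - hgt v" using \<open>q \<in> Grp\<close> unfolding Grp_def by blast
    have "- q = hgt v - hgt u" unfolding w(3) by simp
    then show ?thesis using GrpI[of v u] w by simp
  qed
  show "q i = 0" if "q \<in> Grp" "i \<notin> I" for q i
    using that hgt_supp unfolding Grp_def by auto
qed (rule fin_I)

lemma hgt_bound:
  obtains A where "\<And>w. w \<in> W \<Longrightarrow> bnd (A * size w) (hgt w)"
proof -
  define A where "A = (\<Sum>s\<in>S. \<Sum>i\<in>I. nat \<bar>p s i\<bar>)"
  have A: "\<bar>p s i\<bar> \<le> int A" if "s \<in> S" for s i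
  proof (cases "i \<in> I")
    case True
    have "nat \<bar>p s i\<bar> \<le> (\<Sum>i\<in>I. nat \<bar>p s i\<bar>)" using True fin_I by (intro member_le_sum) auto
    also have "\<dots> \<le> A" unfolding A_def using that fin_S
      by (intro member_le_sum[of s S "\<lambda>s. \<Sum>i\<in>I. nat \<bar>p s i\<bar>"]) auto
    finally show ?thesis by linarith
  qed (simp add: supp_p that)
  show thesis
  proof (rule that)
    show "bnd (A * size w) (hgt w)" if "w \<in> W" for w
      using that
    proof (induction w)
      case (add s w)
      then have w: "s \<in> S" "\<And>i. \<bar>hgt w i\<bar> \<le> int (A * size w)" by (auto simp: bnd_def)
      have "\<bar>hgt (add_mset s w) i\<bar> \<le> int (A * size (add_mset s w))" for i
        using A[OF w(1), of i] w(2)[of i] by (simp add: hgt_add_mset algebra_simps)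
      then show ?case unfolding bnd_def by blast
    qed simp
  qed
qed

lemma Grp_words:
  obtains g h where "\<And>q. q \<in> Grp \<Longrightarrow> g q \<in> W \<and> h q \<in> W \<and> q = hgt (g q) - hgt (h q)"
proof -
  have "\<forall>q\<in>Grp. \<exists>u v. u \<in> W \<and> v \<in> W \<and> q = hgt u - hgt v" unfolding Grp_def by blast
  then show thesis using that by metis
qed

lemma small_words:
  obtains k where "\<And>q. q \<in> Grp \<Longrightarrow> bnd E q \<Longrightarrow>
    \<exists>u\<in>W. \<exists>v\<in>W. q = hgt u - hgt v \<and> size u \<le> k \<and> size v \<le> k"
proof -
  obtain g h where gh: "\<And>q. q \<in> Grp \<Longrightarrow> g q \<in> W \<and> h q \<in> W \<and> q = hgt (g q) - hgt (h q)"
    by (rule Grp_words) blast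
  define k where "k = (\<Sum>q\<in>{q \<in> Grp. bnd E q}. size (g q) + size (h q))"
  show thesis
  proof (rule that[of k])
    fix q assume q: "q \<in> Grp" "bnd E q"
    have "size (g q) + size (h q) \<le> k"
      unfolding k_def using q finite_ball[of E] by (intro member_le_sum) simp_all
    then show "\<exists>u\<in>W. \<exists>v\<in>W. q = hgt u - hgt v \<and> size u \<le> k \<and> size v \<le> k"
      using gh[OF q(1)] by (intro bexI[of _ "g q"] bexI[of _ "h q"]) simp_all
  qed
qed

text \<open>Only finitely many differences of heights are involved, so a common denominator turns them
  into heights of words.\<close>
lemma push_words:
  obtains B w where "\<And>q. q \<in> Grp \<Longrightarrow> bnd E q \<Longrightarrow> w q \<in> W \<and> hgt (w q) = B + q"
proof -
  let ?F = "{q \<in> Grp. bnd E q}"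
  obtain g h where gh: "\<And>q. q \<in> Grp \<Longrightarrow> g q \<in> W \<and> h q \<in> W \<and> q = hgt (g q) - hgt (h q)"
    by (rule Grp_words) blast
  show thesis
  proof (rule that[of "\<lambda>q. g q + (\<Sum>d\<in>?F - {q}. h d)" "hgt (\<Sum>d\<in>?F. h d)"])
    fix q assume q: "q \<in> Grp" "bnd E q"
    have "(\<Sum>d\<in>?F. h d) = h q + (\<Sum>d\<in>?F - {q}. h d)"
      using q finite_ball[of E] by (intro sum.remove) auto
    then have "hgt (\<Sum>d\<in>?F. h d) = hgt (h q) + hgt (\<Sum>d\<in>?F - {q}. h d)"
      using hgt_union by metis
    moreover have "q = hgt (g q) - hgt (h q)" using gh q by blast
    ultimately have "hgt (g q + (\<Sum>d\<in>?F - {q}. h d)) = hgt (\<Sum>d\<in>?F. h d) + q"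
      unfolding hgt_union by (auto simp: fun_eq_iff)
    moreover have "g q + (\<Sum>d\<in>?F - {q}. h d) \<in> W"
      using gh q by (auto intro!: W_sum)
    ultimately show "g q + (\<Sum>d\<in>?F - {q}. h d) \<in> W \<and>
        hgt (g q + (\<Sum>d\<in>?F - {q}. h d)) = hgt (\<Sum>d\<in>?F. h d) + q" by blast
  qed
qed

text \<open>The height has finite kernel on the group of formal differences of words modulo \<open>ev\<close>.\<close>
definition finker :: bool where
  "finker \<longleftrightarrow> (\<exists>F \<subseteq> W \<times> W. finite F \<and>
     (\<forall>u\<in>W. \<forall>v\<in>W. hgt u = hgt v \<longrightarrow> (\<exists>(a, b)\<in>F. ev (u + b) (v + a))))"

text \<open>\<open>P\<close> is a translate of the finite kernel: over the common denominator
  \<open>T\<close>, the kernel elements \<open>fst q - snd q\<close> become words of equal height.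
  Adding a kernel element permutes such a translate modulo \<open>ev\<close>, which is the last
  property.\<close>

lemma torsion_transversal:
  assumes finker
  obtains P where "finite P" "P \<noteq> {}" "P \<subseteq> W" "\<And>a b. a \<in> P \<Longrightarrow> b \<in> P \<Longrightarrow> hgt a = hgt b"
    "\<And>u v a. u \<in> W \<Longrightarrow> v \<in> W \<Longrightarrow> hgt u = hgt v \<Longrightarrow> a \<in> P \<Longrightarrow> \<exists>b\<in>P. ev (u + a) (v + b)"
proof -
  obtain F0 where F0: "F0 \<subseteq> W \<times> W" "finite F0"
    "\<And>u v. u \<in> W \<Longrightarrow> v \<in> W \<Longrightarrow> hgt u = hgt v \<Longrightarrow> \<exists>(a, b)\<in>F0. ev (u + b) (v + a)"
    using assms unfolding finker_def by blast
  let ?eq = "\<lambda>(u, v) (a, b). ev (u + b) (v + a)"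
  let ?K = "{(u, v) \<in> W \<times> W. hgt u = hgt v}"
  \<comment> \<open>\<open>F0\<close> may contain pairs of unequal height; \<open>g\<close> replaces
    a pair by one of equal height in the same class, if there is one.\<close>
  define g where "g q = (SOME k. k \<in> ?K \<and> ?eq k q)" for q
  define F where "F = g ` {q \<in> F0. \<exists>k\<in>?K. ?eq k q}"
  have g: "g q \<in> ?K \<and> ?eq (g q) q" if "k \<in> ?K" "?eq k q" for k q
    unfolding g_def by (rule someI[of _ k]) (use that in blast)
  have F1: "finite F" unfolding F_def using F0(2) by simp
  have F2: "F \<subseteq> ?K"
  proof
    fix k assume "k \<in> F"
    then obtain q k' where "k = g q" "k' \<in> ?K" "?eq k' q" unfolding F_def by blast
    from g[OF this(2,3)] show "k \<in> ?K" unfolding \<open>k = g q\<close> by (rule conjunct1)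
  qed
  note F1 = F1 F2
  have FW: "a \<in> W" "b \<in> W" "hgt a = hgt b" if "(a, b) \<in> F" for a b using F1(2) that by auto
  have F3: "\<exists>(a, b)\<in>F. ev (u + b) (v + a)" if uv: "u \<in> W" "v \<in> W" "hgt u = hgt v" for u v
  proof -
    obtain a b where ab: "(a, b) \<in> F0" "ev (u + b) (v + a)" using F0(3)[OF uv] by blast
    have k: "(u, v) \<in> ?K" "?eq (u, v) (a, b)" using uv ab by auto
    obtain u' v' where g': "g (a, b) = (u', v')" by force
    have uv': "(u', v') \<in> ?K" "ev (u' + b) (v' + a)" using g[OF k] g' by auto
    have "(u', v') \<in> F" unfolding F_def using ab k g' by force
    have eq: "(u + b) + (v' + a) = (u + v') + (a + b)" "(v' + a) + (v + a) = (v + a) + (v' + a)"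
      "(u' + b) + (v + a) = (v + u') + (a + b)" by (simp_all add: ac_simps)
    have "ev ((u + v') + (a + b)) ((v + a) + (v' + a))"
      using ev_add[OF ab(2), of "v' + a"] unfolding eq(1) .
    moreover have "ev ((v + a) + (v' + a)) ((v + u') + (a + b))"
      using ev_add[OF ev_sym[OF uv'(2)], of "v + a"] unfolding eq(2,3) .
    ultimately have "ev ((u + v') + (a + b)) ((v + u') + (a + b))" by (rule ev_trans)
    moreover have "a + b \<in> W" using ab(1) F0(1) by auto
    ultimately have "ev (u + v') (v + u')" by (rule ev_cancel)
    then show ?thesis using \<open>(u', v') \<in> F\<close> by blast
  qed
  define T where "T = (\<Sum>q\<in>F. snd q)"
  define e where "e q = fst q + (\<Sum>q'\<in>F - {q}. snd q')" for q
  have T: "T = snd q + (\<Sum>q'\<in>F - {q}. snd q')" if "q \<in> F" for q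
    unfolding T_def using F1(1) that by (rule sum.remove)
  have sndW: "(\<Sum>q\<in>A. snd q) \<in> W" if "A \<subseteq> F" for A
    using that F1(2) by (intro W_sum) auto
  have eW: "e q \<in> W" if "q \<in> F" for q
    unfolding e_def using F1(2) that sndW[of "F - {q}"] by auto
  have eT: "hgt (e q) = hgt T" if "q \<in> F" for q
    unfolding e_def T[OF that] hgt_union using FW(3)[of "fst q" "snd q"] that by simp
  show thesis
  proof (rule that[of "e ` F"])
    show "finite (e ` F)" using F1(1) by blast
    show "e ` F \<noteq> {}" using F3[of "{#}" "{#}"] by auto
    show "e ` F \<subseteq> W" using eW by blast
    show "hgt a = hgt b" if "a \<in> e ` F" "b \<in> e ` F" for a b using that eT by auto
    fix u v a assume uv: "u \<in> W" "v \<in> W" "hgt u = hgt v" and a: "a \<in> e ` F"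
    have "hgt (u + a) = hgt (v + T)" unfolding hgt_union using uv(3) a eT by auto
    then obtain c d where cd: "(c, d) \<in> F" "ev (u + a + d) (v + T + c)"
      using F3[of "u + a" "v + T"] uv a eW sndW[of F] unfolding T_def by auto
    have "v + T + c = v + e (c, d) + d"
      unfolding e_def using T[OF cd(1)] by (simp add: ac_simps)
    then have "ev (u + a) (v + e (c, d))" using cd(2) FW(2)[OF cd(1)] ev_cancel by metis
    then show "\<exists>b\<in>e ` F. ev (u + a) (v + b)" using cd(1) by blast
  qed
qed

section \<open>Points whose forward images resemble the lattice\<close>

definition free :: "nat \<Rightarrow> 'x \<Rightarrow> bool" where
  "free L x \<longleftrightarrow> (\<forall>u\<in>W. \<forall>v\<in>W. size u \<le> L \<longrightarrow> size v \<le> L \<longrightarrow> act_word f u x = act_word f v x \<longrightarrow> hgt u = hgt v)"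

text \<open>Each point \<open>x\<close> carries a picture of the lattice: position \<open>q\<close>
  is represented by the finite set \<open>orb x q\<close> of images of \<open>x\<close> under long
  words whose height is \<open>q\<close> plus a constant, and it is coloured by \<kappa>.
  Neighbouring points have the same picture up to translation, so the local rule applied to pictures
  colours the points, and a chain of points is shadowed by a chain of positions.\<close>

lemma free_good:
  assumes finker
    and fib: "\<And>s x. s \<in> S \<Longrightarrow> finite {y. f s y = x} \<and> card {y. f s y = x} \<le> K"
  obtains L R col where "\<And>x. col x \<le> card I" "good_col near col {x. free L x} r R"
proof -
  obtain P where P: "finite P" "P \<noteq> {}" "P \<subseteq> W" "\<And>a b. a \<in> P \<Longrightarrow> b \<in> P \<Longrightarrow> hgt a = hgt b"
    and tors: "\<And>u v a. u \<in> W \<Longrightarrow> v \<in> W \<Longrightarrow> hgt u = hgt v \<Longrightarrow> a \<in> P \<Longrightarrow> \<exists>b\<in>P. ev (u + a) (v + b)"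
    using torsion_transversal[OF assms(1)] by blast
  define kP where "kP = (\<Sum>a\<in>P. size a)"
  have kP: "size a \<le> kP" if "a \<in> P" for a
    unfolding kP_def using that P(1) by (intro member_le_sum) simp_all
  obtain A where A: "\<And>w. w \<in> W \<Longrightarrow> bnd (A * size w) (hgt w)" using hgt_bound by blast
  define \<rho> where "\<rho> = A * r"
  obtain \<Lambda> R where rule: "\<And>N. \<exists>E out. (\<forall>\<phi>. out \<phi> \<le> card I) \<and>
    (\<forall>\<phi> \<phi>'. (\<forall>d\<in>Grp. bnd E d \<longrightarrow> \<phi> d = \<phi>' d) \<longrightarrow> out \<phi> = out \<phi>') \<and>
    (\<forall>\<phi>. proper E \<Lambda> \<phi> \<longrightarrow> (\<forall>d\<in>Grp. bnd E d \<longrightarrow> \<phi> d < N) \<longrightarrow>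
      good_col vnear (\<lambda>q. out (\<lambda>d. \<phi> (q + d))) {q \<in> Grp. bnd (R + \<rho>) q} \<rho> R)"
    using local_rule[of \<rho>] by blast
  obtain k0 where k0: "\<And>q. q \<in> Grp \<Longrightarrow> bnd \<Lambda> q \<Longrightarrow>
    \<exists>u\<in>W. \<exists>v\<in>W. q = hgt u - hgt v \<and> size u \<le> k0 \<and> size v \<le> k0"
    using small_words by blast
  \<comment> \<open>Positions at distance at most \<open>\<Lambda>\<close> stay within distance \<open>k1\<close> of each other however deep they are
    pushed. So \<open>\<kappa>\<close> need not be proper at scales depending on the radius \<open>E\<close>, which would be circular,
    as \<open>E\<close> depends on the number of colours of \<open>\<kappa>\<close>.\<close>
  define k1 where "k1 = 2 * k0 + 2 * kP"
  obtain N0 where N0: "\<And>x. finite {y. near k1 x y} \<and> card {y. near k1 x y} \<le> N0"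
    using ball_bound[OF fib] by blast
  obtain \<kappa> where \<kappa>: "\<And>x. \<kappa> x \<le> N0" "\<And>x y. near k1 x y \<Longrightarrow> x \<noteq> y \<Longrightarrow> \<kappa> x \<noteq> \<kappa> y"
    using ex_proper_colouring[of "near k1" N0, OF near.near_sym N0] by blast
  obtain E out where out: "(\<forall>\<phi>. out \<phi> \<le> card I) \<and>
    (\<forall>\<phi> \<phi>'. (\<forall>d\<in>Grp. bnd E d \<longrightarrow> \<phi> d = \<phi>' d) \<longrightarrow> out \<phi> = out \<phi>') \<and>
    (\<forall>\<phi>. proper E \<Lambda> \<phi> \<longrightarrow> (\<forall>d\<in>Grp. bnd E d \<longrightarrow> \<phi> d < N0 + 1) \<longrightarrow>
      good_col vnear (\<lambda>q. out (\<lambda>d. \<phi> (q + d))) {q \<in> Grp. bnd (R + \<rho>) q} \<rho> R)"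
    using rule[of "N0 + 1"] by (elim exE)
  note out = out[THEN conjunct1, rule_format] out[THEN conjunct2, THEN conjunct1, rule_format]
    out[THEN conjunct2, THEN conjunct2, rule_format]
  \<comment> \<open>Pictures are compared at positions up to \<open>E + (R + \<rho>)\<close> from
    the start of a chain, as seen from a point whose own position is up to \<open>R + \<rho>\<close>
    away.\<close>
  define E2 where "E2 = E + 2 * (R + \<rho>)"
  obtain B w where w: "\<And>q. q \<in> Grp \<Longrightarrow> bnd E2 q \<Longrightarrow> w q \<in> W \<and> hgt (w q) = B + q"
    using push_words by blast
  define kw where "kw = (\<Sum>q\<in>{q \<in> Grp. bnd E2 q}. size (w q))"
  have kw: "size (w q) \<le> kw" if "q \<in> Grp" "bnd E2 q" for q
    unfolding kw_def using that finite_ball[of E2] by (intro member_le_sum) simp_all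
  obtain U where U: "U \<in> W" "\<And>u. u \<in> W \<Longrightarrow> size u \<le> r \<Longrightarrow> u \<subseteq># U" using ex_W_cover by blast
  \<comment> \<open>Bounds the words in all pairs for which \<open>c\<close> will turn an
    \<open>ev\<close> into an equality of actions.\<close>
  define m where "m = size U + kw + r + kP + k0"
  obtain c where c: "c \<in> W" "\<And>u v x. u \<in> W \<Longrightarrow> v \<in> W \<Longrightarrow> size u \<le> m \<Longrightarrow> size v \<le> m \<Longrightarrow> ev u v \<Longrightarrow>
    act_word f (c + u) x = act_word f (c + v) x" using common_witness_size by blast
  define L where "L = size c + size U + kP + kw"
  \<comment> \<open>\<open>w q\<close> leads to position \<open>q\<close>; \<open>a\<close> runs
    through the torsion classes, so that the set does not depend on the route; \<open>U\<close>
    makes room to cancel a step to a neighbour; \<open>c\<close> turns \<open>ev\<close> into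
    equality.\<close>
  define orb where "orb x q = (\<lambda>a. act_word f (c + U + a + w q) x) ` P" for x q
  \<comment> \<open>Seen from \<open>x\<close>, the point \<open>y\<close> has position
    \<open>hgt u - hgt v\<close>, so \<open>q\<close> and \<open>q'\<close> name the same place.
    Taking \<open>u\<close> out of \<open>U\<close> and inserting \<open>v\<close> leads to a word
    of the right height, and the change of the torsion representative from \<open>a\<close> to
    \<open>b\<close> accounts for the rest.\<close>
  have orb_sub: "orb x q \<subseteq> orb y q'"
    if uv: "u \<in> W" "v \<in> W" "size u \<le> r" "size v \<le> r" "act_word f u x = act_word f v y"
      and q: "q \<in> Grp" "bnd E2 q" "q' \<in> Grp" "bnd E2 q'" "q + hgt v = q' + hgt u" for x y u v q q'
  proof
    fix z assume "z \<in> orb x q"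
    then obtain a where a: "a \<in> P" "z = act_word f (c + U + a + w q) x" unfolding orb_def by blast
    obtain U' where U': "U = U' + u" using U(2)[OF uv(1,3)] by (metis subset_mset.diff_add)
    have U'W: "U' \<in> W" "size U' \<le> size U" using U(1) U' by auto
    have wq: "w q \<in> W" "w q' \<in> W" "hgt (w q) = B + q" "hgt (w q') = B + q'" using w q by blast+
    have "hgt (U' + w q + v) = hgt (U + w q')"
    proof -
      have "hgt U' + (B + q) + hgt v = hgt U' + hgt u + (B + q')"
      proof
        fix i
        show "(hgt U' + (B + q) + hgt v) i = (hgt U' + hgt u + (B + q')) i"
          using fun_cong[OF q(5), of i] by simp
      qed
      then show ?thesis unfolding U' hgt_union wq(3,4) .
    qed
    then obtain b where b: "b \<in> P" "ev ((U' + w q + v) + a) ((U + w q') + b)"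
      using tors[of "U' + w q + v" "U + w q'" a] a U'W wq uv U(1) by auto
    have "z = act_word f (c + (U' + a + w q)) (act_word f u x)"
      unfolding a(2) U' by (simp only: act_union[symmetric] ac_simps)
    also have "\<dots> = act_word f (c + ((U' + w q + v) + a)) y"
      unfolding uv(5) by (simp only: act_union[symmetric] ac_simps)
    also have "\<dots> = act_word f (c + ((U + w q') + b)) y"
    proof (rule c(2)[OF _ _ _ _ b(2)])
      show "size (U' + w q + v + a) \<le> m" "size (U + w q' + b) \<le> m"
        using U'W kw[OF q(1,2)] kw[OF q(3,4)] kP[OF a(1)] kP[OF b(1)] uv(4) unfolding m_def by simp_all
    qed (use U'W U wq uv P(3) a(1) b(1) in auto)
    also have "\<dots> = act_word f (c + U + b + w q') y" by (simp only: ac_simps)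
    finally show "z \<in> orb y q'" unfolding orb_def using b(1) by blast
  qed
  have orb_eq: "orb x q = orb y q'"
    if uv: "u \<in> W" "v \<in> W" "size u \<le> r" "size v \<le> r" "act_word f u x = act_word f v y"
      and q: "q \<in> Grp" "bnd E2 q" "q' \<in> Grp" "bnd E2 q'" "q + hgt v = q' + hgt u" for x y u v q q'
    using orb_sub[OF uv q] orb_sub[OF uv(2,1,4,3) uv(5)[symmetric] q(3,4,1,2) q(5)[symmetric]] by blast
  \<comment> \<open>The deep words are shared by both sides: only \<open>u + b\<close> and
    \<open>v + b'\<close> remain to be applied to \<open>y\<close> and \<open>y'\<close>, where
    \<open>u\<close> and \<open>v\<close> are short words realising \<open>q' - q\<close>.\<close>
  have orb_near: "near k1 y y'"
    if q: "q \<in> Grp" "bnd E2 q" "q' \<in> Grp" "bnd E2 q'" "bnd \<Lambda> (q' - q)"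
      and y: "y \<in> orb x q" "y' \<in> orb x q'" for x y y' q q'
  proof -
    obtain a b where a: "a \<in> P" "y = act_word f (c + U + a + w q) x" and b: "b \<in> P" "y' = act_word f (c + U + b + w q') x"
      using y unfolding orb_def by blast
    obtain u v where uv: "u \<in> W" "v \<in> W" "q' - q = hgt u - hgt v" "size u \<le> k0" "size v \<le> k0"
      using k0[OF diff_G[OF q(3,1)] q(5)] by blast
    have wq: "w q \<in> W" "w q' \<in> W" "hgt (w q) = B + q" "hgt (w q') = B + q'" using w q by blast+
    have "hgt (u + w q) = hgt (v + w q')"
    proof -
      have "hgt u + q = hgt v + q'" using uv(3) by (metis add.commute diff_add_cancel diff_add_eq)
      then have "hgt u + (B + q) = hgt v + (B + q')" by (metis add.left_commute)
      then show ?thesis unfolding hgt_union wq(3,4) .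
    qed
    then obtain b' where b': "b' \<in> P" "ev ((u + w q) + a) ((v + w q') + b')"
      using tors[of "u + w q" "v + w q'" a] a wq uv by auto
    have "act_word f (c + ((u + w q) + a)) z = act_word f (c + ((v + w q') + b')) z" for z
    proof (rule c(2)[OF _ _ _ _ b'(2)])
      show "size (u + w q + a) \<le> m" "size (v + w q' + b') \<le> m"
        using kw[OF q(1,2)] kw[OF q(3,4)] kP[OF a(1)] kP[OF b'(1)] uv(4,5) unfolding m_def by simp_all
    qed (use wq uv P(3) a(1) b'(1) in auto)
    note eq = this[of "act_word f (U + b) x"]
    have "act_word f (u + b) y = act_word f (c + ((u + w q) + a)) (act_word f (U + b) x)"
      unfolding a(2) by (simp only: act_union[symmetric] ac_simps)
    also have "\<dots> = act_word f (v + b') y'"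
      unfolding eq b(2) by (simp only: act_union[symmetric] ac_simps)
    finally have "act_word f (u + b) y = act_word f (v + b') y'" .
    moreover have "size (u + b) + size (v + b') \<le> k1"
      using uv(4,5) kP[OF b(1)] kP[OF b'(1)] unfolding k1_def by simp
    moreover have "u + b \<in> W" "v + b' \<in> W" using uv(1,2) b(1) b'(1) P(3) by auto
    ultimately show ?thesis by (intro nearI)
  qed
  \<comment> \<open>Here freeness enters: the words involved have length at most \<open>L\<close>,
    so equal images force equal heights.\<close>
  have orb_disj: "orb x q \<inter> orb x q' = {}"
    if x: "free L x" and q: "q \<in> Grp" "bnd E2 q" "q' \<in> Grp" "bnd E2 q'" "q \<noteq> q'" for x q q'
  proof (rule ccontr)
    assume "orb x q \<inter> orb x q' \<noteq> {}"
    then obtain a b where a: "a \<in> P" and b: "b \<in> P"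
      and eq: "act_word f (c + U + a + w q) x = act_word f (c + U + b + w q') x" unfolding orb_def by blast
    have wq: "w q \<in> W" "w q' \<in> W" "hgt (w q) = B + q" "hgt (w q') = B + q'" using w q by blast+
    have "size (c + U + a + w q) \<le> L" "size (c + U + b + w q') \<le> L"
      using kP[OF a] kP[OF b] kw[OF q(1,2)] kw[OF q(3,4)] unfolding L_def by simp_all
    then have "hgt (c + U + a + w q) = hgt (c + U + b + w q')"
      using x eq c(1) U(1) a b P(3) wq unfolding free_def by (meson W_union subsetD)
    then have "hgt c + hgt U + hgt a + (B + q) = hgt c + hgt U + hgt b + (B + q')"
      unfolding hgt_union wq(3,4) .
    then have "q = q'" using P(4)[OF a b] by (metis add_left_cancel)
    then show False using q(5) by blast
  qed
  have orb_fin: "finite (orb x q)" "orb x q \<noteq> {}" for x q unfolding orb_def using P by auto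
  \<comment> \<open>The set has no distinguished point; the least value depends on the set alone and
    is attained at one of its points, which suffices for properness.\<close>
  define \<phi> where "\<phi> x q = Min (\<kappa> ` orb x q)" for x q
  have \<phi>_in: "\<phi> x q \<in> \<kappa> ` orb x q" for x q unfolding \<phi>_def using orb_fin by (intro Min_in) auto
  have \<phi>_le: "\<phi> x q < N0 + 1" for x q using \<phi>_in[of x q] \<kappa>(1) by (metis imageE less_add_one order_le_less_trans)
  have \<phi>_proper: "proper E \<Lambda> (\<phi> x)" if x: "free L x" for x
    unfolding proper_def
  proof (intro ballI impI)
    fix q q' assume q: "q \<in> Grp" "q' \<in> Grp" and b: "bnd E q \<and> bnd E q' \<and> q \<noteq> q' \<and> bnd \<Lambda> (q' - q)"
    have b2: "bnd E2 q" "bnd E2 q'" using b bnd_mono[of E _ E2] unfolding E2_def by simp_all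
    obtain y y' where y: "y \<in> orb x q" "\<phi> x q = \<kappa> y" "y' \<in> orb x q'" "\<phi> x q' = \<kappa> y'"
      using \<phi>_in[of x q] \<phi>_in[of x q'] by blast
    have "y \<noteq> y'" using orb_disj[OF x q(1) b2(1) q(2) b2(2)] b y by blast
    moreover have "near k1 y y'" using orb_near[OF q(1) b2(1) q(2) b2(2) _ y(1,3)] b by blast
    ultimately show "\<phi> x q \<noteq> \<phi> x q'" unfolding y(2,4) by (intro \<kappa>(2))
  qed
  define col where "col x = out (\<phi> x)" for x
  have "good_col near col {x. free L x} r (2 * L)"
    unfolding good_col_def
  proof (intro allI impI)
    fix x y assume chain: "(x, y) \<in> mono_chain near col {x. free L x} r"
    show "near (2 * L) x y"
    proof (cases "x = y")
      case True
      then show ?thesis using near.near_refl by blast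
    next
      case False
      then have x: "free L x" using near.mono_chain_end[OF chain] by blast
      let ?col = "\<lambda>q. out (\<lambda>d. \<phi> x (q + d))"
      let ?B = "{q \<in> Grp. bnd (R + \<rho>) q}"
      have good: "good_col vnear ?col ?B \<rho> R" by (rule out(3)[OF \<phi>_proper[OF x] \<phi>_le])
      \<comment> \<open>\<open>q\<close> is the position of \<open>y\<close> in the picture of
        \<open>x\<close>: the two pictures agree up to translation by \<open>q\<close>. The bound
        \<open>R\<close> on \<open>q\<close> is regained after each step from the boundedness of the
        rule, so errors do not accumulate.\<close>
      define tracked where "tracked y q \<longleftrightarrow> q \<in> Grp \<and> bnd R q \<and> (0, q) \<in> mono_chain vnear ?col ?B \<rho> \<and>
        (\<forall>t\<in>Grp. bnd (E + (R + \<rho>)) t \<longrightarrow> orb x t = orb y (t - q))" for y q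
      have col_y: "col y = ?col q" if q: "q \<in> Grp" "bnd (R + \<rho>) q"
        and eq: "\<And>t. t \<in> Grp \<Longrightarrow> bnd (E + (R + \<rho>)) t \<Longrightarrow> orb x t = orb y (t - q)" for y q
        unfolding col_def
      proof (rule out(2))
        fix d assume d: "d \<in> Grp" "bnd E d"
        have "q + d \<in> Grp" "bnd (E + (R + \<rho>)) (q + d)"
          using add_G[OF q(1) d(1)] bnd_add[OF d(2) q(2)] by (simp_all only: add.commute)
        then have "orb x (q + d) = orb y (q + d - q)" by (rule eq)
        moreover have "q + d - q = d" by simp
        ultimately have "orb x (q + d) = orb y d" by metis
        then show "\<phi> y d = \<phi> x (q + d)" unfolding \<phi>_def by simp
      qed
      have "\<exists>q. tracked y q"
        using chain unfolding mono_chain_def[of near]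
      proof (induction rule: rtrancl_induct)
        case base
        have "t - 0 = t" for t :: "nat \<Rightarrow> int" by simp
        then have "tracked x 0" unfolding tracked_def using zero_G bnd_0 vec.mono_chain_refl by metis
        then show ?case by blast
      next
        case (step y z)
        then obtain q where q: "tracked y q" by blast
        have yz: "free L y" "free L z" "col y = col z" "near r y z" using step.hyps(2) by auto
        obtain u v where uv: "u \<in> W" "v \<in> W" "size u + size v \<le> r" "act_word f u y = act_word f v z"
          using yz(4) unfolding near_def by blast
        define q' where "q' = q + (hgt u - hgt v)"
        have qG: "q \<in> Grp" "bnd R q" and qc: "(0, q) \<in> mono_chain vnear ?col ?B \<rho>"
          and qo: "\<And>t. t \<in> Grp \<Longrightarrow> bnd (E + (R + \<rho>)) t \<Longrightarrow> orb x t = orb y (t - q)"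
          using q unfolding tracked_def by blast+
        have small: "bnd \<rho> (hgt u - hgt v)"
        proof -
          have "bnd (A * size u + A * size v) (hgt u - hgt v)" using A[OF uv(1)] A[OF uv(2)] by (rule bnd_diff)
          moreover have "A * size u + A * size v \<le> \<rho>"
            unfolding \<rho>_def using uv(3) by (metis add_mult_distrib2 mult_le_mono2)
          ultimately show ?thesis by (rule bnd_mono)
        qed
        have q'G: "q' \<in> Grp" unfolding q'_def using qG(1) GrpI[OF uv(1,2)] by (rule add_G)
        have q'b: "bnd (R + \<rho>) q'" unfolding q'_def using qG(2) small by (rule bnd_add)
        have qb: "bnd (R + \<rho>) q" using qG(2) by (rule bnd_mono) simp
        have q'o: "orb x t = orb z (t - q')" if t: "t \<in> Grp" "bnd (E + (R + \<rho>)) t" for t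
        proof -
          have "orb y (t - q) = orb z (t - q')"
          proof (rule orb_eq[OF uv(1,2) _ _ uv(4)])
            show "size u \<le> r" "size v \<le> r" using uv(3) by simp_all
            show "t - q \<in> Grp" "t - q' \<in> Grp" using t(1) qG(1) q'G by (simp_all only: diff_G)
            show "bnd E2 (t - q)" by (rule bnd_mono[OF bnd_diff[OF t(2) qb]]) (simp add: E2_def)
            show "bnd E2 (t - q')" by (rule bnd_mono[OF bnd_diff[OF t(2) q'b]]) (simp add: E2_def)
            show "t - q + hgt v = t - q' + hgt u" unfolding q'_def by (simp add: fun_eq_iff)
          qed
          then show ?thesis using qo[OF t] by simp
        qed
        have "(0, q') \<in> mono_chain vnear ?col ?B \<rho>"
        proof (rule vec.mono_chain_step[OF qc])
          show "q \<in> ?B" "q' \<in> ?B" using qG(1) qb q'G q'b by blast+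
          show "?col q = ?col q'" using col_y[OF qG(1) qb qo] col_y[OF q'G q'b q'o] yz(3) by simp
          have "q - q' = hgt v - hgt u" unfolding q'_def by (simp add: fun_eq_iff)
          moreover have "bnd \<rho> (hgt v - hgt u)" using small by (subst bnd_minus_commute)
          ultimately show "bnd \<rho> (q - q')" by metis
        qed
        moreover from this have "bnd R (0 - q')" using good unfolding good_col_def by blast
        then have "bnd R q'" unfolding diff_0 bnd_uminus .
        ultimately have "tracked z q'" unfolding tracked_def using q'G q'o by blast
        then show ?case by blast
      qed
      then obtain q where q: "q \<in> Grp" "bnd R q"
        and o: "\<And>t. t \<in> Grp \<Longrightarrow> bnd (E + (R + \<rho>)) t \<Longrightarrow> orb x t = orb y (t - q)"
        unfolding tracked_def by blast
      \<comment> \<open>A common point of these two sets is the image of both \<open>x\<close> and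
        \<open>y\<close> under words of length at most \<open>L\<close>.\<close>
      have "orb x 0 = orb y (0 - q)" by (rule o[OF zero_G bnd_0])
      then have oq: "orb x 0 = orb y (- q)" unfolding diff_0 .
      obtain z where "z \<in> orb x 0" using orb_fin by blast
      then have "z \<in> orb x 0" "z \<in> orb y (- q)" using oq by blast+
      then obtain a b where a: "a \<in> P" "z = act_word f (c + U + a + w 0) x"
        and b: "b \<in> P" "z = act_word f (c + U + b + w (- q)) y" unfolding orb_def by blast
      have mq: "- q \<in> Grp" "bnd E2 (- q)"
        using uminus_G[OF q(1)] bnd_mono[OF q(2), of E2] by (simp_all add: E2_def)
      show ?thesis
      proof (rule nearI)
        show "act_word f (c + U + a + w 0) x = act_word f (c + U + b + w (- q)) y" using a b by simp
        show "c + U + a + w 0 \<in> W" "c + U + b + w (- q) \<in> W"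
          using c(1) U(1) a(1) b(1) P(3) w[OF zero_G bnd_0] w[OF mq] by auto
        show "size (c + U + a + w 0) + size (c + U + b + w (- q)) \<le> 2 * L"
          using kP[OF a(1)] kP[OF b(1)] kw[OF zero_G bnd_0] kw[OF mq] unfolding L_def by simp
      qed
    qed
  qed
  then show thesis using that[of col L "2 * L"] out(1) unfolding col_def by blast
qed

end


section \<open>Induction on the rank\<close>

context coarse
begin

definition asd :: "nat \<Rightarrow> 'p set \<Rightarrow> bool" where
  "asd n A \<longleftrightarrow> (\<forall>r. \<exists>R col. (\<forall>x. col x \<le> n) \<and> good_col N col A r R)"

lemma good_col_glue:
  assumes "good_col N colA A r RA" "good_col N colB B (RA + 2 * r) RB"
  shows "good_col N (\<lambda>x. if x \<in> A then colA x else colB x) (A \<union> B) r (RB + 2 * RA + 2 * r)"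
proof -
  let ?col = "\<lambda>x. if x \<in> A then colA x else colB x"
  have "good_col N ?col A r RA" using assms(1) by (rule good_col_subset) auto
  moreover have "good_col N ?col (B - A) (RA + 2 * r) RB" using assms(2) by (rule good_col_subset) auto
  ultimately have "good_col N ?col (A \<union> (B - A)) r (RB + 2 * RA + 2 * r)" by (rule good_col_Un)
  then show ?thesis by simp
qed

lemma asd_empty: "asd n {}"
  unfolding asd_def good_col_def
proof (intro allI exI conjI impI)
  fix r p q
  show "(0::nat) \<le> n" by simp
  assume "(p, q) \<in> mono_chain N (\<lambda>_. 0) {} r"
  then have "p = q" by (simp add: mono_chain_def)
  then show "N 0 p q" using near_refl by blast
qed

lemma asd_Un:
  assumes "asd n A" "asd n B"
  shows "asd n (A \<union> B)"
  unfolding asd_def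
proof
  fix r
  obtain RA colA where A: "\<And>x. colA x \<le> n" "good_col N colA A r RA" using assms(1) unfolding asd_def by blast
  obtain RB colB where B: "\<And>x. colB x \<le> n" "good_col N colB B (RA + 2 * r) RB"
    using assms(2) unfolding asd_def by blast
  show "\<exists>R col. (\<forall>x. col x \<le> n) \<and> good_col N col (A \<union> B) r R"
    using good_col_glue[OF A(2) B(2)] A(1) B(1) by (intro exI conjI) auto
qed

lemma asd_UN: "finite Q \<Longrightarrow> (\<And>q. q \<in> Q \<Longrightarrow> asd n (A q)) \<Longrightarrow> asd n (\<Union>q\<in>Q. A q)"
  by (induction Q rule: finite_induct) (auto intro: asd_empty asd_Un)

end

context heights
begin

context
  fixes a b :: "'m multiset" and i0 :: nat
begin

text \<open>On the invariant set where \<open>a\<close> and \<open>b\<close> act alike, the height along \<open>hgt a - hgt b\<close> is lost;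
  \<open>drop_p\<close> is the height modulo that direction.\<close>

definition eq_set :: "'x set" where
  "eq_set = {x. act_word f a x = act_word f b x}"

text \<open>The identity outside \<open>eq_set\<close> keeps the maps total and commuting, so that
  the induction hypothesis, which speaks about a whole type, applies.\<close>

definition eq_map :: "'m \<Rightarrow> 'x \<Rightarrow> 'x" where
  "eq_map s x = (if x \<in> eq_set then f s x else x)"

definition drop_p :: "'m \<Rightarrow> nat \<Rightarrow> int" where
  "drop_p s i = (hgt a i0 - hgt b i0) * p s i - (hgt a i - hgt b i) * p s i0"

context
  assumes ab: "a \<in> W" "b \<in> W" and neq: "hgt a i0 \<noteq> hgt b i0"
begin

lemma eq_set_closed: "x \<in> eq_set \<Longrightarrow> f s x \<in> eq_set"
  unfolding eq_set_def using act_commute[of a "{#s#}" x] act_commute[of b "{#s#}" x] by simp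

lemma i0_I: "i0 \<in> I"
  using neq hgt_supp ab by metis

lemma commuting_eq_map: "commuting S eq_map"
  by standard (auto simp: eq_map_def eq_set_closed fin_S comm)

text \<open>The two products in \<open>drop_p\<close> cancel at \<open>i0\<close>, so that
  coordinate may leave the index set; this is what makes the induction on \<open>card I\<close>
  descend.\<close>

lemma heights_eq_map: "heights S eq_map (I - {i0}) drop_p"
proof -
  interpret E: commuting S eq_map by (rule commuting_eq_map)
  show ?thesis
  proof
    show "drop_p s i = 0" if "s \<in> S" "i \<notin> I - {i0}" for s i
      using that hgt_supp ab supp_p unfolding drop_p_def by (cases "i = i0") auto
  qed (simp add: fin_I)
qed

interpretation E: heights S eq_map "I - {i0}" drop_p
  by (rule heights_eq_map)

lemma eq_map_in: "x \<in> eq_set \<Longrightarrow> eq_map s x = f s x"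
  and eq_map_out: "x \<notin> eq_set \<Longrightarrow> eq_map s x = x"
  by (simp_all only: eq_map_def if_True if_False)

lemma act_eq_map: "act_word eq_map w x = (if x \<in> eq_set then act_word f w x else x)"
proof (cases "x \<in> eq_set")
  case True
  have cl: "act_word f w x \<in> eq_set" for w
    by (induction w) (use True eq_set_closed in auto)
  have "act_word eq_map w x = act_word f w x"
  proof (induction w)
    case (add s w)
    then show ?case unfolding E.act_add_mset act_add_mset by (simp only: eq_map_in[OF cl])
  qed (simp only: E.act_empty act_empty)
  then show ?thesis using True by simp
next
  case False
  have "act_word eq_map w x = x"
  proof (induction w)
    case (add s w)
    then show ?case unfolding E.act_add_mset by (simp only: eq_map_out[OF False])
  qed (simp only: E.act_empty)
  then show ?thesis using False by simp
qed

lemma near_eq_map: "x \<in> eq_set \<Longrightarrow> y \<in> eq_set \<Longrightarrow> E.near k x y \<longleftrightarrow> near k x y"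
  unfolding E.near_def near_def by (simp add: act_eq_map)

text \<open>Over a point outside the invariant set the fibre is that point alone, whence
  \<open>1 \<le> K\<close>.\<close>

lemma fiber_eq_map:
  assumes "finite {y. f s y = x} \<and> card {y. f s y = x} \<le> K" "1 \<le> K"
  shows "finite {y. eq_map s y = x} \<and> card {y. eq_map s y = x} \<le> K"
proof (cases "x \<in> eq_set")
  case True
  then have "{y. eq_map s y = x} \<subseteq> {y. f s y = x}" by (auto simp: eq_map_def split: if_splits)
  then show ?thesis using assms(1) by (meson card_mono finite_subset order_trans)
next
  case False
  then have "{y. eq_map s y = x} = {x}" by (auto simp: eq_map_def eq_set_closed split: if_splits)
  then show ?thesis using assms(2) by simp
qed

lemma hgt_drop: "E.hgt w i = (hgt a i0 - hgt b i0) * hgt w i - (hgt a i - hgt b i) * hgt w i0"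
proof (induction w)
  case (add s w)
  have "E.hgt (add_mset s w) i = drop_p s i + E.hgt w i" by (rule E.hgt_add_mset)
  also have "drop_p s i = (hgt a i0 - hgt b i0) * p s i - (hgt a i - hgt b i) * p s i0"
    by (rule drop_p_def)
  finally show ?case unfolding add hgt_add_mset by (simp only: algebra_simps)
qed (simp only: E.hgt_empty hgt_empty zero_fun_apply mult_zero_right diff_0_right)

lemma ev_eq_map: "ev u v \<Longrightarrow> E.ev u v"
  unfolding E.ev_def ev_def by (auto simp: act_eq_map)

lemma ev_eq_map_repeat: "E.ev (repeat_mset k a) (repeat_mset k b)"
proof -
  have "act_word eq_map a x = act_word eq_map b x" for x
    by (auto simp: act_eq_map eq_set_def)
  then have "act_word eq_map (repeat_mset k a) x = act_word eq_map (repeat_mset k b) x" for x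
    by (induction k) (simp_all add: E.act_union)
  then show ?thesis unfolding E.ev_def using E.W_empty by (intro bexI[of _ "{#}"]) auto
qed

text \<open>Equal new heights mean that the old heights differ by a vector \<open>h\<close> parallel
  to \<open>v\<close>. Multiples of \<open>v\<close> are invisible to the new action; removing the
  integer part of \<open>h i0 / v i0\<close> leaves a height determined by a remainder
  \<open>t\<close>, of which there are finitely many. A chosen pair \<open>K t\<close> realises it,
  and what is left lies in the old finite kernel.\<close>

lemma finker_eq_map:
  assumes finker
  shows E.finker
proof -
  obtain F0 where F0: "F0 \<subseteq> W \<times> W" "finite F0"
    "\<And>u v. u \<in> W \<Longrightarrow> v \<in> W \<Longrightarrow> hgt u = hgt v \<Longrightarrow> \<exists>(c, d)\<in>F0. ev (u + d) (v + c)"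
    using assms unfolding finker_def by blast
  define v where "v i = hgt a i - hgt b i" for i
  have v0: "v i0 \<noteq> 0" using neq unfolding v_def by simp
  define Q where "Q t = (\<lambda>(e, g). e \<in> W \<and> g \<in> W \<and> (\<forall>j. v i0 * (hgt e j - hgt g j) = t * v j))" for t
  define T where "T = {t \<in> {- \<bar>v i0\<bar>..\<bar>v i0\<bar>}. \<exists>k. Q t k}"
  define K where "K t = (SOME k. Q t k)" for t
  have K: "Q t (K t)" if "t \<in> T" for t using that unfolding T_def K_def by (auto intro: someI)
  define F where "F = (\<lambda>(t, c, d). (fst (K t) + c, snd (K t) + d)) ` (T \<times> F0)"
  have finF: "finite F" 
  proof -
    have "T \<subseteq> {- \<bar>v i0\<bar>..\<bar>v i0\<bar>}" unfolding T_def by blast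
    then have "finite T" by (rule finite_subset) simp
    then show ?thesis unfolding F_def using F0(2) by (intro finite_imageI finite_cartesian_product)
  qed
  have FW: "F \<subseteq> W \<times> W"
  proof
    fix k assume "k \<in> F"
    then obtain t c d where "t \<in> T" "(c, d) \<in> F0" "k = (fst (K t) + c, snd (K t) + d)" unfolding F_def by auto
    then show "k \<in> W \<times> W" using K[of t] F0(1) unfolding Q_def by (auto simp: case_prod_unfold)
  qed
  have "\<exists>(c, d)\<in>F. E.ev (u + d) (w + c)" if u: "u \<in> W" "w \<in> W" and eq: "E.hgt u = E.hgt w" for u w
  proof -
    define h where "h j = hgt u j - hgt w j" for j
    have h: "v i0 * h j = h i0 * v j" for j
      using fun_cong[OF eq, of j] unfolding hgt_drop h_def v_def by (simp add: algebra_simps)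
    define q where "q = h i0 div v i0"
    \<comment> \<open>Adding \<open>q\<close> copies of \<open>b\<close> to \<open>u\<close> and of
      \<open>a\<close> to \<open>w\<close> subtracts \<open>q * v\<close> from the height
      difference; for negative \<open>q\<close> the roles of \<open>a\<close> and \<open>b\<close>
      are exchanged.\<close>
    define u' where "u' = u + (if q \<ge> 0 then repeat_mset (nat q) b else repeat_mset (nat (- q)) a)"
    define w' where "w' = w + (if q \<ge> 0 then repeat_mset (nat q) a else repeat_mset (nat (- q)) b)"
    have W': "u' \<in> W" "w' \<in> W" unfolding u'_def w'_def using u ab W_repeat by auto
    have h': "hgt u' j - hgt w' j = h j - q * v j" for j
      unfolding u'_def w'_def h_def v_def by (auto simp: hgt_union hgt_repeat algebra_simps)
    define t where "t = h i0 mod v i0"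
    have t: "v i0 * (hgt u' j - hgt w' j) = t * v j" for j
    proof -
      have "v i0 * (hgt u' j - hgt w' j) = h i0 * v j - q * v i0 * v j"
        unfolding h' using h[of j] by (simp add: algebra_simps)
      also have "\<dots> = (h i0 - q * v i0) * v j" by (simp add: algebra_simps)
      also have "h i0 - q * v i0 = t" unfolding t_def q_def by (simp add: minus_div_mult_eq_mod)
      finally show ?thesis .
    qed
    have "Q t (u', w')" unfolding Q_def using W' t by simp
    moreover have "\<bar>t\<bar> \<le> \<bar>v i0\<bar>" unfolding t_def using abs_mod_less[OF v0, of "h i0"] by simp
    ultimately have tT: "t \<in> T" unfolding T_def by (auto simp: abs_le_iff)
    obtain e g where eg: "K t = (e, g)" by force
    have eg': "e \<in> W" "g \<in> W" "\<And>j. v i0 * (hgt e j - hgt g j) = t * v j"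
      using K[OF tT] unfolding eg Q_def by auto
    have "hgt (u' + g) = hgt (w' + e)"
    proof
      fix j
      have "v i0 * (hgt u' j - hgt w' j) = v i0 * (hgt e j - hgt g j)" using t eg'(3) by simp
      then have "hgt u' j - hgt w' j = hgt e j - hgt g j" using v0 by simp
      then show "hgt (u' + g) j = hgt (w' + e) j" by (simp add: hgt_union)
    qed
    then obtain c d where cd: "(c, d) \<in> F0" "ev (u' + g + d) (w' + e + c)"
      using F0(3)[of "u' + g" "w' + e"] W' eg' by auto
    define z1 where "z1 = (if q \<ge> 0 then repeat_mset (nat q) b else repeat_mset (nat (- q)) a)"
    define z2 where "z2 = (if q \<ge> 0 then repeat_mset (nat q) a else repeat_mset (nat (- q)) b)"
    have z: "E.ev z2 z1" "z1 \<in> W" unfolding z1_def z2_def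
      using ev_eq_map_repeat[THEN E.ev_sym] ev_eq_map_repeat ab W_repeat by auto
    have "E.ev ((w + (e + c)) + z2) ((w + (e + c)) + z1)"
      using E.ev_add[OF z(1), of "w + (e + c)"] by (simp only: ac_simps)
    moreover have "E.ev ((u + (g + d)) + z1) ((w + (e + c)) + z2)"
      using ev_eq_map[OF cd(2)] unfolding u'_def w'_def z1_def[symmetric] z2_def[symmetric] by (simp only: ac_simps)
    ultimately have "E.ev ((u + (g + d)) + z1) ((w + (e + c)) + z1)" by (metis E.ev_trans)
    then have "E.ev (u + (g + d)) (w + (e + c))" using z(2) by (rule E.ev_cancel)
    moreover have "(e + c, g + d) \<in> F" unfolding F_def using tT cd(1) eg by force
    ultimately show ?thesis by blast
  qed
  then show ?thesis unfolding E.finker_def using FW finF by blast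
qed

end

end

end

text \<open>The free points come first, since they determine \<open>L\<close> and a bound
  \<open>R\<close>. The remaining sets, finitely many for this \<open>L\<close>, are good at every
  scale by induction, in particular at \<open>R + 2 * r\<close>, which gluing demands and which was
  unknown before.\<close>

theorem asd_heights:
  assumes "heights S f I p" "heights.finker S f p"
    and "\<And>s x. s \<in> S \<Longrightarrow> finite {y. f s y = x} \<and> card {y. f s y = x} \<le> K" "1 \<le> K"
  shows "coarse.asd (commuting.near S f) (card I) UNIV"
  using assms(1-3)
proof (induction "card I" arbitrary: I p f rule: less_induct)
  case less
  interpret heights S f I p by (rule less.prems(1))
  have eq: "near.asd (card I) {x. act_word f a x = act_word f b x}" if ab: "a \<in> W" "b \<in> W" "hgt a \<noteq> hgt b" for a b
  proof -
    obtain i0 where i0: "hgt a i0 \<noteq> hgt b i0" using ab(3) by blast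
    define g where "g = eq_map a b"
    define C where "C = eq_set a b"
    interpret E: heights S g "I - {i0}" "drop_p a b i0"
      unfolding g_def by (rule heights_eq_map[OF ab(1,2) i0])
    have "card (I - {i0}) < card I" by (rule card_Diff1_less[OF fin_I i0_I[OF ab(1,2) i0]])
    then have "E.near.asd (card (I - {i0})) UNIV"
    proof (rule less.hyps)
      show "heights S g (I - {i0}) (drop_p a b i0)" by (rule E.heights_axioms)
      show "E.finker" unfolding g_def by (rule finker_eq_map[OF ab(1,2) i0 less.prems(2)])
      show "finite {y. g s y = x} \<and> card {y. g s y = x} \<le> K" if "s \<in> S" for s x
        unfolding g_def by (rule fiber_eq_map[OF ab(1,2) i0 less.prems(3)[OF that] assms(4)])
    qed
    moreover have "card (I - {i0}) \<le> card I" using fin_I by (intro card_mono) auto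
    ultimately have E: "\<exists>R col. (\<forall>x. col x \<le> card I) \<and> good_col E.near col UNIV r R" for r
      unfolding E.near.asd_def by (meson order_trans)
    have nr: "E.near k x y \<longleftrightarrow> near k x y" if "x \<in> C" "y \<in> C" for k x y
      using that unfolding g_def C_def by (rule near_eq_map[OF ab(1,2) i0])
    have "\<exists>R col. (\<forall>x. col x \<le> card I) \<and> good_col near col C r R" for r
    proof -
      obtain R col where R: "\<And>x. col x \<le> card I" "good_col E.near col UNIV r R" using E by blast
      have "good_col E.near col C r R" using R(2) by (rule E.near.good_col_subset) auto
      moreover have "mono_chain E.near col C r = mono_chain near col C r"
        unfolding mono_chain_def using nr by (intro arg_cong[of _ _ rtrancl]) auto
      ultimately have "good_col near col C r R"
        unfolding good_col_def using nr near.mono_chain_end near.near_refl by metis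
      then show ?thesis using R(1) by blast
    qed
    then have "near.asd (card I) C" unfolding near.asd_def by blast
    then show ?thesis unfolding C_def eq_set_def .
  qed
  show ?case
    unfolding near.asd_def
  proof
    fix r
    obtain L R col where F: "\<And>x. col x \<le> card I" "good_col near col {x. free L x} r R"
      using free_good[OF less.prems(2,3)] by metis
    let ?W = "{w \<in> W. size w \<le> L}"
    let ?Q = "{(a, b) \<in> ?W \<times> ?W. hgt a \<noteq> hgt b}"
    let ?C = "\<lambda>(a, b). {x. act_word f a x = act_word f b x}"
    have "finite ?Q" by (rule finite_subset[of _ "?W \<times> ?W"]) (use finite_W in auto)
    then have "near.asd (card I) (\<Union>q\<in>?Q. ?C q)"
      by (rule near.asd_UN) (use eq in auto)
    then obtain R' col' where G: "\<And>x. col' x \<le> card I" "good_col near col' (\<Union>q\<in>?Q. ?C q) (R + 2 * r) R'"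
      unfolding near.asd_def by blast
    have "UNIV = {x. free L x} \<union> (\<Union>q\<in>?Q. ?C q)" unfolding free_def by fastforce
    then show "\<exists>R col. (\<forall>x. col x \<le> card I) \<and> good_col near col UNIV r R"
      using near.good_col_glue[OF F(2) G(2)] F(1) G(1) by (intro exI conjI) auto
  qed
qed


section \<open>Finitely generated commutative groups\<close>

text \<open>All \<open>2 ^ m\<close> parity patterns must be met by at most \<open>2 ^ n\<close>
  elements. Counting modulo two takes the place of a dimension argument in both rank bounds
  below.\<close>

lemma card_le_if_parity_surj:
  fixes F :: "'k \<Rightarrow> nat \<Rightarrow> int"
  assumes "finite X" "card X \<le> 2 ^ n"
    and "\<And>y :: nat \<Rightarrow> int. \<exists>x\<in>X. \<forall>i<m. even (y i - F x i)"
  shows "m \<le> n"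
proof -
  have "Pow {..<m} \<subseteq> (\<lambda>x. {i. i < m \<and> odd (F x i)}) ` X"
  proof
    fix A assume A: "A \<in> Pow {..<m}"
    obtain x where x: "x \<in> X" "\<forall>i<m. even ((if i \<in> A then 1 else 0) - F x i)"
      using assms(3)[of "\<lambda>i. if i \<in> A then 1 else 0"] by blast
    have "A = {i. i < m \<and> odd (F x i)}"
      using A x(2) by (auto split: if_splits)
    then show "A \<in> (\<lambda>x. {i. i < m \<and> odd (F x i)}) ` X" using x(1) by blast
  qed
  then have "card (Pow {..<m}) \<le> card X" using assms(1) by (meson card_image_le card_mono finite_imageI order_trans)
  then have "(2::nat) ^ m \<le> 2 ^ n" unfolding card_Pow[OF finite_lessThan] card_lessThan using assms(2) by (rule order_trans)
  then show ?thesis by simp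
qed

text \<open>Gaussian elimination without division.\<close>
lemma ex_int_functional:
  fixes \<Lambda> :: "('s \<Rightarrow> int) set"
  assumes "finite S" "(\<lambda>_. 0) \<in> \<Lambda>"
    and "\<And>y z a b. y \<in> \<Lambda> \<Longrightarrow> z \<in> \<Lambda> \<Longrightarrow> (\<lambda>i. a * y i + b * z i) \<in> \<Lambda>"
    and "\<And>z i. z \<in> \<Lambda> \<Longrightarrow> i \<notin> S \<Longrightarrow> z i = 0" "\<And>i. i \<notin> S \<Longrightarrow> x i = 0"
    and "\<And>N. N > 0 \<Longrightarrow> (\<lambda>i. N * x i) \<notin> \<Lambda>"
  shows "\<exists>\<psi>. (\<forall>z\<in>\<Lambda>. (\<Sum>i\<in>S. \<psi> i * z i) = 0) \<and> (\<Sum>i\<in>S. \<psi> i * x i) \<noteq> 0"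
  using assms
proof (induction S arbitrary: \<Lambda> x rule: finite_induct)
  case empty
  have "(\<lambda>i. 1 * x i) = (\<lambda>_. 0)" using empty(4) by auto
  then show ?case using empty(1) empty(5)[of 1] by simp
next
  case (insert s S)
  show ?case
  proof (cases "\<exists>l\<in>\<Lambda>. l s \<noteq> 0")
    case False
    show ?thesis
    proof (cases "x s = 0")
      case True
      have "\<exists>\<psi>. (\<forall>z\<in>\<Lambda>. (\<Sum>i\<in>S. \<psi> i * z i) = 0) \<and> (\<Sum>i\<in>S. \<psi> i * x i) \<noteq> 0"
      proof (rule insert.IH)
        show "z i = 0" if "z \<in> \<Lambda>" "i \<notin> S" for z i using that False insert.prems(3) by (cases "i = s") auto
        show "x i = 0" if "i \<notin> S" for i using that True insert.prems(4) by (cases "i = s") auto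
      qed (use insert.prems in blast)+
      then obtain \<psi> where "\<forall>z\<in>\<Lambda>. (\<Sum>i\<in>S. \<psi> i * z i) = 0" "(\<Sum>i\<in>S. \<psi> i * x i) \<noteq> 0" by blast
      then show ?thesis using insert.hyps False True by (intro exI[of _ \<psi>]) auto
    next
      case xs: False
      have "(\<Sum>i\<in>insert s S. (if i = s then 1 else 0) * z i) = z s" for z :: "'s \<Rightarrow> int"
        using insert.hyps by (simp add: if_distrib[of "\<lambda>c. c * _"] sum.delta cong: if_cong)
      then show ?thesis using False xs by (intro exI[of _ "\<lambda>i. if i = s then 1 else 0"]) auto
    qed
  next
    case True
    then obtain l0 where l0: "l0 \<in> \<Lambda>" "l0 s \<noteq> 0" by blast
    obtain l where l: "l \<in> \<Lambda>" "l s > 0"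
    proof (cases "l0 s > 0")
      case True
      then show thesis using that l0(1) by blast
    next
      case False
      have "(\<lambda>i. (-1) * l0 i + 0 * l0 i) \<in> \<Lambda>" using insert.prems(2) l0(1) by blast
      then show thesis using that[of "\<lambda>i. (-1) * l0 i + 0 * l0 i"] False l0(2) by simp
    qed
    \<comment> \<open>Clears coordinate \<open>s\<close> with the pivot \<open>l\<close>; scaling by
      \<open>l s\<close> replaces division.\<close>
    define elim where "elim z = (\<lambda>i. l s * z i + (- z s) * l i)" for z :: "'s \<Rightarrow> int"
    have elim: "elim z \<in> \<Lambda>" "elim z s = 0" if "z \<in> \<Lambda>" for z
      unfolding elim_def by (rule insert.prems(2)[OF that l(1)]) simp
    define \<Lambda>' where "\<Lambda>' = {z \<in> \<Lambda>. z s = 0}"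
    have "\<exists>\<psi>. (\<forall>z\<in>\<Lambda>'. (\<Sum>i\<in>S. \<psi> i * z i) = 0) \<and> (\<Sum>i\<in>S. \<psi> i * elim x i) \<noteq> 0"
    proof (rule insert.IH)
      show "(\<lambda>_. 0) \<in> \<Lambda>'" unfolding \<Lambda>'_def using insert.prems(1) by simp
      show "(\<lambda>i. a * y i + b * z i) \<in> \<Lambda>'" if "y \<in> \<Lambda>'" "z \<in> \<Lambda>'" for y z a b
        using that insert.prems(2) unfolding \<Lambda>'_def by simp
      show "z i = 0" if "z \<in> \<Lambda>'" "i \<notin> S" for z i
        using that insert.prems(3)[of z i] unfolding \<Lambda>'_def by (cases "i = s") auto
      show "elim x i = 0" if "i \<notin> S" for i
        using that insert.prems(4)[of i] insert.prems(3)[OF l(1), of i] unfolding elim_def by (cases "i = s") auto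
      show "(\<lambda>i. N * elim x i) \<notin> \<Lambda>'" if "N > 0" for N
      proof
        assume "(\<lambda>i. N * elim x i) \<in> \<Lambda>'"
        then have "(\<lambda>i. 1 * (N * elim x i) + (N * x s) * l i) \<in> \<Lambda>"
          using insert.prems(2) l(1) unfolding \<Lambda>'_def by blast
        moreover have "(\<lambda>i. 1 * (N * elim x i) + (N * x s) * l i) = (\<lambda>i. (N * l s) * x i)"
          unfolding elim_def by (simp add: algebra_simps)
        ultimately show False using insert.prems(5)[of "N * l s"] that l(2) by simp
      qed
    qed
    then obtain \<psi> where \<psi>: "\<forall>z\<in>\<Lambda>'. (\<Sum>i\<in>S. \<psi> i * z i) = 0" "(\<Sum>i\<in>S. \<psi> i * elim x i) \<noteq> 0" by blast
    \<comment> \<open>The value at \<open>s\<close> is chosen so that the functional vanishes on the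
      pivot \<open>l\<close>.\<close>
    let ?\<psi> = "\<lambda>i. if i = s then - (\<Sum>i\<in>S. \<psi> i * l i) else l s * \<psi> i"
    have eq: "(\<Sum>i\<in>insert s S. ?\<psi> i * z i) = (\<Sum>i\<in>S. \<psi> i * elim z i)" for z
    proof -
      have "(\<Sum>i\<in>S. ?\<psi> i * z i) = (\<Sum>i\<in>S. l s * \<psi> i * z i)"
        using insert.hyps by (intro sum.cong) auto
      moreover have "(\<Sum>i\<in>S. \<psi> i * elim z i) = (\<Sum>i\<in>S. l s * \<psi> i * z i) - z s * (\<Sum>i\<in>S. \<psi> i * l i)"
        unfolding elim_def by (simp add: algebra_simps sum.distrib sum_distrib_left sum_subtractf)
      ultimately show ?thesis using insert.hyps by simp
    qed
    show ?thesis
    proof (intro exI[of _ ?\<psi>] conjI ballI)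
      show "(\<Sum>i\<in>insert s S. ?\<psi> i * z i) = 0" if "z \<in> \<Lambda>" for z
        unfolding eq using \<psi>(1) elim[OF that] unfolding \<Lambda>'_def by simp
      show "(\<Sum>i\<in>insert s S. ?\<psi> i * x i) \<noteq> 0" unfolding eq by (rule \<psi>(2))
    qed
  qed
qed

lemma (in comm_group) int_pow_finprod_hom:
  assumes "finite S" "e \<in> S \<rightarrow> carrier G"
  shows "(\<Otimes>s\<in>S. e s [^] (y s + z s :: int)) = (\<Otimes>s\<in>S. e s [^] y s) \<otimes> (\<Otimes>s\<in>S. e s [^] z s)"
proof -
  have "(\<Otimes>s\<in>S. e s [^] (y s + z s)) = (\<Otimes>s\<in>S. e s [^] y s \<otimes> e s [^] z s)"
    using assms(2) by (intro finprod_cong') (auto simp: int_pow_mult Pi_def)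
  also have "\<dots> = (\<Otimes>s\<in>S. e s [^] y s) \<otimes> (\<Otimes>s\<in>S. e s [^] z s)"
    using assms(2) by (intro finprod_multf) (auto simp: Pi_def)
  finally show ?thesis .
qed

lemma (in group) hom_int_pow:
  assumes "c \<in> hom G integer_group" "x \<in> carrier G"
  shows "c (x [^] (k :: int)) = k * c x"
proof -
  interpret Z: group integer_group by (rule group_integer_group)
  interpret group_hom G integer_group c
    by (simp add: group_hom_def group_hom_axioms_def group_axioms group_integer_group assms(1))
  have "c x [^]\<^bsub>integer_group\<^esub> k = k * c x" by (rule group_int_pow_integer_group)
  then show ?thesis using assms(2) by (simp add: hom_int_pow)
qed

lemma (in group) hom_integer:
  assumes "c \<in> hom G integer_group"
  shows "x \<in> carrier G \<Longrightarrow> y \<in> carrier G \<Longrightarrow> c (x \<otimes> y) = c x + c y"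
    and "c \<one> = 0" and "x \<in> carrier G \<Longrightarrow> c (inv x) = - c x"
proof -
  interpret group_hom G integer_group c
    by (simp add: group_hom_def group_hom_axioms_def group_axioms group_integer_group assms)
  show "x \<in> carrier G \<Longrightarrow> y \<in> carrier G \<Longrightarrow> c (x \<otimes> y) = c x + c y" by simp
  show "c \<one> = 0" using hom_one by simp
  show "x \<in> carrier G \<Longrightarrow> c (inv x) = - c x" by simp
qed

lemma (in comm_group) hom_finprod_int:
  assumes "c \<in> hom G integer_group" "finite S" "e \<in> S \<rightarrow> carrier G"
  shows "c (\<Otimes>s\<in>S. e s [^] (z s :: int)) = (\<Sum>s\<in>S. z s * c (e s))"
  using assms(2,3)
proof (induction S rule: finite_induct)
  case empty
  show ?case using hom_integer(2)[OF assms(1)] by simp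
next
  case (insert s S)
  then show ?case
    using hom_integer(1)[OF assms(1)] hom_int_pow[OF assms(1)]
    by (simp add: Pi_def finprod_closed)
qed

locale fg_comm_group = comm_group G for G :: "('a, 'g) monoid_scheme" (structure) +
  fixes S :: "'s set" and e :: "'s \<Rightarrow> 'a"
  assumes fin_S: "finite S" and e_closed: "e \<in> S \<rightarrow> carrier G"
    and generated: "x \<in> carrier G \<Longrightarrow> \<exists>z :: 's \<Rightarrow> int. x = (\<Otimes>s\<in>S. e s [^] z s)"
begin

definition word :: "('s \<Rightarrow> int) \<Rightarrow> 'a" where
  "word z = (\<Otimes>s\<in>S. e s [^] z s)"

lemma word_closed [simp]: "word z \<in> carrier G"
  unfolding word_def using e_closed by (intro finprod_closed) auto

lemma word_add: "word (\<lambda>s. y s + z s) = word y \<otimes> word z"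
  unfolding word_def by (rule int_pow_finprod_hom[OF fin_S e_closed])

lemma word_scale: "word (\<lambda>s. k * z s) = word z [^] (k :: int)"
proof -
  have "(\<Otimes>s\<in>A. e s [^] (k * z s)) = (\<Otimes>s\<in>A. e s [^] z s) [^] k" if "finite A" "A \<subseteq> S" for A
    using that
  proof (induction A rule: finite_induct)
    case (insert s A)
    then have c: "e s \<in> carrier G" "e \<in> A \<rightarrow> carrier G" using e_closed by auto
    then show ?case using insert
      by (simp add: Pi_def finprod_closed int_pow_distrib int_pow_pow mult.commute)
  qed simp
  then show ?thesis unfolding word_def using fin_S by blast
qed

lemma word_0: "word (\<lambda>_. 0) = \<one>"
  unfolding word_def by simp

text \<open>The relations between the generators form a subgroup of the exponent vectors, and no
  positive multiple of a vector for \<open>x\<close> lies in it. A functional that vanishes on the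
  relations but not at this vector descends to the group.\<close>

lemma ex_hom_nonzero:
  assumes x: "x \<in> carrier G" "\<And>N :: int. N > 0 \<Longrightarrow> x [^] N \<noteq> \<one>"
  obtains \<psi> where "\<psi> \<in> hom G integer_group" "\<psi> x \<noteq> 0"
proof -
  let ?supp = "\<lambda>z s. if s \<in> S then z s else (0 :: int)"
  have supp: "word (?supp z) = word z" for z
    unfolding word_def using e_closed by (intro finprod_cong') auto
  have gen: "\<exists>z. y = word z \<and> (\<forall>i. i \<notin> S \<longrightarrow> z i = 0)" if y: "y \<in> carrier G" for y
  proof -
    obtain z where "y = word z" using generated[OF y] unfolding word_def by blast
    then show ?thesis using supp[of z] by (intro exI[of _ "?supp z"]) simp
  qed
  obtain z0 where z0: "x = word z0" "\<And>i. i \<notin> S \<Longrightarrow> z0 i = 0" using gen[OF x(1)] by blast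
  define \<Lambda> where "\<Lambda> = {z. word z = \<one> \<and> (\<forall>i. i \<notin> S \<longrightarrow> z i = 0)}"
  have "\<exists>\<psi>. (\<forall>z\<in>\<Lambda>. (\<Sum>i\<in>S. \<psi> i * z i) = 0) \<and> (\<Sum>i\<in>S. \<psi> i * z0 i) \<noteq> 0"
  proof (rule ex_int_functional[OF fin_S])
    show "(\<lambda>i. a * y i + b * z i) \<in> \<Lambda>" if "y \<in> \<Lambda>" "z \<in> \<Lambda>" for y z a b
      using that unfolding \<Lambda>_def by (simp add: word_add word_scale)
    show "(\<lambda>i. N * z0 i) \<notin> \<Lambda>" if "N > 0" for N
      using x(2)[OF that] z0(1) unfolding \<Lambda>_def by (simp add: word_scale)
  qed (use z0(2) word_0 in \<open>auto simp: \<Lambda>_def\<close>)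
  then obtain \<psi> where \<psi>: "\<And>z. z \<in> \<Lambda> \<Longrightarrow> (\<Sum>i\<in>S. \<psi> i * z i) = 0" "(\<Sum>i\<in>S. \<psi> i * z0 i) \<noteq> 0" by blast
  \<comment> \<open>The word for \<open>y\<close> is an arbitrary choice; the value does not depend
    on it because \<psi> vanishes on relations.\<close>
  define h where "h y = (\<Sum>i\<in>S. \<psi> i * (SOME z. y = word z \<and> (\<forall>i. i \<notin> S \<longrightarrow> z i = 0)) i)" for y
  have h: "h (word z) = (\<Sum>i\<in>S. \<psi> i * z i)" for z
  proof -
    define z' where "z' = (SOME z'. word z = word z' \<and> (\<forall>i. i \<notin> S \<longrightarrow> z' i = 0))"
    have z': "word z = word z' \<and> (\<forall>i. i \<notin> S \<longrightarrow> z' i = 0)"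
      unfolding z'_def by (rule someI_ex[OF gen[OF word_closed]])
    have "word (\<lambda>s. ?supp z s + (- 1) * z' s) = \<one>"
      using z' word_add[of "?supp z" "\<lambda>s. (- 1) * z' s"] word_scale[of "-1" z'] supp[of z] by (simp add: int_pow_neg)
    then have "(\<lambda>s. ?supp z s + (- 1) * z' s) \<in> \<Lambda>" unfolding \<Lambda>_def using z' by simp
    from \<psi>(1)[OF this] have "(\<Sum>i\<in>S. \<psi> i * z i - \<psi> i * z' i) = 0"
      by (simp add: algebra_simps)
    then show ?thesis unfolding h_def z'_def[symmetric] by (simp add: sum_subtractf)
  qed
  have "h \<in> hom G integer_group"
  proof (rule homI)
    fix y y' assume y: "y \<in> carrier G" "y' \<in> carrier G"
    then obtain z z' where z: "y = word z" "y' = word z'" using gen by meson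
    have "h (y \<otimes> y') = (\<Sum>i\<in>S. \<psi> i * (z i + z' i))" unfolding z word_add[symmetric] by (rule h)
    then show "h (y \<otimes> y') = h y \<otimes>\<^bsub>integer_group\<^esub> h y'"
      unfolding z h by (simp add: algebra_simps sum.distrib)
  qed simp
  moreover have "h x \<noteq> 0" unfolding z0(1) h by (rule \<psi>(2))
  ultimately show thesis by (rule that)
qed

end

text \<open>In a commutative group such dual families amount to a splitting into a free part with
  basis \<open>g\<close> and the common kernel of the characters \<open>c\<close>.\<close>

definition (in group) biorth :: "nat \<Rightarrow> (nat \<Rightarrow> 'a \<Rightarrow> int) \<Rightarrow> (nat \<Rightarrow> 'a) \<Rightarrow> bool" where
  "biorth n c g \<longleftrightarrow> (\<forall>i<n. c i \<in> hom G integer_group \<and> g i \<in> carrier G) \<and>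
     (\<forall>i<n. \<forall>j<n. c i (g j) = (if i = j then 1 else 0))"

context comm_group
begin

context
  fixes n c g
  assumes bi: "biorth n c g"
begin

lemma biorth_hom: "i < n \<Longrightarrow> c i \<in> hom G integer_group"
  and biorth_closed: "g \<in> {..<n} \<rightarrow> carrier G"
  and biorth_delta: "i < n \<Longrightarrow> j < n \<Longrightarrow> c i (g j) = (if i = j then 1 else 0)"
  using bi unfolding biorth_def by auto

definition combo :: "(nat \<Rightarrow> int) \<Rightarrow> 'a" where
  "combo y = (\<Otimes>i\<in>{..<n}. g i [^] y i)"

lemma combo_closed [simp]: "combo y \<in> carrier G"
  unfolding combo_def using biorth_closed by (intro finprod_closed) auto

lemma combo_add: "combo (\<lambda>i. y i + z i) = combo y \<otimes> combo z"
  unfolding combo_def by (rule int_pow_finprod_hom[OF _ biorth_closed]) simp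

lemma hom_combo: "i < n \<Longrightarrow> c i (combo y) = y i"
  unfolding combo_def
  using hom_finprod_int[OF biorth_hom, of i "{..<n}" g y] biorth_closed biorth_delta
  by (simp add: if_distrib[of "\<lambda>t. _ * t"] sum.delta cong: if_cong)

lemma combo_cong: "(\<And>i. i < n \<Longrightarrow> y i = z i) \<Longrightarrow> combo y = combo z"
  unfolding combo_def using biorth_closed by (intro finprod_cong') auto

definition ker :: "'a set" where
  "ker = {x \<in> carrier G. \<forall>i<n. c i x = 0}"

definition proj :: "'a \<Rightarrow> 'a" where
  "proj x = x \<otimes> inv (combo (\<lambda>i. c i x))"

lemma proj_ker: "x \<in> carrier G \<Longrightarrow> proj x \<in> ker"
  unfolding ker_def proj_def using hom_combo
  by (auto simp: hom_integer[OF biorth_hom])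

lemma proj_eq: "x \<in> ker \<Longrightarrow> proj x = x"
proof -
  assume x: "x \<in> ker"
  have "combo (\<lambda>i. c i x) = combo (\<lambda>_. 0)" by (rule combo_cong) (use x in \<open>simp add: ker_def\<close>)
  also have "\<dots> = \<one>" unfolding combo_def by simp
  finally show ?thesis unfolding proj_def using x by (simp add: ker_def)
qed

lemma proj_hom: "proj \<in> hom G G"
proof (rule homI)
  show "proj x \<in> carrier G" if "x \<in> carrier G" for x using proj_ker[OF that] by (simp add: ker_def)
  fix x y assume xy: "x \<in> carrier G" "y \<in> carrier G"
  have "combo (\<lambda>i. c i (x \<otimes> y)) = combo (\<lambda>i. c i x + c i y)"
    by (rule combo_cong) (simp add: xy hom_integer[OF biorth_hom])
  then show "proj (x \<otimes> y) = proj x \<otimes> proj y"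
    unfolding proj_def using xy by (simp add: combo_add inv_mult m_ac)
qed

lemma subgroup_ker: "subgroup ker G"
  by (rule subgroupI) (auto simp: ker_def hom_integer[OF biorth_hom] intro: exI[of _ \<one>])

lemma iso_combo:
  "(\<lambda>(y, k). combo y \<otimes> k) \<in> iso (int_vectors n \<times>\<times> G\<lparr>carrier := ker\<rparr>) G"
proof (rule isoI)
  let ?P = "int_vectors n \<times>\<times> G\<lparr>carrier := ker\<rparr>" and ?h = "\<lambda>(y, k). combo y \<otimes> k"
  have kc: "k \<in> carrier G" if "k \<in> ker" for k using that by (simp add: ker_def)
  show "?h \<in> hom (?P) G"
  proof (rule homI)
    fix p q assume "p \<in> carrier (?P)" "q \<in> carrier (?P)"
    then obtain y k z l where p: "p = (y, k)" "k \<in> ker" and q: "q = (z, l)" "l \<in> ker" by auto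
    have "combo (\<lambda>i\<in>{..<n}. y i + z i) = combo (\<lambda>i. y i + z i)" by (rule combo_cong) simp
    then show "?h (p \<otimes>\<^bsub>?P\<^esub> q) =
        ?h p \<otimes> ?h q"
      using p q kc by (simp add: combo_add m_ac)
  next
    fix p assume "p \<in> carrier (?P)"
    then obtain y k where p: "p = (y, k)" "k \<in> ker" by (cases p) simp
    show "?h p \<in> carrier G" unfolding p(1) using kc[OF p(2)] by simp
  qed
  show "bij_betw ?h (carrier (?P)) (carrier G)"
    unfolding bij_betw_def
  proof
    show "inj_on ?h (carrier (?P))"
    proof (rule inj_onI)
      fix p q
      assume "p \<in> carrier (?P)" "q \<in> carrier (?P)"
        and pq_eq: "?h p = ?h q"
      then obtain y k z l where p: "p = (y, k)" and q: "q = (z, l)"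
        and y: "y \<in> {..<n} \<rightarrow>\<^sub>E UNIV" and z: "z \<in> {..<n} \<rightarrow>\<^sub>E UNIV" and k: "k \<in> ker" "l \<in> ker"
        by (cases p; cases q) simp
      have eq: "combo y \<otimes> k = combo z \<otimes> l" using pq_eq p q by simp
      have "y i = z i" if "i < n" for i
      proof -
        have "c i (combo y \<otimes> k) = c i (combo z \<otimes> l)" using eq by simp
        moreover have "k \<in> carrier G" "l \<in> carrier G" "c i k = 0" "c i l = 0"
          using k that unfolding ker_def by blast+
        ultimately show ?thesis using that by (simp add: hom_integer(1)[OF biorth_hom] hom_combo)
      qed
      then have "y = z" using y z by (intro PiE_ext[of y "{..<n}" _ z]) auto
      then show "p = q" using eq k kc p q by simp
    qed
    show "?h ` carrier (?P) = carrier G"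
    proof
      show "carrier G \<subseteq> ?h ` carrier (?P)"
      proof
        fix x assume x: "x \<in> carrier G"
        have "combo (\<lambda>i\<in>{..<n}. c i x) = combo (\<lambda>i. c i x)" by (rule combo_cong) simp
        then have "x = combo (\<lambda>i\<in>{..<n}. c i x) \<otimes> proj x"
          unfolding proj_def using x by (simp add: m_lcomm)
        then show "x \<in> ?h ` carrier (?P)"
          using proj_ker[OF x] by (intro image_eqI[of _ _ "((\<lambda>i\<in>{..<n}. c i x), proj x)"]) auto
      qed
      show "?h ` carrier (?P) \<subseteq> carrier G"
      proof
        fix x assume "x \<in> ?h ` carrier (?P)"
        then obtain y k where "x = combo y \<otimes> k" "k \<in> ker" by fastforce
        then show "x \<in> carrier G" using kc by simp
      qed
    qed
  qed
qed

end

end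

context fg_comm_group
begin

text \<open>The parities of the \<open>c i\<close> at an element depend only on the parities of its
  exponents, so at most \<open>2 ^ card S\<close> patterns occur, while combinations of the
  \<open>g i\<close> realise all of them.\<close>

lemma biorth_le_card:
  assumes "biorth n c g"
  shows "n \<le> card S"
proof (rule card_le_if_parity_surj[of "Pow S" "card S" n "\<lambda>B i. \<Sum>s\<in>B. c i (e s)"])
  fix y :: "nat \<Rightarrow> int"
  obtain z :: "'s \<Rightarrow> int" where z: "combo n g y = (\<Otimes>s\<in>S. e s [^] z s)"
    using generated[OF combo_closed[OF assms]] by blast
  have "even (y i - (\<Sum>s\<in>{s \<in> S. odd (z s)}. c i (e s)))" if i: "i < n" for i
  proof -
    have "y i = (\<Sum>s\<in>S. z s * c i (e s))"
      using hom_combo[OF assms i, of y] hom_finprod_int[OF biorth_hom[OF assms i] fin_S e_closed, of z] z by simp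
    moreover have "(\<Sum>s\<in>{s \<in> S. odd (z s)}. c i (e s)) = (\<Sum>s\<in>S. (if odd (z s) then c i (e s) else 0))"
      using fin_S by (simp add: sum.inter_filter)
    ultimately have "y i - (\<Sum>s\<in>{s \<in> S. odd (z s)}. c i (e s)) =
        (\<Sum>s\<in>S. z s * c i (e s) - (if odd (z s) then c i (e s) else 0))"
      by (simp add: sum_subtractf)
    moreover have "even \<dots>" by (rule dvd_sum) auto
    ultimately show ?thesis by simp
  qed
  then show "\<exists>B\<in>Pow S. \<forall>i<n. even (y i - (\<Sum>s\<in>B. c i (e s)))"
    by (intro bexI[of _ "{s \<in> S. odd (z s)}"]) auto
qed (simp_all add: fin_S card_Pow)

text \<open>A kernel element of infinite order supplies a character \<psi> that is nonzero on the
  kernel; its values there are the multiples of a least positive \<open>d\<close>. The new character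
  is \<psi> divided by \<open>d\<close>, after projection to the kernel, which makes it vanish on
  the old \<open>g j\<close>.\<close>

lemma biorth_extend:
  assumes bi: "biorth n c g" and x: "x \<in> ker n c" "\<And>N :: int. N > 0 \<Longrightarrow> x [^] N \<noteq> \<one>"
  obtains c' g' where "biorth (Suc n) c' g'"
proof -
  have kc: "k \<in> carrier G" if "k \<in> ker n c" for k using that by (simp add: ker_def[OF bi])
  obtain \<psi> where \<psi>: "\<psi> \<in> hom G integer_group" "\<psi> x \<noteq> 0"
    using ex_hom_nonzero[OF kc[OF x(1)] x(2)] by blast
  note \<psi>_hom = hom_integer[OF \<psi>(1)] hom_int_pow[OF \<psi>(1)]
  interpret K: subgroup "ker n c" G by (rule subgroup_ker[OF bi])
  have K_pow: "k [^] (m :: int) \<in> ker n c" if "k \<in> ker n c" for k m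
    using that by (rule subgroup_int_pow_closed[OF subgroup_ker[OF bi]])
  define P where "P d \<longleftrightarrow> d > 0 \<and> (\<exists>k\<in>ker n c. \<psi> k = int d)" for d
  have "P (nat \<bar>\<psi> x\<bar>)"
  proof (cases "\<psi> x > 0")
    case True
    then show ?thesis unfolding P_def using x(1) by auto
  next
    case False
    have "\<psi> (inv x) = int (nat \<bar>\<psi> x\<bar>)" using False kc[OF x(1)] \<psi>_hom by simp
    then show ?thesis unfolding P_def using x(1) \<psi>(2) by auto
  qed
  define d where "d = (LEAST d. P d)"
  have "P d" unfolding d_def using \<open>P (nat \<bar>\<psi> x\<bar>)\<close> by (rule LeastI)
  then obtain x1 where x1: "x1 \<in> ker n c" "\<psi> x1 = int d" and d: "d > 0" unfolding P_def by blast
  have dvd: "int d dvd \<psi> k" if k: "k \<in> ker n c" for k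
  proof (rule ccontr)
    assume "\<not> int d dvd \<psi> k"
    then have m: "\<psi> k mod int d \<noteq> 0" by (simp add: dvd_eq_mod_eq_0)
    let ?q = "\<psi> k div int d"
    have "\<psi> (k \<otimes> x1 [^] (- ?q)) = \<psi> k - ?q * int d"
      using \<psi>_hom kc[OF k] kc[OF x1(1)] x1(2) by simp
    also have "\<dots> = int (nat (\<psi> k mod int d))" using d by (simp add: minus_div_mult_eq_mod)
    finally have "\<psi> (k \<otimes> x1 [^] (- ?q)) = int (nat (\<psi> k mod int d))" .
    moreover have "k \<otimes> x1 [^] (- ?q) \<in> ker n c" using k K_pow[OF x1(1)] by blast
    moreover have pos: "0 < \<psi> k mod int d" "\<psi> k mod int d < int d"
      using m d pos_mod_sign[of "int d" "\<psi> k"] pos_mod_bound[of "int d" "\<psi> k"] by linarith+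
    ultimately have "P (nat (\<psi> k mod int d))" unfolding P_def by auto
    then have "d \<le> nat (\<psi> k mod int d)" unfolding d_def by (rule Least_le)
    then show False using pos by linarith
  qed
  let ?pr = "proj n c g"
  have pr_hom: "?pr \<in> hom G G" and pr_ker: "y \<in> carrier G \<Longrightarrow> ?pr y \<in> ker n c" for y
    using proj_hom[OF bi] proj_ker[OF bi] by blast+
  define c' where "c' i y = (if i < n then c i y else \<psi> (?pr y) div int d)" for i y
  define g' where "g' i = (if i < n then g i else x1)" for i
  have g_closed: "g i \<in> carrier G" if "i < n" for i using biorth_closed[OF bi] that by auto
  have pr_g: "?pr (g j) = \<one>" if j: "j < n" for j
  proof -
    have "combo n g (\<lambda>i. c i (g j)) = combo n g (\<lambda>i. if i = j then 1 else 0)"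
      by (rule combo_cong[OF bi]) (simp add: biorth_delta[OF bi _ j])
    also have "\<dots> = (\<Otimes>i\<in>{..<n}. if i = j then g i else \<one>)"
      unfolding combo_def[OF bi] using g_closed by (intro finprod_cong') auto
    also have "\<dots> = g j"
      using finprod_singleton_swap[of j "{..<n}" g] g_closed j by auto
    finally show ?thesis unfolding proj_def[OF bi] using g_closed[OF j] by simp
  qed
  have "biorth (Suc n) c' g'"
    unfolding biorth_def
  proof (intro conjI allI impI)
    fix i assume i: "i < Suc n"
    show "c' i \<in> hom G integer_group"
    proof (cases "i < n")
      case True
      then have "c' i = c i" unfolding c'_def by auto
      then show ?thesis using biorth_hom[OF bi True] by simp
    next
      case False
      show ?thesis
      proof (rule homI)
        fix y z assume yz: "y \<in> carrier G" "z \<in> carrier G"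
        have "?pr (y \<otimes> z) = ?pr y \<otimes> ?pr z" using pr_hom yz by (simp add: hom_def)
        then have "\<psi> (?pr (y \<otimes> z)) = \<psi> (?pr y) + \<psi> (?pr z)"
          using \<psi>_hom(1) kc[OF pr_ker] yz by simp
        then show "c' i (y \<otimes> z) = c' i y \<otimes>\<^bsub>integer_group\<^esub> c' i z"
          unfolding c'_def using False dvd[OF pr_ker] yz by (simp add: div_plus_div_distrib_dvd_left)
      qed simp
    qed
    show "g' i \<in> carrier G" unfolding g'_def using g_closed kc[OF x1(1)] by simp
  next
    fix i j assume ij: "i < Suc n" "j < Suc n"
    consider "i < n" "j < n" | "i < n" "j = n" | "i = n" "j < n" | "i = n" "j = n" using ij by linarith
    then show "c' i (g' j) = (if i = j then 1 else 0)"
    proof cases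
      case 1
      then show ?thesis unfolding c'_def g'_def using biorth_delta[OF bi] by simp
    next
      case 2
      then have "c i x1 = 0" using x1(1) unfolding ker_def[OF bi] by blast
      then show ?thesis using 2 unfolding c'_def g'_def by simp
    next
      case 3
      then show ?thesis unfolding c'_def g'_def using pr_g \<psi>_hom(2) by simp
    next
      case 4
      then show ?thesis unfolding c'_def g'_def using proj_eq[OF bi x1(1)] x1(2) d by simp
    qed
  qed
  then show thesis by (rule that)
qed

text \<open>For a maximal biorthogonal system the common kernel is a torsion group, and a finitely
  generated one.\<close>
theorem ex_biorth_finite_ker:
  obtains n c g where "biorth n c g" "finite (ker n c)"
proof -
  have "\<exists>n. \<exists>c g. biorth n c g" by (intro exI[of _ 0]) (simp add: biorth_def)
  moreover have "\<forall>n. (\<exists>c g. biorth n c g) \<longrightarrow> n \<le> card S" using biorth_le_card by blast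
  ultimately obtain n where "\<exists>c g. biorth n c g" and max: "\<And>m. \<exists>c g. biorth m c g \<Longrightarrow> m \<le> n"
    using Nat.ex_has_greatest_nat[of "\<lambda>n. \<exists>c g. biorth n c g" _ "card S"] by (metis le_trans)
  then obtain c g where bi: "biorth n c g" by blast
  let ?pr = "proj n c g"
  have kc: "k \<in> carrier G" if "k \<in> ker n c" for k using that by (simp add: ker_def[OF bi])
  have tors: "\<exists>N::int. N > 0 \<and> k [^] N = \<one>" if "k \<in> ker n c" for k
    using biorth_extend[OF bi that] max by (metis Suc_n_not_le_n)
  have pe: "?pr (e s) \<in> ker n c" if "s \<in> S" for s
    using proj_ker[OF bi] e_closed that by blast
  have "\<forall>s\<in>S. \<exists>N::int. N > 0 \<and> ?pr (e s) [^] N = \<one>" using tors pe by blast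
  then obtain N :: "'s \<Rightarrow> int" where N: "\<And>s. s \<in> S \<Longrightarrow> N s > 0 \<and> ?pr (e s) [^] N s = \<one>" by metis
  let ?W = "\<lambda>z. \<Otimes>s\<in>S. ?pr (e s) [^] (z s :: int)"
  \<comment> \<open>The kernel is generated by the projections of the generators. These are torsion
    elements, so their exponents can be reduced modulo \<open>N s\<close>.\<close>
  have "ker n c \<subseteq> ?W ` (PiE S (\<lambda>s. {0..<N s}))"
  proof
    fix k assume k: "k \<in> ker n c"
    obtain z :: "'s \<Rightarrow> int" where z: "k = (\<Otimes>s\<in>S. e s [^] z s)" using generated[OF kc[OF k]] by blast
    interpret pr: group_hom G G ?pr
      by (simp add: group_hom_def group_hom_axioms_def group_axioms proj_hom[OF bi])
    have "?pr (\<Otimes>s\<in>A. e s [^] z s) = (\<Otimes>s\<in>A. ?pr (e s) [^] z s)" if "finite A" "A \<subseteq> S" for A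
      using that
    proof (induction A rule: finite_induct)
      case (insert s A)
      then have es: "e s \<in> carrier G" "\<And>t. t \<in> A \<Longrightarrow> e t \<in> carrier G" using e_closed by auto
      then show ?case using insert by (simp add: Pi_def finprod_closed pr.hom_int_pow)
    qed simp
    then have "k = ?W z" using proj_eq[OF bi k] z fin_S by auto
    also have "?W z = ?W (\<lambda>s\<in>S. z s mod N s)"
    proof (rule finprod_cong')
      fix s assume s: "s \<in> S"
      have c: "?pr (e s) \<in> carrier G" using kc[OF pe[OF s]] .
      have "?pr (e s) [^] z s = ?pr (e s) [^] (N s * (z s div N s) + z s mod N s)" by simp
      also have "\<dots> = (?pr (e s) [^] N s) [^] (z s div N s) \<otimes> ?pr (e s) [^] (z s mod N s)"
        using c by (simp only: int_pow_mult int_pow_pow)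
      also have "\<dots> = ?pr (e s) [^] (z s mod N s)" using N[OF s] c by simp
      finally show "?pr (e s) [^] z s = ?pr (e s) [^] (\<lambda>s\<in>S. z s mod N s) s" using s by simp
    qed (use kc pe in auto)
    finally show "k \<in> ?W ` (PiE S (\<lambda>s. {0..<N s}))" using N by (intro image_eqI) auto
  qed
  moreover have "finite (PiE S (\<lambda>s. {0..<N s}))" using fin_S by (simp add: finite_PiE)
  ultimately have "finite (ker n c)" using finite_surj by blast
  with bi show thesis by (rule that)
qed

end

text \<open>Integer characters kill the finite factor, and their parities depend only on the
  parities of the \<open>n\<close> coordinates; thus \<open>2 ^ n\<close> elements realise all
  \<open>2 ^ m\<close> patterns.\<close>

lemma (in comm_group) biorth_le_rank:
  assumes bi: "biorth m c g" and iso: "G \<cong> int_vectors n \<times>\<times> T" and T: "comm_group T" "finite (carrier T)"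
  shows "m \<le> n"
proof -
  let ?P = "int_vectors n \<times>\<times> T" and ?o = "\<lambda>i\<in>{..<n}. 0 :: int"
  interpret T: comm_group T by (rule T(1))
  have grp: "group (?P)"
    by (intro DirProd_group product_group T.group_axioms) simp
  obtain \<theta> where \<theta>: "\<theta> \<in> iso (?P) G"
    using group.iso_sym[OF group_axioms iso] unfolding is_iso_def by blast
  interpret \<theta>: group_hom "?P" G \<theta>
    using \<theta> by (simp add: group_hom_def group_hom_axioms_def group_axioms grp iso_def)
  show ?thesis
  proof (rule card_le_if_parity_surj[of "PiE {..<n} (\<lambda>_. {0, 1::int})" n m "\<lambda>a i. c i (\<theta> (a, \<one>\<^bsub>T\<^esub>))"])
    fix y :: "nat \<Rightarrow> int"
    have "combo m g y \<in> \<theta> ` carrier (?P)"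
      using \<theta> combo_closed[OF bi] by (auto simp: iso_def bij_betw_def)
    then obtain a t where at: "combo m g y = \<theta> (a, t)" "a \<in> {..<n} \<rightarrow>\<^sub>E UNIV" "t \<in> carrier T" by auto
    define p where "p = (\<lambda>i\<in>{..<n}. a i mod 2)"
    define q where "q = (\<lambda>i\<in>{..<n}. a i div 2)"
    have pq: "(p, \<one>\<^bsub>T\<^esub>) \<in> carrier (?P)" "(q, \<one>\<^bsub>T\<^esub>) \<in> carrier (?P)"
      unfolding p_def q_def by auto
    have ot: "(?o, t) \<in> carrier (?P)" using at(3) by auto
    \<comment> \<open>Parity part, twice a vector, and torsion part: only the first contributes to
      the parity of a character.\<close>
    have "(a, t) = (p, \<one>\<^bsub>T\<^esub>) \<otimes>\<^bsub>?P\<^esub> ((q, \<one>\<^bsub>T\<^esub>) \<otimes>\<^bsub>?P\<^esub> (q, \<one>\<^bsub>T\<^esub>)) \<otimes>\<^bsub>?P\<^esub> (?o, t)"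
    proof -
      have "a i = a i mod 2 + (a i div 2 + a i div 2)" for i by presburger
      then have "a = (\<lambda>i\<in>{..<n}. p i + (q i + q i) + 0)"
        unfolding p_def q_def using at(2) by (intro PiE_ext[of a "{..<n}" "\<lambda>_. UNIV"]) auto
      then show ?thesis using at(3) by (simp add: restrict_def fun_eq_iff)
    qed
    then have eq: "\<theta> (a, t) = \<theta> (p, \<one>\<^bsub>T\<^esub>) \<otimes> (\<theta> (q, \<one>\<^bsub>T\<^esub>) \<otimes> \<theta> (q, \<one>\<^bsub>T\<^esub>)) \<otimes> \<theta> (?o, t)"
      using pq ot by (simp only: \<theta>.hom_mult group.is_monoid[OF grp] monoid.m_closed)
    have "even (y i - c i (\<theta> (p, \<one>\<^bsub>T\<^esub>)))" if i: "i < m" for i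
    proof -
      note ch = hom_integer[OF biorth_hom[OF bi i]] hom_int_pow[OF biorth_hom[OF bi i]]
      have "\<theta> (?o, t) [^] int (card (carrier T)) = \<one>"
      proof -
        have "(?o, t) [^]\<^bsub>?P\<^esub> k = ((\<lambda>i\<in>{..<n}. 0), t [^]\<^bsub>T\<^esub> k)" for k :: nat
          by (induction k) (auto simp: fun_eq_iff)
        then have "(?o, t) [^]\<^bsub>?P\<^esub> card (carrier T) = \<one>\<^bsub>?P\<^esub>"
          using T.pow_order_eq_1[OF at(3)] by (simp add: order_def)
        then have "\<theta> (?o, t) [^] card (carrier T) = \<one>"
          using \<theta>.hom_nat_pow[OF ot] \<theta>.hom_one by metis
        then show ?thesis by (simp add: int_pow_int)
      qed
      then have "int (card (carrier T)) * c i (\<theta> (?o, t)) = 0"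
        using ch(4)[of "\<theta> (?o, t)" "int (card (carrier T))"] \<theta>.hom_closed[OF ot] ch(2) by simp
      moreover have "card (carrier T) > 0" using T(2) at(3) by (auto simp: card_gt_0_iff)
      ultimately have "c i (\<theta> (?o, t)) = 0" by simp
      then have "c i (\<theta> (a, t)) = c i (\<theta> (p, \<one>\<^bsub>T\<^esub>)) + 2 * c i (\<theta> (q, \<one>\<^bsub>T\<^esub>))"
        unfolding eq using pq ot \<theta>.hom_closed by (simp only: ch(1) m_closed)
      moreover have "c i (\<theta> (a, t)) = y i" unfolding at(1)[symmetric] by (rule hom_combo[OF bi i])
      ultimately show ?thesis by simp
    qed
    moreover have "p \<in> PiE {..<n} (\<lambda>_. {0, 1})" unfolding p_def by auto
    ultimately show "\<exists>p\<in>PiE {..<n} (\<lambda>_. {0, 1}). \<forall>i<m. even (y i - c i (\<theta> (p, \<one>\<^bsub>T\<^esub>)))" by blast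
  qed (simp_all add: finite_PiE card_PiE numeral_2_eq_2)
qed

lemma (in comm_group) ex_biorth_if_iso:
  assumes iso: "G \<cong> int_vectors n \<times>\<times> T" and T: "group T"
  obtains c g where "biorth n c g"
proof -
  let ?P = "int_vectors n \<times>\<times> T"
  interpret T: group T by (rule T)
  have grp: "group (?P)"
    by (intro DirProd_group product_group T.group_axioms) simp
  obtain \<theta> where \<theta>: "\<theta> \<in> iso G (?P)" using iso unfolding is_iso_def by blast
  interpret \<theta>: group_hom G "?P" \<theta>
    using \<theta> by (simp add: group_hom_def group_hom_axioms_def group_axioms grp iso_def)
  have surj: "\<exists>x\<in>carrier G. \<theta> x = ((\<lambda>i\<in>{..<n}. if i = j then 1 else 0), \<one>\<^bsub>T\<^esub>)" for j
  proof -
    have "((\<lambda>i\<in>{..<n}. if i = j then 1 else 0), \<one>\<^bsub>T\<^esub>) \<in> \<theta> ` carrier G"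
      using \<theta> by (auto simp: iso_def bij_betw_def)
    then show ?thesis by (metis imageE)
  qed
  then obtain g where g: "\<And>j. g j \<in> carrier G" "\<And>j. \<theta> (g j) = ((\<lambda>i\<in>{..<n}. if i = j then 1 else 0), \<one>\<^bsub>T\<^esub>)"
    by metis
  have "biorth n (\<lambda>i x. fst (\<theta> x) i) g"
    unfolding biorth_def
  proof (intro conjI allI impI)
    fix i assume i: "i < n"
    show "(\<lambda>x. fst (\<theta> x) i) \<in> hom G integer_group"
      by (rule homI) (use i in \<open>auto simp: mult_DirProd'\<close>)
  qed (use g in auto)
  then show thesis by (rule that)
qed


section \<open>Group completion and rank\<close>

definition fraction :: "('m, 'b) monoid_scheme \<Rightarrow> 'm \<Rightarrow> 'm \<Rightarrow> ('m \<times> 'm) set" where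
  "fraction M a b = fraction_rel M `` {(a, b)}"

context comm_monoid
begin

abbreviation (input) "GG \<equiv> group_completion G"

lemma equiv_fraction_rel: "equiv (carrier G \<times> carrier G) (fraction_rel G)"
proof (rule equivI)
  show "refl_on (carrier G \<times> carrier G) (fraction_rel G)"
    by (rule refl_onI) (auto simp: fraction_rel_def)
  show "sym (fraction_rel G)" by (rule symI) (clarsimp simp: fraction_rel_def, metis)
  show "trans (fraction_rel G)"
  proof (rule transI)
    fix p q t assume pq: "(p, q) \<in> fraction_rel G" and qt: "(q, t) \<in> fraction_rel G"
    obtain a b a' b' a'' b'' where eq: "p = (a, b)" "q = (a', b')" "t = (a'', b'')" by (metis surj_pair)
    have cl: "a \<in> carrier G" "b \<in> carrier G" "a' \<in> carrier G" "b' \<in> carrier G" "a'' \<in> carrier G" "b'' \<in> carrier G"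
      using pq qt unfolding eq fraction_rel_def by auto
    obtain c d where c: "c \<in> carrier G" "a \<otimes> b' \<otimes> c = a' \<otimes> b \<otimes> c"
      and d: "d \<in> carrier G" "a' \<otimes> b'' \<otimes> d = a'' \<otimes> b' \<otimes> d"
      using pq qt unfolding eq fraction_rel_def by auto
    \<comment> \<open>The common factor for the composite is the product of both given factors and
      the middle denominator \<open>b'\<close>.\<close>
    have "a \<otimes> b'' \<otimes> (b' \<otimes> c \<otimes> d) = (a \<otimes> b' \<otimes> c) \<otimes> (b'' \<otimes> d)" using cl c(1) d(1) by (simp add: m_ac)
    also have "\<dots> = (a' \<otimes> b'' \<otimes> d) \<otimes> (b \<otimes> c)" unfolding c(2) using cl c(1) d(1) by (simp add: m_ac)
    also have "\<dots> = a'' \<otimes> b \<otimes> (b' \<otimes> c \<otimes> d)" unfolding d(2) using cl c(1) d(1) by (simp add: m_ac)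
    finally have "a \<otimes> b'' \<otimes> (b' \<otimes> c \<otimes> d) = a'' \<otimes> b \<otimes> (b' \<otimes> c \<otimes> d)" .
    moreover have "b' \<otimes> c \<otimes> d \<in> carrier G" using cl c(1) d(1) by simp
    ultimately show "(p, t) \<in> fraction_rel G" unfolding eq fraction_rel_def using cl by blast
  qed
qed (auto simp: fraction_rel_def)

lemma fraction_eq_iff:
  assumes "a \<in> carrier G" "b \<in> carrier G" "a' \<in> carrier G" "b' \<in> carrier G"
  shows "fraction G a b = fraction G a' b' \<longleftrightarrow> (\<exists>c\<in>carrier G. a \<otimes> b' \<otimes> c = a' \<otimes> b \<otimes> c)"
proof -
  have "fraction G a b = fraction G a' b' \<longleftrightarrow> ((a, b), (a', b')) \<in> fraction_rel G"
    unfolding fraction_def by (rule eq_equiv_class_iff[OF equiv_fraction_rel]) (use assms in auto)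
  then show ?thesis using assms unfolding fraction_rel_def by auto
qed

lemma fraction_closed: "a \<in> carrier G \<Longrightarrow> b \<in> carrier G \<Longrightarrow> fraction G a b \<in> carrier GG"
  unfolding fraction_def group_completion_def by (auto intro: quotientI)

lemma fraction_cases:
  assumes "P \<in> carrier GG"
  obtains a b where "a \<in> carrier G" "b \<in> carrier G" "P = fraction G a b"
  using assms unfolding fraction_def group_completion_def by (auto elim!: quotientE)

text \<open>The class of the product does not depend on the representatives, so the union over them
  collapses to a single class.\<close>

lemma fraction_mult:
  assumes "a \<in> carrier G" "b \<in> carrier G" "a' \<in> carrier G" "b' \<in> carrier G"
  shows "fraction G a b \<otimes>\<^bsub>GG\<^esub> fraction G a' b' = fraction G (a \<otimes> a') (b \<otimes> b')"
proof -
  have "congruent2 (fraction_rel G) (fraction_rel G) (\<lambda>(a, b) (a', b'). fraction G (a \<otimes> a') (b \<otimes> b'))"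
  proof (rule congruent2I')
    fix p p' q q' assume p: "(p, p') \<in> fraction_rel G" and q: "(q, q') \<in> fraction_rel G"
    obtain a b a' b' x y x' y' where eq: "p = (a, b)" "p' = (a', b')" "q = (x, y)" "q' = (x', y')"
      by (metis surj_pair)
    have cl: "a \<in> carrier G" "b \<in> carrier G" "a' \<in> carrier G" "b' \<in> carrier G"
        "x \<in> carrier G" "y \<in> carrier G" "x' \<in> carrier G" "y' \<in> carrier G"
      using p q unfolding eq fraction_rel_def by auto
    obtain c d where c: "c \<in> carrier G" "a \<otimes> b' \<otimes> c = a' \<otimes> b \<otimes> c"
      and d: "d \<in> carrier G" "x \<otimes> y' \<otimes> d = x' \<otimes> y \<otimes> d"
      using p q unfolding eq fraction_rel_def by auto
    have "a \<otimes> x \<otimes> (b' \<otimes> y') \<otimes> (c \<otimes> d) = (a \<otimes> b' \<otimes> c) \<otimes> (x \<otimes> y' \<otimes> d)" using cl c(1) d(1) by (simp add: m_ac)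
    also have "\<dots> = a' \<otimes> x' \<otimes> (b \<otimes> y) \<otimes> (c \<otimes> d)" unfolding c(2) d(2) using cl c(1) d(1) by (simp add: m_ac)
    finally have "fraction G (a \<otimes> x) (b \<otimes> y) = fraction G (a' \<otimes> x') (b' \<otimes> y')"
      using cl c(1) d(1) by (subst fraction_eq_iff) auto
    then show "(case p of (a, b) \<Rightarrow> \<lambda>(a', b'). fraction G (a \<otimes> a') (b \<otimes> b')) q =
        (case p' of (a, b) \<Rightarrow> \<lambda>(a', b'). fraction G (a \<otimes> a') (b \<otimes> b')) q'" unfolding eq by simp
  qed
  from UN_equiv_class2[OF equiv_fraction_rel equiv_fraction_rel this, of "(a, b)" "(a', b')"]
  show ?thesis using assms unfolding fraction_def group_completion_def by (simp add: case_prod_unfold)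
qed

lemma fraction_one: "\<one>\<^bsub>GG\<^esub> = fraction G \<one> \<one>"
  by (simp add: group_completion_def fraction_def)

lemma comm_group_completion: "comm_group (group_completion G)"
proof (rule comm_groupI)
  fix P Q T
  assume P: "P \<in> carrier GG"
  then obtain a b where p: "a \<in> carrier G" "b \<in> carrier G" "P = fraction G a b" by (rule fraction_cases)
  show "\<one>\<^bsub>GG\<^esub> \<otimes>\<^bsub>GG\<^esub> P = P"
    unfolding fraction_one p(3) using p(1,2) by (simp add: fraction_mult)
  have "fraction G (b \<otimes> a) (a \<otimes> b) = fraction G \<one> \<one>"
    using p(1,2) by (subst fraction_eq_iff) (auto simp: m_comm intro: bexI[of _ \<one>])
  then show "\<exists>Q\<in>carrier GG. Q \<otimes>\<^bsub>GG\<^esub> P = \<one>\<^bsub>GG\<^esub>"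
    using p fraction_closed[OF p(2,1)] by (intro bexI[of _ "fraction G b a"]) (simp_all add: fraction_mult fraction_one)
  assume Q: "Q \<in> carrier GG"
  then obtain c d where q: "c \<in> carrier G" "d \<in> carrier G" "Q = fraction G c d" by (rule fraction_cases)
  show "P \<otimes>\<^bsub>GG\<^esub> Q \<in> carrier GG"
    using p q by (simp add: fraction_mult fraction_closed)
  show "P \<otimes>\<^bsub>GG\<^esub> Q = Q \<otimes>\<^bsub>GG\<^esub> P"
    using p q by (simp add: fraction_mult m_comm)
  assume "T \<in> carrier GG"
  then obtain x y where t: "x \<in> carrier G" "y \<in> carrier G" "T = fraction G x y" by (rule fraction_cases)
  show "P \<otimes>\<^bsub>GG\<^esub> Q \<otimes>\<^bsub>GG\<^esub> T = P \<otimes>\<^bsub>GG\<^esub> (Q \<otimes>\<^bsub>GG\<^esub> T)"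
    using p q t by (simp add: fraction_mult m_assoc)
qed (simp add: fraction_one fraction_closed)

end

text \<open>Points outside \<open>X\<close> are fixed and letters outside \<open>S\<close> act
  trivially, so that the maps commute on the whole type, as \<open>commuting\<close>
  demands.\<close>

definition ext_action :: "'m set \<Rightarrow> 'x set \<Rightarrow> ('m \<Rightarrow> 'x \<Rightarrow> 'x) \<Rightarrow> 'm \<Rightarrow> 'x \<Rightarrow> 'x" where
  "ext_action S X f s x = (if s \<in> S \<and> x \<in> X then f s x else x)"

lemma ext_in: "s \<in> S \<Longrightarrow> x \<in> X \<Longrightarrow> ext_action S X f s x = f s x"
  and ext_out: "x \<notin> X \<Longrightarrow> ext_action S X f s x = x"
  and ext_out_S: "s \<notin> S \<Longrightarrow> ext_action S X f s x = x"
  by (simp_all add: ext_action_def)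

locale fg_comm_monoid = comm_monoid M for M :: "('m, 'b) monoid_scheme" (structure) +
  fixes S :: "'m set"
  assumes fin_S: "finite S" and gen: "monoid_generated_by M S"
begin

lemma S_closed: "s \<in> S \<Longrightarrow> s \<in> carrier M"
  using gen unfolding monoid_generated_by_def by auto

lemma generated_induct [consumes 1, case_names one gen mult]:
  assumes "m \<in> carrier M" "P \<one>" "\<And>s. s \<in> S \<Longrightarrow> P s"
    and "\<And>a b. a \<in> carrier M \<Longrightarrow> b \<in> carrier M \<Longrightarrow> P a \<Longrightarrow> P b \<Longrightarrow> P (a \<otimes> b)"
  shows "P m"
proof -
  let ?H = "{m \<in> carrier M. P m}"
  have "submonoid ?H M" by unfold_locales (use assms in auto)
  moreover have "S \<subseteq> ?H" using assms(3) S_closed by auto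
  ultimately have "(\<lambda>H. submonoid H M) hull S \<subseteq> ?H" by (rule hull_minimal[rotated])
  then show ?thesis using gen assms(1) unfolding monoid_generated_by_def by auto
qed

lemma commuting_ext:
  assumes "monoid_action M X f"
  shows "commuting S (ext_action S X f)"
proof
  fix s t x
  have cl: "f s x \<in> X" if "s \<in> S" "x \<in> X" for s x
    using assms that S_closed unfolding monoid_action_def by blast
  have "f s (f t x) = f t (f s x)" if "s \<in> S" "t \<in> S" "x \<in> X"
  proof -
    have "f s (f t x) = f (s \<otimes> t) x" "f t (f s x) = f (t \<otimes> s) x"
      using assms that S_closed unfolding monoid_action_def by metis+
    then show ?thesis using that S_closed m_comm by simp
  qed
  then show "ext_action S X f s (ext_action S X f t x) = ext_action S X f t (ext_action S X f s x)"
    unfolding ext_action_def using cl by auto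
qed (rule fin_S)

lemma regular_action: "monoid_action M (carrier M) (\<otimes>)"
  unfolding monoid_action_def by (auto simp: m_assoc)

text \<open>For words over \<open>S\<close> this is the product of the letters; as an orbit of the
  regular action it inherits the rules for words.\<close>

definition mval :: "'m multiset \<Rightarrow> 'm" where
  "mval w = act_word (ext_action S (carrier M) (\<otimes>)) w \<one>"

interpretation R: commuting S "ext_action S (carrier M) (\<otimes>)"
  by (rule commuting_ext[OF regular_action])

abbreviation "words \<equiv> R.W"

lemma mval_empty [simp]: "mval {#} = \<one>"
  unfolding mval_def by simp

lemma mval_closed: "mval w \<in> carrier M"
  unfolding mval_def
proof (induction w)
  case (add s w)
  show ?case unfolding R.act_add_mset
    using add S_closed by (cases "s \<in> S") (simp_all add: ext_in ext_out_S)
qed simp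

lemma mval_add_mset: "s \<in> S \<Longrightarrow> mval (add_mset s w) = s \<otimes> mval w"
  using mval_closed[of w] unfolding mval_def R.act_add_mset by (rule ext_in[rotated])

lemma mval_union: "u \<in> words \<Longrightarrow> mval (u + v) = mval u \<otimes> mval v"
  by (induction u) (simp_all add: mval_closed mval_add_mset S_closed m_assoc)

lemma ex_word: "m \<in> carrier M \<Longrightarrow> \<exists>w\<in>words. m = mval w"
proof (induction m rule: generated_induct)
  case one
  show ?case by (intro bexI[of _ "{#}"]) simp_all
next
  case (gen s)
  then show ?case by (intro bexI[of _ "{#s#}"]) (simp_all add: mval_add_mset S_closed)
next
  case (mult a b)
  then obtain u v where "u \<in> words" "v \<in> words" "a = mval u" "b = mval v" by blast
  then show ?case using mval_union[of u v] by (intro bexI[of _ "u + v"]) simp_all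
qed

lemma act_ext:
  assumes "monoid_action M X f" "w \<in> words"
  shows "act_word (ext_action S X f) w x = (if x \<in> X then f (mval w) x else x)"
proof -
  interpret E: commuting S "ext_action S X f" by (rule commuting_ext[OF assms(1)])
  have 1: "f \<one> x = x" if "x \<in> X" for x using assms(1) that unfolding monoid_action_def by blast
  have 2: "f (a \<otimes> b) x = f a (f b x)" if "x \<in> X" "a \<in> carrier M" "b \<in> carrier M" for a b x
    using assms(1) that unfolding monoid_action_def by blast
  have 3: "f a x \<in> X" if "x \<in> X" "a \<in> carrier M" for a x
    using assms(1) that unfolding monoid_action_def by blast
  show ?thesis using assms(2)
  proof (induction w)
    case empty
    show ?case using 1 by simp
  next
    case (add s w)
    then have s: "s \<in> S" "w \<in> words" by simp_all
    show ?case unfolding E.act_add_mset add.IH[OF s(2)]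
      using 2 3 mval_closed s by (simp add: mval_add_mset S_closed ext_in ext_out)
  qed
qed

abbreviation "MG \<equiv> group_completion M"

definition inj_completion :: "'m \<Rightarrow> ('m \<times> 'm) set" where
  "inj_completion m = fraction M m \<one>"

lemma inj_completion_closed: "m \<in> carrier M \<Longrightarrow> inj_completion m \<in> carrier (MG)"
  unfolding inj_completion_def by (simp add: fraction_closed)

lemma inj_completion_mult:
  "a \<in> carrier M \<Longrightarrow> b \<in> carrier M \<Longrightarrow>
   inj_completion (a \<otimes> b) = inj_completion a \<otimes>\<^bsub>MG\<^esub> inj_completion b"
  unfolding inj_completion_def by (simp add: fraction_mult)

lemma inj_completion_one: "inj_completion \<one> = \<one>\<^bsub>MG\<^esub>"
  unfolding inj_completion_def by (simp add: fraction_one)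

lemma fraction_inj_completion:
  assumes "a \<in> carrier M" "b \<in> carrier M"
  shows "fraction M a b = inj_completion a \<otimes>\<^bsub>MG\<^esub> inv\<^bsub>MG\<^esub> inj_completion b"
proof -
  interpret C: comm_group "MG" by (rule comm_group_completion)
  have "fraction M a b \<otimes>\<^bsub>MG\<^esub> inj_completion b = inj_completion a"
    unfolding inj_completion_def using assms by (simp add: fraction_mult fraction_eq_iff) (auto simp: m_ac)
  then show ?thesis
    using assms by (metis C.inv_solve_right fraction_closed inj_completion_closed)
qed

sublocale completion: fg_comm_group "MG" S inj_completion
proof -
  interpret C: comm_group "MG" by (rule comm_group_completion)
  have e: "inj_completion \<in> S \<rightarrow> carrier (MG)"
    using S_closed inj_completion_closed by auto
  let ?w = "\<lambda>z :: 'm \<Rightarrow> int. \<Otimes>\<^bsub>MG\<^esub>s\<in>S. inj_completion s [^]\<^bsub>MG\<^esub> z s"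
  have add: "?w (\<lambda>s. y s + z s) = ?w y \<otimes>\<^bsub>MG\<^esub> ?w z" for y z
    by (rule C.int_pow_finprod_hom[OF fin_S e])
  have wc: "?w z \<in> carrier (MG)" for z using e by (intro C.finprod_closed) auto
  have neg: "?w (\<lambda>s. - z s) = inv\<^bsub>MG\<^esub> ?w z" for z
  proof -
    have "?w (\<lambda>s. - z s + z s) = \<one>\<^bsub>MG\<^esub>" by simp
    then have "?w (\<lambda>s. - z s) \<otimes>\<^bsub>MG\<^esub> ?w z = \<one>\<^bsub>MG\<^esub>"
      unfolding add[of "\<lambda>s. - z s" z] .
    then show ?thesis using wc wc by (rule C.inv_equality[symmetric])
  qed
  have word: "\<exists>z. inj_completion m = ?w z" if "m \<in> carrier M" for m
    using that
  proof (induction m rule: generated_induct)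
    case one
    show ?case by (intro exI[of _ "\<lambda>_. 0"]) (simp add: inj_completion_one)
  next
    case (gen s)
    have es: "inj_completion s \<in> carrier (MG)" using e gen by blast
    have "?w (\<lambda>t. if t = s then 1 else 0) = (\<Otimes>\<^bsub>MG\<^esub>t\<in>S. if t = s then inj_completion t else \<one>\<^bsub>MG\<^esub>)"
      by (intro C.finprod_cong') (use e in \<open>simp_all add: Pi_iff C.int_pow_1[OF es]\<close>)
    also have "\<dots> = inj_completion s"
      using C.finprod_singleton_swap[of s S inj_completion] gen fin_S e by auto
    finally show ?case by metis
  next
    case (mult a b)
    then obtain y z where "inj_completion a = ?w y" "inj_completion b = ?w z" by blast
    then have "inj_completion (a \<otimes> b) = ?w (\<lambda>s. y s + z s)"
      unfolding add inj_completion_mult[OF mult(1,2)] by simp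
    then show ?case by (intro exI[of _ "\<lambda>s. y s + z s"])
  qed
  show "fg_comm_group (MG) S inj_completion"
  proof
    fix x assume "x \<in> carrier (MG)"
    then obtain a b where ab: "a \<in> carrier M" "b \<in> carrier M" "x = fraction M a b" by (rule fraction_cases)
    obtain y z where "inj_completion a = ?w y" "inj_completion b = ?w z" using word ab by meson
    then have "x = ?w (\<lambda>s. y s + - z s)" unfolding ab(3) fraction_inj_completion[OF ab(1,2)] using add[of y "\<lambda>s. - z s"] neg[of z] by simp
    then show "\<exists>z. x = ?w z" by (intro exI[of _ "\<lambda>s. y s + - z s"])
  qed (use fin_S e in auto)
qed

text \<open>This justifies the definite description: a decomposition yields a biorthogonal system of
  its rank, and the size of such a system is bounded by the rank of any other decomposition.\<close>

lemma rk_eq: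
  assumes "MG \<cong> int_vectors n \<times>\<times> T" "comm_group (T :: ('m \<times> 'm) set monoid)" "finite (carrier T)"
  shows "rk M = n"
  unfolding rk_def
proof (rule the_equality)
  show "\<exists>T :: ('m \<times> 'm) set monoid. comm_group T \<and> finite (carrier T) \<and> MG \<cong> int_vectors n \<times>\<times> T"
    using assms by blast
  fix m assume "\<exists>T :: ('m \<times> 'm) set monoid. comm_group T \<and> finite (carrier T) \<and> MG \<cong> int_vectors m \<times>\<times> T"
  then obtain T' :: "('m \<times> 'm) set monoid" where T': "comm_group T'" "finite (carrier T')"
    "MG \<cong> int_vectors m \<times>\<times> T'" by blast
  interpret T: comm_group T by (rule assms(2))
  interpret T': comm_group T' by (rule T'(1))
  obtain c g where "completion.biorth n c g"
    using completion.ex_biorth_if_iso[OF assms(1) T.group_axioms] by blast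
  then have "n \<le> m" using T' completion.biorth_le_rank by blast
  moreover obtain c g where "completion.biorth m c g"
    using completion.ex_biorth_if_iso[OF T'(3) T'.group_axioms] by blast
  then have "m \<le> n" using completion.biorth_le_rank assms by blast
  ultimately show "m = n" by simp
qed

lemma rk_biorth:
  assumes n: "completion.biorth n c g" "finite (completion.ker n c)"
  shows "rk M = n"
proof -
  let ?T = "(MG)\<lparr>carrier := completion.ker n c\<rparr>"
  have sub: "subgroup (completion.ker n c) (MG)" by (rule completion.subgroup_ker[OF n(1)])
  have T: "comm_group ?T"
    using completion.subgroup_imp_group[OF sub] completion.submonoid_is_comm_monoid[OF subgroup.subgroup_is_submonoid[OF sub]]
    by (simp add: comm_group_def)
  interpret T: comm_group ?T by (rule T)
  have grp: "group (int_vectors n \<times>\<times> ?T)"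
    by (intro DirProd_group product_group T.group_axioms) simp
  have "int_vectors n \<times>\<times> ?T \<cong> MG"
    using completion.iso_combo[OF n(1)] unfolding is_iso_def by blast
  then have "MG \<cong> int_vectors n \<times>\<times> ?T" using group.iso_sym[OF grp] by blast
  then show ?thesis using T n(2) by (intro rk_eq) auto
qed

lemma ex_biorth_rk:
  obtains c g where "completion.biorth (rk M) c g" "finite (completion.ker (rk M) c)"
  using completion.ex_biorth_finite_ker rk_biorth by metis

text \<open>The heights are the characters of a system with finite kernel, evaluated at the
  generators. Two words of equal height have their fraction in that kernel, and \<open>F\<close>
  holds a pair of words for every fraction of words that lies there.\<close>

lemma rk_heights:
  obtains p :: "'m \<Rightarrow> nat \<Rightarrow> int" and F where "\<forall>s. \<forall>i \<ge> rk M. p s i = 0" "finite F" "F \<subseteq> words \<times> words"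
    "\<forall>u\<in>words. \<forall>v\<in>words. (\<forall>i. (\<Sum>s\<in>#u. p s i) = (\<Sum>s\<in>#v. p s i)) \<longrightarrow>
      (\<exists>(a, b)\<in>F. \<exists>c\<in>words. mval (c + (u + b)) = mval (c + (v + a)))"
proof -
  obtain c g where bi: "completion.biorth (rk M) c g" and fin: "finite (completion.ker (rk M) c)"
    by (rule ex_biorth_rk)
  define p where "p s i = (if i < rk M then c i (inj_completion s) else 0)" for s i
  have hom: "c i \<in> hom (MG) integer_group" if "i < rk M" for i
    using completion.biorth_hom[OF bi that] .
  have p_word: "(\<Sum>s\<in>#w. p s i) = c i (inj_completion (mval w))" if "w \<in> words" "i < rk M" for w i
    using that(1)
  proof (induction w)
    case empty
    show ?case using completion.hom_integer(2)[OF hom[OF that(2)]] by (simp add: inj_completion_one)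
  next
    case (add s w)
    then have s: "s \<in> S" "w \<in> words" by simp_all
    have "inj_completion (mval (add_mset s w)) = inj_completion s \<otimes>\<^bsub>MG\<^esub> inj_completion (mval w)"
      using s by (simp add: mval_add_mset inj_completion_mult S_closed mval_closed)
    then have "c i (inj_completion (mval (add_mset s w))) = c i (inj_completion s) + c i (inj_completion (mval w))"
      using completion.hom_integer(1)[OF hom[OF that(2)]] s by (simp add: inj_completion_closed S_closed mval_closed)
    then show ?case using add.IH[OF s(2)] that(2) by (simp add: p_def)
  qed
  define q where "q k = fraction M (mval (fst k)) (mval (snd k))" for k
  let ?K = "{(u, v) \<in> words \<times> words. q (u, v) \<in> completion.ker (rk M) c}"
  have "finite (q ` ?K)" by (rule finite_subset[OF _ fin]) auto
  from finite_subset_image[OF this order_refl]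
  obtain F where F: "F \<subseteq> ?K" "finite F" "q ` ?K = q ` F" by (elim exE conjE)
  show thesis
  proof (rule that[of p F])
    show "F \<subseteq> words \<times> words" using F(1) by auto
    have "\<exists>(a, b)\<in>F. \<exists>c\<in>words. mval (c + (u + b)) = mval (c + (v + a))"
      if uv: "u \<in> words" "v \<in> words" and eq: "\<And>i. (\<Sum>s\<in>#u. p s i) = (\<Sum>s\<in>#v. p s i)" for u v
    proof -
    have "c i (q (u, v)) = 0" if "i < rk M" for i
      using eq[of i] completion.hom_integer[OF hom[OF that]] p_word[OF uv(1) that] p_word[OF uv(2) that] mval_closed
      by (simp add: q_def fraction_inj_completion inj_completion_closed)
    then have "q (u, v) \<in> completion.ker (rk M) c"
      unfolding completion.ker_def[OF bi] using mval_closed by (simp add: q_def fraction_closed)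
    then have "q (u, v) \<in> q ` F" unfolding F(3)[symmetric] using uv by (intro imageI) simp
    then obtain a b where ab: "(a, b) \<in> F" "q (u, v) = q (a, b)" by auto
    have abW: "a \<in> words" "b \<in> words" using ab(1) F(1) by auto
    have "fraction M (mval u) (mval v) = fraction M (mval a) (mval b)" using ab(2) by (simp add: q_def)
    then obtain m where m: "m \<in> carrier M" "mval u \<otimes> mval b \<otimes> m = mval a \<otimes> mval v \<otimes> m"
      using mval_closed by (subst (asm) fraction_eq_iff) auto
    obtain d where d: "d \<in> words" "m = mval d" using ex_word[OF m(1)] by blast
    have "mval (d + (u + b)) = mval u \<otimes> mval b \<otimes> m"
      using d uv abW mval_closed by (simp add: mval_union m_ac)
    also have "\<dots> = mval (d + (v + a))"
      unfolding m(2) using d uv abW mval_closed by (simp add: mval_union m_ac)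
    finally show "\<exists>(a, b)\<in>F. \<exists>c\<in>words. mval (c + (u + b)) = mval (c + (v + a))" using ab(1) d(1) by blast
    qed
    then show "\<forall>u\<in>words. \<forall>v\<in>words. (\<forall>i. (\<Sum>s\<in>#u. p s i) = (\<Sum>s\<in>#v. p s i)) \<longrightarrow>
      (\<exists>(a, b)\<in>F. \<exists>c\<in>words. mval (c + (u + b)) = mval (c + (v + a)))" by blast
  qed (use F(2) in \<open>auto simp: p_def\<close>)
qed

definition admissible :: "nat \<Rightarrow> 'x set \<times> ('m \<Rightarrow> 'x \<Rightarrow> 'x) \<Rightarrow> bool" where
  "admissible K = (\<lambda>(X, f). monoid_action M X f \<and>
     (\<forall>x\<in>X. \<forall>s\<in>S. finite (fiber X f s x) \<and> card (fiber X f s x) \<le> K))"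

lemma fiber_ext:
  assumes "admissible K (X, f)" "1 \<le> K" "s \<in> S"
  shows "finite {y. ext_action S X f s y = x} \<and> card {y. ext_action S X f s y = x} \<le> K"
proof (cases "x \<in> X")
  case True
  have "{y. ext_action S X f s y = x} = fiber X f s x"
    using True assms(3) by (auto simp: ext_action_def fiber_def)
  then show ?thesis using assms True unfolding admissible_def by auto
next
  case False
  have "f s y \<in> X" if "y \<in> X" for y
    using assms(1,3) that S_closed unfolding admissible_def monoid_action_def by auto
  then have "{y. ext_action S X f s y = x} = {x}" using False assms(3) by (auto simp: ext_action_def)
  then show ?thesis using assms(2) by simp
qed

text \<open>All actions are put side by side into one action, whose control function then serves all of
  them.\<close>
theorem uniform_colouring:
  assumes "1 \<le> K"
  obtains R where "\<And>(X :: 'x set) f r. admissible K (X, f) \<Longrightarrow>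
    \<exists>col. (\<forall>x. col x \<le> rk M) \<and> good_col (commuting.near S (ext_action S X f)) col UNIV r (R r)"
proof -
  \<comment> \<open>The pair \<open>(X, f)\<close> names the action and the last component the
    point; copies belonging to inadmissible pairs are fixed pointwise.\<close>
  define h :: "'m \<Rightarrow> ('x set \<times> ('m \<Rightarrow> 'x \<Rightarrow> 'x)) \<times> 'x \<Rightarrow> ('x set \<times> ('m \<Rightarrow> 'x \<Rightarrow> 'x)) \<times> 'x"
    where "h s q = (if admissible K (fst q) then (fst q, ext_action S (fst (fst q)) (snd (fst q)) s (snd q)) else q)" for s q
  have h_in: "h s ((X, f), x) = ((X, f), ext_action S X f s x)" if "admissible K (X, f)" for s X f x
    using that by (simp add: h_def)
  have h_out: "h s (A, x) = (A, x)" if "\<not> admissible K A" for s A x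
    using that by (simp add: h_def)
  have comm_in: "commuting S (ext_action S X f)" if "admissible K (X, f)" for X :: "'x set" and f
    by (rule commuting_ext) (use that in \<open>simp add: admissible_def\<close>)
  have comm_h: "commuting S h"
  proof
    fix s t and q :: "('x set \<times> ('m \<Rightarrow> 'x \<Rightarrow> 'x)) \<times> 'x"
    obtain X f x where q: "q = ((X, f), x)" by (metis surj_pair)
    show "h s (h t q) = h t (h s q)"
    proof (cases "admissible K (X, f)")
      case True
      then show ?thesis unfolding q h_in[OF True] using commuting.comm[OF comm_in[OF True]] by metis
    qed (simp add: q h_out)
  qed (rule fin_S)
  interpret h: commuting S h by (rule comm_h)
  have act_in: "act_word h w ((X, f), x) = ((X, f), act_word (ext_action S X f) w x)" if A: "admissible K (X, f)" for w X f x
  proof -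
    interpret E: commuting S "ext_action S X f" by (rule comm_in[OF A])
    show ?thesis by (induction w) (simp_all add: h_in[OF A])
  qed
  have act_out: "act_word h w (A, x) = (A, x)" if "\<not> admissible K A" for w A x
    by (induction w) (simp_all add: h_out[OF that])
  obtain p :: "'m \<Rightarrow> nat \<Rightarrow> int" and F where p: "\<forall>s. \<forall>i \<ge> rk M. p s i = 0" "finite F" "F \<subseteq> words \<times> words"
    "\<forall>u\<in>words. \<forall>v\<in>words. (\<forall>i. (\<Sum>s\<in>#u. p s i) = (\<Sum>s\<in>#v. p s i)) \<longrightarrow>
      (\<exists>(a, b)\<in>F. \<exists>c\<in>words. mval (c + (u + b)) = mval (c + (v + a)))"
    by (rule rk_heights)
  have heights: "heights S h {..<rk M} p"
    by unfold_locales (use p(1) in auto)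
  interpret h: heights S h "{..<rk M}" p by (rule heights)
  have ev: "h.ev u v" if c: "c \<in> words" "u \<in> words" "v \<in> words" "mval (c + u) = mval (c + v)" for c u v
  proof -
    have "act_word h (c + u) q = act_word h (c + v) q" for q
    proof -
      obtain X f x where q: "q = ((X, f), x)" by (metis surj_pair)
      show ?thesis
      proof (cases "admissible K (X, f)")
        case True
        then have "monoid_action M X f" by (simp add: admissible_def)
        then show ?thesis unfolding q act_in[OF True] using c by (simp add: act_ext)
      next
        case False
        then show ?thesis unfolding q by (simp add: act_out)
      qed
    qed
    then show ?thesis unfolding h.ev_def using c(1) by blast
  qed
  have finker: "h.finker"
    unfolding h.finker_def
  proof (intro exI[of _ F] conjI ballI impI)
    fix u v assume uv: "u \<in> words" "v \<in> words" "h.hgt u = h.hgt v"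
    have "(\<Sum>s\<in>#u. p s i) = (\<Sum>s\<in>#v. p s i)" for i
      using fun_cong[OF uv(3), of i] unfolding h.hgt_def .
    then obtain a b c where "(a, b) \<in> F" "c \<in> words" "mval (c + (u + b)) = mval (c + (v + a))"
      using p(4) uv(1,2) by blast
    then show "\<exists>(a, b)\<in>F. h.ev (u + b) (v + a)" using ev[of c "u + b" "v + a"] uv p(3) by auto
  qed (use p in auto)
  have fib: "finite {y. h s y = q} \<and> card {y. h s y = q} \<le> K" if s: "s \<in> S" for s q
  proof -
    obtain X f x where q: "q = ((X, f), x)" by (metis surj_pair)
    show ?thesis
    proof (cases "admissible K (X, f)")
      case True
      have "{y. h s y = q} = Pair (X, f) ` {y. ext_action S X f s y = x}"
        unfolding q using True by (auto simp: h_def split: if_splits)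
      moreover have "card (Pair (X, f) ` {y. ext_action S X f s y = x}) = card {y. ext_action S X f s y = x}"
        by (rule card_image) (simp add: inj_on_def)
      ultimately show ?thesis using fiber_ext[OF True assms s] by simp
    next
      case False
      have "{y. h s y = q} = {q}"
        unfolding q using False by (auto simp: h_def split: if_splits)
      then show ?thesis using assms by simp
    qed
  qed
  have "h.near.asd (card {..<rk M}) UNIV"
    using asd_heights[OF heights finker fib assms] .
  then have "\<forall>r. \<exists>R. \<exists>col. (\<forall>x. col x \<le> rk M) \<and> good_col h.near col UNIV r R"
    unfolding h.near.asd_def by simp
  then obtain R where R: "\<And>r. \<exists>col. (\<forall>x. col x \<le> rk M) \<and> good_col h.near col UNIV r (R r)" by metis
  show thesis
  proof (rule that[of R])
    fix X :: "'x set" and f r assume A: "admissible K (X, f)"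
    interpret E: commuting S "ext_action S X f" by (rule comm_in[OF A])
    obtain col where col: "\<And>x. col x \<le> rk M" "good_col h.near col UNIV r (R r)" using R by blast
    have near: "h.near k ((X, f), x) ((X, f), y) \<longleftrightarrow> E.near k x y" for k x y
      unfolding h.near_def E.near_def by (simp add: act_in[OF A])
    have chain: "(((X, f), x), ((X, f), y)) \<in> mono_chain h.near col UNIV r"
      if "(x, y) \<in> mono_chain E.near (\<lambda>x. col ((X, f), x)) UNIV r" for x y
      using that unfolding mono_chain_def[of E.near]
    proof (induction rule: rtrancl_induct)
      case (step y z)
      then show ?case using h.near.mono_chain_step near by fastforce
    qed (rule h.near.mono_chain_refl)
    have "good_col E.near (\<lambda>x. col ((X, f), x)) UNIV r (R r)"
      using col(2) chain near unfolding good_col_def by blast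
    then show "\<exists>col. (\<forall>x. col x \<le> rk M) \<and> good_col E.near col UNIV r (R r)"
      using col(1) by (intro exI[of _ "\<lambda>x. col ((X, f), x)"]) simp
  qed
qed

end


section \<open>Control functions for Schreier graphs\<close>

text \<open>A nonempty set of natural numbers attains its infimum, and the infimum over the empty
  set exceeds every real.\<close>

lemma INF_of_nat_le_ennreal:
  assumes "0 \<le> r"
  shows "(INF k\<in>A. of_nat k :: ennreal) \<le> ennreal r \<longleftrightarrow> (\<exists>k\<in>A. real k \<le> r)"
proof
  assume le: "(INF k\<in>A. of_nat k :: ennreal) \<le> ennreal r"
  show "\<exists>k\<in>A. real k \<le> r"
  proof (cases "A = {}")
    case True
    then show ?thesis using le by (simp add: top_unique)
  next
    case False
    then have L: "(LEAST k. k \<in> A) \<in> A" by (meson LeastI ex_in_conv)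
    have "of_nat (LEAST k. k \<in> A) \<le> (INF k\<in>A. of_nat k :: ennreal)"
      by (rule INF_greatest) (simp add: Least_le)
    then have "of_nat (LEAST k. k \<in> A) \<le> ennreal r" using le by (rule order_trans)
    then have "real (LEAST k. k \<in> A) \<le> r" using assms by (simp add: ennreal_of_nat_eq_real_of_nat)
    then show ?thesis using L by blast
  qed
next
  assume "\<exists>k\<in>A. real k \<le> r"
  then obtain k where k: "k \<in> A" "real k \<le> r" by blast
  have "(of_nat k :: ennreal) \<le> ennreal r" using k(2) by (simp add: ennreal_of_nat_eq_real_of_nat ennreal_leI)
  then show "(INF k\<in>A. of_nat k :: ennreal) \<le> ennreal r" using k(1) by (rule INF_lower2[rotated])
qed

lemma sym_relpow:
  assumes "sym E" "(x, y) \<in> E ^^ k"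
  shows "(y, x) \<in> E ^^ k"
  using assms(2)
proof (induction k arbitrary: y)
  case (Suc k)
  then obtain z where z: "(x, z) \<in> E ^^ k" "(z, y) \<in> E" by auto
  have "(y, z) \<in> E" using assms(1) z(2) by (rule symD)
  then show ?case using Suc.IH[OF z(1)] by (rule relpow_Suc_I2)
qed simp

lemma schreier_dist_sym: "schreier_dist S X f x y = schreier_dist S X f y x"
proof -
  let ?E = "{(u, v). {u, v} \<in> schreier_edges S X f}"
  have "sym ?E" by (auto simp: sym_def insert_commute)
  then have "(x, y) \<in> ?E ^^ k \<longleftrightarrow> (y, x) \<in> ?E ^^ k" for k
    using sym_relpow by metis
  then show ?thesis unfolding schreier_dist_def by simp
qed

lemma chain_rel_bound_iff:
  fixes d :: "'x \<Rightarrow> 'x \<Rightarrow> ennreal"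
  assumes "\<And>x y. d x y = d y x"
  shows "(\<forall>C\<in>r_components d r A. ext_diameter d C \<le> D) \<longleftrightarrow> (\<forall>(x, y)\<in>chain_rel d r A. d x y \<le> D)"
proof
  let ?R = "{(p, q). p \<in> A \<and> q \<in> A \<and> d p q \<le> ennreal r}"
  have "sym (?R\<^sup>*)" by (rule sym_rtrancl) (auto simp: sym_def assms)
  then have sym: "(y, x) \<in> chain_rel d r A" if "(x, y) \<in> chain_rel d r A" for x y
    using that unfolding chain_rel_def by (auto dest: symD)
  have trans: "(x, z) \<in> chain_rel d r A" if "(x, y) \<in> chain_rel d r A" "(y, z) \<in> chain_rel d r A" for x y z
    using that unfolding chain_rel_def by auto
  assume *: "\<forall>(x, y)\<in>chain_rel d r A. d x y \<le> D"
  show "\<forall>C\<in>r_components d r A. ext_diameter d C \<le> D"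
  proof
    fix C assume "C \<in> r_components d r A"
    then obtain a where C: "C = chain_rel d r A `` {a}" unfolding r_components_def by (rule quotientE)
    show "ext_diameter d C \<le> D"
      unfolding ext_diameter_def C using * sym trans by (intro SUP_least) blast
  qed
next
  assume *: "\<forall>C\<in>r_components d r A. ext_diameter d C \<le> D"
  show "\<forall>(x, y)\<in>chain_rel d r A. d x y \<le> D"
  proof clarify
    fix x y assume xy: "(x, y) \<in> chain_rel d r A"
    then have x: "x \<in> A" "(x, x) \<in> chain_rel d r A" unfolding chain_rel_def by auto
    let ?C = "chain_rel d r A `` {x}"
    have "d x y \<le> (SUP y\<in>?C. d x y)" using xy by (intro SUP_upper) blast
    also have "\<dots> \<le> ext_diameter d ?C" unfolding ext_diameter_def using x(2) by (intro SUP_upper) blast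
    also have "\<dots> \<le> D" using * x(1) unfolding r_components_def by (auto intro: quotientI)
    finally show "d x y \<le> D" .
  qed
qed

lemma asdim_le_with_control_iff:
  assumes "\<And>x y. d x y = d y x"
  shows "asdim_le_with_control X d n R \<longleftrightarrow> (\<forall>r>0. 0 \<le> R r \<and>
    (\<exists>U :: nat \<Rightarrow> 'x set. (\<Union>i\<le>n. U i) = X \<and>
      (\<forall>i\<le>n. \<forall>(x, y)\<in>chain_rel d r (U i). d x y \<le> ennreal (R r))))"
  unfolding asdim_le_with_control_def chain_rel_bound_iff[OF assms] ..

context fg_comm_monoid
begin

text \<open>A path gives two words with a common image because backward steps can be moved behind
  forward ones; conversely, two such words trace a path. Path lengths are integers, hence the
  floor.\<close>

lemma dist_le_iff_near:
  assumes act: "monoid_action M X f" and "0 \<le> r"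
  shows "schreier_dist S X f x y \<le> ennreal r \<longleftrightarrow> commuting.near S (ext_action S X f) (nat \<lfloor>r\<rfloor>) x y"
proof -
  interpret E: commuting S "ext_action S X f" by (rule commuting_ext[OF act])
  let ?E = "{(u, v). {u, v} \<in> schreier_edges S X f}"
  have edge: "E.near 1 u v" if uv: "(u, v) \<in> ?E" for u v
  proof -
    obtain z s where z: "{u, v} = {z, f s z}" "z \<in> X" "s \<in> S" using uv unfolding schreier_edges_def by blast
    have "E.near 1 z (f s z)"
      by (rule E.nearI[of "{#s#}" "{#}"]) (use z(2,3) in \<open>simp_all add: ext_in\<close>)
    then show ?thesis using z(1) E.near.near_sym by (metis doubleton_eq_iff)
  qed
  have path: "E.near k u v" if "(u, v) \<in> ?E ^^ k" for k u v
    using that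
  proof (induction k arbitrary: v)
    case 0
    then show ?case using E.near.near_refl by simp
  next
    case (Suc k)
    then obtain w where "(u, w) \<in> ?E ^^ k" "(w, v) \<in> ?E" by auto
    then have "E.near (k + 1) u v" using Suc.IH edge E.near.near_add by blast
    then show ?case by simp
  qed
  \<comment> \<open>A letter that fixes the current point gives no edge, as loops are discarded, so
    the path may be shorter than the word.\<close>
  have down: "\<exists>j\<le>size w. (u, act_word (ext_action S X f) w u) \<in> ?E ^^ j" if "w \<in> words" for w u
    using that
  proof (induction w)
    case empty
    show ?case by auto
  next
    case (add s w)
    then obtain j where j: "j \<le> size w" "(u, act_word (ext_action S X f) w u) \<in> ?E ^^ j" by auto
    let ?v = "act_word (ext_action S X f) w u"
    show ?case
    proof (cases "ext_action S X f s ?v = ?v")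
      case True
      then show ?thesis using j by (intro exI[of _ j]) simp
    next
      case False
      then have "?v \<in> X" "s \<in> S" by (auto simp: ext_action_def split: if_splits)
      then have "(?v, ext_action S X f s ?v) \<in> ?E" using False unfolding schreier_edges_def by (auto simp: ext_in)
      then have "(u, ext_action S X f s ?v) \<in> ?E ^^ Suc j" using j(2) by auto
      then show ?thesis using j(1) by (intro exI[of _ "Suc j"]) simp
    qed
  qed
  have sym: "sym ?E" by (auto simp: sym_def insert_commute)
  have "(\<exists>k\<in>{k. (x, y) \<in> ?E ^^ k}. real k \<le> r) \<longleftrightarrow> E.near (nat \<lfloor>r\<rfloor>) x y"
  proof
    assume "\<exists>k\<in>{k. (x, y) \<in> ?E ^^ k}. real k \<le> r"
    then obtain k where k: "(x, y) \<in> ?E ^^ k" "real k \<le> r" by blast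
    have "k \<le> nat \<lfloor>r\<rfloor>" using k(2) by (simp add: le_nat_iff le_floor_iff)
    then show "E.near (nat \<lfloor>r\<rfloor>) x y" using path[OF k(1)] E.near.near_mono by blast
  next
    assume "E.near (nat \<lfloor>r\<rfloor>) x y"
    then obtain u v where uv: "u \<in> words" "v \<in> words" "size u + size v \<le> nat \<lfloor>r\<rfloor>"
      "act_word (ext_action S X f) u x = act_word (ext_action S X f) v y" unfolding E.near_def by blast
    obtain j where j: "j \<le> size u" "(x, act_word (ext_action S X f) u x) \<in> ?E ^^ j" using down[OF uv(1)] by blast
    obtain k where k: "k \<le> size v" "(y, act_word (ext_action S X f) v y) \<in> ?E ^^ k" using down[OF uv(2)] by blast
    have "(act_word (ext_action S X f) v y, y) \<in> ?E ^^ k"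
      using sym k(2) by (rule sym_relpow)
    then have "(x, y) \<in> ?E ^^ (j + k)" using j(2) uv(4) by (auto simp: relpow_add)
    moreover have "real (j + k) \<le> r"
    proof -
      have "int (j + k) \<le> \<lfloor>r\<rfloor>" using j(1) k(1) uv(3) assms(2) by linarith
      then show ?thesis by (simp add: le_floor_iff)
    qed
    ultimately show "\<exists>k\<in>{k. (x, y) \<in> ?E ^^ k}. real k \<le> r" by blast
  qed
  then show ?thesis unfolding schreier_dist_def INF_of_nat_le_ennreal[OF assms(2)] .
qed

definition fiber_bounded :: "nat \<Rightarrow> 'x set \<Rightarrow> ('m \<Rightarrow> 'x \<Rightarrow> 'x) \<Rightarrow> bool" where
  "fiber_bounded K X f \<longleftrightarrow> bounded_to_one_action M X f \<and>
     (\<forall>x\<in>X. \<forall>s\<in>S. finite (fiber X f s x) \<and> card (fiber X f s x) \<le> K)"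

lemma fiber_bounded_admissible: "fiber_bounded K X f \<Longrightarrow> admissible K (X, f)"
  unfolding fiber_bounded_def admissible_def bounded_to_one_action_def by auto

lemma ex_uniform_control:
  assumes "1 \<le> K"
  shows "\<exists>R. (\<forall>r>0. 0 \<le> R r) \<and>
    (\<forall>(X :: 'x set) f. fiber_bounded K X f \<longrightarrow> asdim_le_with_control X (schreier_dist S X f) (rk M) R)"
proof -
  obtain R where R: "\<And>(X :: 'x set) f r. admissible K (X, f) \<Longrightarrow>
    \<exists>col. (\<forall>x. col x \<le> rk M) \<and> good_col (commuting.near S (ext_action S X f)) col UNIV r (R r)"
    using uniform_colouring[OF assms] by metis
  show ?thesis
  proof (intro exI[of _ "\<lambda>r. real (R (nat \<lfloor>r\<rfloor>))"] conjI allI impI)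
    fix X :: "'x set" and f assume "fiber_bounded K X f"
    then have A: "admissible K (X, f)" by (rule fiber_bounded_admissible)
    then have act: "monoid_action M X f" unfolding admissible_def by simp
    interpret E: commuting S "ext_action S X f" by (rule commuting_ext[OF act])
    show "asdim_le_with_control X (schreier_dist S X f) (rk M) (\<lambda>r. real (R (nat \<lfloor>r\<rfloor>)))"
      unfolding asdim_le_with_control_iff[OF schreier_dist_sym]
    proof (intro allI impI conjI)
      fix r :: real assume r: "r > 0"
      obtain col where col: "\<And>x. col x \<le> rk M" "good_col E.near col UNIV (nat \<lfloor>r\<rfloor>) (R (nat \<lfloor>r\<rfloor>))"
        using R[OF A] by blast
      show "\<exists>U. (\<Union>i\<le>rk M. U i) = X \<and> (\<forall>i\<le>rk M. \<forall>(x, y)\<in>chain_rel (schreier_dist S X f) r (U i).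
          schreier_dist S X f x y \<le> ennreal (real (R (nat \<lfloor>r\<rfloor>))))"
      proof (intro exI[of _ "\<lambda>i. {x \<in> X. col x = i}"] conjI allI impI, goal_cases)
        case 1
        show ?case using col(1) by auto
      next
        case (2 i)
        let ?step = "{(p, q). p \<in> {x \<in> X. col x = i} \<and> q \<in> {x \<in> X. col x = i} \<and> schreier_dist S X f p q \<le> ennreal r}"
        show ?case
        proof clarify
          fix x y assume "(x, y) \<in> chain_rel (schreier_dist S X f) r {x \<in> X. col x = i}"
          then have "(x, y) \<in> ?step\<^sup>*"
            unfolding chain_rel_def by blast
          moreover have "?step \<subseteq>
              {(p, q). p \<in> UNIV \<and> q \<in> UNIV \<and> col p = col q \<and> E.near (nat \<lfloor>r\<rfloor>) p q}"
            using dist_le_iff_near[OF act, of r] r by auto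
          ultimately have "(x, y) \<in> mono_chain E.near col UNIV (nat \<lfloor>r\<rfloor>)"
            unfolding mono_chain_def using rtrancl_mono by blast
          then have "E.near (R (nat \<lfloor>r\<rfloor>)) x y" using col(2) unfolding good_col_def by blast
          then show "schreier_dist S X f x y \<le> ennreal (real (R (nat \<lfloor>r\<rfloor>)))"
            by (subst dist_le_iff_near[OF act]) simp_all
        qed
      qed
    qed simp
  qed simp
qed

lemma uniform_control:
  assumes "1 \<le> K"
  shows "\<forall>r>0. 0 \<le> uniform_control M S K r"
    and "fiber_bounded K (X :: nat set) f \<Longrightarrow>
      asdim_le_with_control X (schreier_dist S X f) (rk M) (uniform_control M S K)"
proof -
  have *: "(\<forall>r>0. 0 \<le> uniform_control M S K r) \<and>
    (\<forall>(X :: nat set) f. fiber_bounded K X f \<longrightarrow>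
      asdim_le_with_control X (schreier_dist S X f) (rk M) (uniform_control M S K))"
    unfolding uniform_control_def fiber_bounded_def
    by (rule someI_ex[OF ex_uniform_control[OF assms, unfolded fiber_bounded_def]])
  show "\<forall>r>0. 0 \<le> uniform_control M S K r" using * by blast
  show "fiber_bounded K (X :: nat set) f \<Longrightarrow>
      asdim_le_with_control X (schreier_dist S X f) (rk M) (uniform_control M S K)" using * by blast
qed

text \<open>A connected component is countable, so it can be moved to the natural numbers.\<close>
lemma countable_component:
  assumes fb: "fiber_bounded K X f" and K: "1 \<le> K" and x0: "x0 \<in> X"
  obtains C e Y g where "C = {x \<in> X. \<exists>k. commuting.near S (ext_action S X f) k x0 x}" "inj_on e C"
    "Y = e ` C" "fiber_bounded K (Y :: nat set) g"
    "\<forall>x\<in>C. \<forall>y\<in>C. \<forall>k. commuting.near S (ext_action S Y g) k (e x) (e y) \<longleftrightarrow> commuting.near S (ext_action S X f) k x y"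
proof -
  have A: "admissible K (X, f)" using fb by (rule fiber_bounded_admissible)
  then have act: "monoid_action M X f" unfolding admissible_def by simp
  interpret E: commuting S "ext_action S X f" by (rule commuting_ext[OF act])
  define C where "C = {x \<in> X. \<exists>k. E.near k x0 x}"
  have "countable (\<Union>k. {x. E.near k x0 x})"
  proof (rule countable_UN)
    show "countable {x. E.near k x0 x}" for k
    proof -
      obtain N where "\<And>x. finite {y. E.near k x y} \<and> card {y. E.near k x y} \<le> N"
        using E.ball_bound[OF fiber_ext[OF A K]] by metis
      then show ?thesis by (simp add: countable_finite)
    qed
  qed simp
  then have "countable C" by (rule countable_subset[rotated]) (auto simp: C_def)
  then obtain e :: "_ \<Rightarrow> nat" where e: "inj_on e C" unfolding countable_def by blast
  define Y where "Y = e ` C"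
  define g where "g m y = e (f m (inv_into C e y))" for m y
  have ge: "g m (e x) = e (f m x)" if "x \<in> C" for m x
    unfolding g_def using e that by simp
  have closed: "f m x \<in> C" if m: "m \<in> carrier M" and x: "x \<in> C" for m x
  proof -
    obtain k where k: "x \<in> X" "E.near k x0 x" using x unfolding C_def by blast
    obtain w where w: "w \<in> words" "m = mval w" using ex_word[OF m] by blast
    have "E.near (size w) x (f m x)"
      by (rule E.nearI[of w "{#}"]) (use w k in \<open>simp_all add: act_ext[OF act]\<close>)
    then have "E.near (k + size w) x0 (f m x)" using k(2) E.near.near_add by blast
    moreover have "f m x \<in> X" using act m k(1) unfolding monoid_action_def by blast
    ultimately show ?thesis unfolding C_def by blast
  qed
  have CX: "x \<in> X" if "x \<in> C" for x using that unfolding C_def by blast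
  have act': "monoid_action M Y g"
    using act closed CX unfolding monoid_action_def Y_def by (simp add: ge)
  have fib: "fiber Y g m (e x) = e ` (fiber X f m x \<inter> C)" if "m \<in> carrier M" "x \<in> C" for m x
    using closed that e CX unfolding fiber_def Y_def by (auto simp: ge inj_on_eq_iff)
  have fib_le: "finite (fiber Y g m (e x)) \<and> card (fiber Y g m (e x)) \<le> N"
    if "m \<in> carrier M" "x \<in> C" "finite (fiber X f m x) \<and> card (fiber X f m x) \<le> N" for m x N
  proof -
    have "card (e ` (fiber X f m x \<inter> C)) \<le> card (fiber X f m x \<inter> C)" using that(3) by (intro card_image_le) simp
    also have "\<dots> \<le> card (fiber X f m x)" using that(3) by (intro card_mono) auto
    finally show ?thesis unfolding fib[OF that(1,2)] using that(3) by simp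
  qed
  have "fiber_bounded K Y g"
    unfolding fiber_bounded_def bounded_to_one_action_def
  proof (intro conjI ballI)
    fix m assume m: "m \<in> carrier M"
    then obtain N where "\<forall>x\<in>X. finite (fiber X f m x) \<and> card (fiber X f m x) \<le> N"
      using fb unfolding fiber_bounded_def bounded_to_one_action_def by blast
    then show "\<exists>N. \<forall>x\<in>Y. finite (fiber Y g m x) \<and> card (fiber Y g m x) \<le> N"
      using fib_le[OF m] CX unfolding Y_def by blast
  next
    fix y s assume "y \<in> Y" and s: "s \<in> S"
    then obtain x where x: "y = e x" "x \<in> C" unfolding Y_def by blast
    have "finite (fiber X f s x) \<and> card (fiber X f s x) \<le> K"
      using fb s CX[OF x(2)] unfolding fiber_bounded_def by blast
    then show "finite (fiber Y g s y)" "card (fiber Y g s y) \<le> K"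
      using fib_le[OF S_closed[OF s] x(2)] unfolding x(1) by blast+
  qed (rule act')
  moreover have "commuting.near S (ext_action S Y g) k (e x) (e y) \<longleftrightarrow> E.near k x y" if xy: "x \<in> C" "y \<in> C" for x y k
  proof -
    interpret E': commuting S "ext_action S Y g" by (rule commuting_ext[OF act'])
    have a: "act_word (ext_action S Y g) w (e x) = e (act_word (ext_action S X f) w x)" "act_word (ext_action S X f) w x \<in> C" if "w \<in> words" "x \<in> C" for w x
      using that mval_closed CX closed unfolding Y_def by (simp_all add: act_ext[OF act'[unfolded Y_def]] act_ext[OF act] ge)
    show ?thesis
      unfolding E'.near_def E.near_def using a xy e by (metis inj_on_eq_iff)
  qed
  ultimately show thesis using that[of C e Y g] e unfolding C_def Y_def by blast
qed

text \<open>The control function was chosen for sets of natural numbers only. Each component is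
  transported there and covered on its own; a chain with steps of finite length never leaves its
  component, so the covers combine with the same bound.\<close>

theorem asdim_le_uniform_control:
  assumes fb: "fiber_bounded K (X :: 'x set) f" and K: "1 \<le> K"
  shows "asdim_le_with_control X (schreier_dist S X f) (rk M) (uniform_control M S K)"
  unfolding asdim_le_with_control_iff[OF schreier_dist_sym]
proof (intro allI impI conjI)
  fix r :: real assume r: "r > 0"
  let ?R = "uniform_control M S K r"
  show R0: "0 \<le> ?R" using uniform_control(1)[OF K] r by blast
  have A: "admissible K (X, f)" using fb by (rule fiber_bounded_admissible)
  then have act: "monoid_action M X f" unfolding admissible_def by simp
  interpret E: commuting S "ext_action S X f" by (rule commuting_ext[OF act])
  let ?d = "schreier_dist S X f"
  define comp where "comp x = {y \<in> X. \<exists>k. E.near k x y}" for x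
  have comp_eq: "comp x = comp y" if "E.near k x y" for k x y
    using that E.near.near_add E.near.near_sym unfolding comp_def by blast
  have "\<exists>U :: nat \<Rightarrow> 'x set. (\<Union>i\<le>rk M. U i) = comp x0 \<and>
      (\<forall>i\<le>rk M. \<forall>(x, y)\<in>chain_rel ?d r (U i). ?d x y \<le> ennreal ?R)" if x0: "x0 \<in> X" for x0
  proof -
    obtain C e Y g where C: "C = {x \<in> X. \<exists>k. E.near k x0 x}" "inj_on e C"
      and Y: "Y = e ` C" "fiber_bounded K (Y :: nat set) g"
      and near: "\<forall>x\<in>C. \<forall>y\<in>C. \<forall>k. commuting.near S (ext_action S Y g) k (e x) (e y) \<longleftrightarrow> E.near k x y"
      by (rule countable_component[OF fb K x0])
    have C_comp: "C = comp x0" unfolding C(1) comp_def ..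
    have act': "monoid_action M Y g" using Y(2) unfolding fiber_bounded_def bounded_to_one_action_def by blast
    let ?d' = "schreier_dist S Y g"
    have d: "?d' (e x) (e y) \<le> ennreal t \<longleftrightarrow> ?d x y \<le> ennreal t" if "x \<in> C" "y \<in> C" "0 \<le> t" for x y t
      using that near by (simp add: dist_le_iff_near[OF act] dist_le_iff_near[OF act'])
    obtain V where V: "(\<Union>i\<le>rk M. V i) = Y"
        "\<forall>i\<le>rk M. \<forall>(x, y)\<in>chain_rel ?d' r (V i). ?d' x y \<le> ennreal ?R"
      using uniform_control(2)[OF K Y(2), unfolded asdim_le_with_control_iff[OF schreier_dist_sym],
          THEN spec, THEN mp, OF r, THEN conjunct2] by (elim exE conjE)
    show ?thesis
    proof (intro exI[of _ "\<lambda>i. {x \<in> C. e x \<in> V i}"] conjI allI impI)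
      show "(\<Union>i\<le>rk M. {x \<in> C. e x \<in> V i}) = comp x0" using V(1) Y(1) C_comp by auto
      fix i assume i: "i \<le> rk M"
      show "\<forall>(x, y)\<in>chain_rel ?d r {x \<in> C. e x \<in> V i}. ?d x y \<le> ennreal ?R"
      proof clarify
        fix x y assume xy: "(x, y) \<in> chain_rel ?d r {x \<in> C. e x \<in> V i}"
        then have xyC: "x \<in> C" "y \<in> C" "e x \<in> V i" "e y \<in> V i" unfolding chain_rel_def by auto
        from xy have "(x, y) \<in> {(p, q). p \<in> {x \<in> C. e x \<in> V i} \<and> q \<in> {x \<in> C. e x \<in> V i} \<and> ?d p q \<le> ennreal r}\<^sup>*"
          unfolding chain_rel_def by blast
        then have "(e x, e y) \<in> {(p, q). p \<in> V i \<and> q \<in> V i \<and> ?d' p q \<le> ennreal r}\<^sup>*"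
        proof (induction rule: rtrancl_induct)
          case (step y z)
          then have "(e y, e z) \<in> {(p, q). p \<in> V i \<and> q \<in> V i \<and> ?d' p q \<le> ennreal r}"
            using d[of y z r] r by auto
          with step.IH show ?case by (rule rtrancl_into_rtrancl)
        qed simp
        then have "(e x, e y) \<in> chain_rel ?d' r (V i)" using xyC unfolding chain_rel_def by simp
        then have "?d' (e x) (e y) \<le> ennreal ?R" using V(2) i by blast
        then show "?d x y \<le> ennreal ?R" using d xyC(1,2) R0 by blast
      qed
    qed
  qed
  then have "\<forall>A\<in>comp ` X. \<exists>U :: nat \<Rightarrow> 'x set. (\<Union>i\<le>rk M. U i) = A \<and>
      (\<forall>i\<le>rk M. \<forall>(x, y)\<in>chain_rel ?d r (U i). ?d x y \<le> ennreal ?R)" by blast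
  then obtain V :: "'x set \<Rightarrow> nat \<Rightarrow> 'x set" where V: "\<And>A. A \<in> comp ` X \<Longrightarrow> (\<Union>i\<le>rk M. V A i) = A \<and>
      (\<forall>i\<le>rk M. \<forall>(x, y)\<in>chain_rel ?d r (V A i). ?d x y \<le> ennreal ?R)" by metis
  show "\<exists>U :: nat \<Rightarrow> 'x set. (\<Union>i\<le>rk M. U i) = X \<and>
      (\<forall>i\<le>rk M. \<forall>(x, y)\<in>chain_rel ?d r (U i). ?d x y \<le> ennreal ?R)"
  proof (intro exI[of _ "\<lambda>i. {x \<in> X. x \<in> V (comp x) i}"] conjI allI impI)
    have "x \<in> (\<Union>i\<le>rk M. V (comp x) i)" if "x \<in> X" for x
    proof -
      have "x \<in> comp x" using that E.near.near_refl unfolding comp_def by blast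
      then show ?thesis using V[of "comp x"] that by blast
    qed
    then show "(\<Union>i\<le>rk M. {x \<in> X. x \<in> V (comp x) i}) = X" by blast
    fix i assume i: "i \<le> rk M"
    show "\<forall>(x, y)\<in>chain_rel ?d r {x \<in> X. x \<in> V (comp x) i}. ?d x y \<le> ennreal ?R"
    proof clarify
      fix x y assume xy: "(x, y) \<in> chain_rel ?d r {x \<in> X. x \<in> V (comp x) i}"
      then have x: "x \<in> X" "x \<in> V (comp x) i" "y \<in> V (comp y) i" unfolding chain_rel_def by auto
      from xy have "(x, y) \<in> {(p, q). p \<in> {x \<in> X. x \<in> V (comp x) i} \<and> q \<in> {x \<in> X. x \<in> V (comp x) i} \<and> ?d p q \<le> ennreal r}\<^sup>*"
        unfolding chain_rel_def by blast
      then have "comp y = comp x \<and> (x, y) \<in> {(p, q). p \<in> V (comp x) i \<and> q \<in> V (comp x) i \<and> ?d p q \<le> ennreal r}\<^sup>*"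
      proof (induction rule: rtrancl_induct)
        case (step y z)
        then have yz: "y \<in> V (comp y) i" "z \<in> V (comp z) i" "?d y z \<le> ennreal r" by auto
        have "E.near (nat \<lfloor>r\<rfloor>) y z" using yz(3) r by (simp add: dist_le_iff_near[OF act])
        then have "comp y = comp z" by (rule comp_eq)
        then have c: "comp y = comp x" "comp z = comp x" using step.IH by simp_all
        then have "(y, z) \<in> {(p, q). p \<in> V (comp x) i \<and> q \<in> V (comp x) i \<and> ?d p q \<le> ennreal r}"
          using yz by simp
        then show ?case using step.IH c by (meson rtrancl_into_rtrancl)
      qed simp
      then have "(x, y) \<in> chain_rel ?d r (V (comp x) i)" using x unfolding chain_rel_def by auto
      then show "?d x y \<le> ennreal ?R" using V[of "comp x"] x(1) i by blast
    qed
  qed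
qed

end


section \<open>The translation action\<close>

lemma funE_eqI:
  assumes "x \<in> {..<n} \<rightarrow>\<^sub>E A" "y \<in> {..<n} \<rightarrow>\<^sub>E B" "\<And>i. i < n \<Longrightarrow> x i = y i"
  shows "x = y"
  using assms by (intro extensionalityI[of x "{..<n}" y]) (auto simp: PiE_def)

lemma nat_vectors_simps [simp]:
  "carrier (nat_vectors n) = {..<n} \<rightarrow>\<^sub>E UNIV"
  "\<one>\<^bsub>nat_vectors n\<^esub> = (\<lambda>i\<in>{..<n}. 0)"
  "x \<otimes>\<^bsub>nat_vectors n\<^esub> y = (\<lambda>i\<in>{..<n}. x i + y i)"
  by (simp_all add: nat_vectors_def)

lemma comm_monoid_nat_vectors: "comm_monoid (nat_vectors n)"
proof (rule comm_monoidI)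
  show "\<one>\<^bsub>nat_vectors n\<^esub> \<otimes>\<^bsub>nat_vectors n\<^esub> x = x" if "x \<in> carrier (nat_vectors n)" for x
    by (rule funE_eqI[of _ n UNIV x]) (use that in simp_all)
qed (auto simp: fun_eq_iff)

definition unit_vector :: "nat \<Rightarrow> nat \<Rightarrow> nat \<Rightarrow> nat" where
  "unit_vector n i = (\<lambda>j\<in>{..<n}. if j = i then 1 else 0)"

lemma unit_vector_closed: "unit_vector n i \<in> carrier (nat_vectors n)"
  by (simp add: unit_vector_def)

lemma generated_nat_vectors: "monoid_generated_by (nat_vectors n) (unit_vector n ` {..<n})"
  unfolding monoid_generated_by_def
proof (intro conjI equalityI)
  interpret comm_monoid "nat_vectors n" by (rule comm_monoid_nat_vectors)
  show sub: "unit_vector n ` {..<n} \<subseteq> carrier (nat_vectors n)" using unit_vector_closed by blast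
  have "submonoid (carrier (nat_vectors n)) (nat_vectors n)" by unfold_locales auto
  then show "(\<lambda>H. submonoid H (nat_vectors n)) hull (unit_vector n ` {..<n}) \<subseteq> carrier (nat_vectors n)"
    using sub by (intro hull_minimal)
  \<comment> \<open>Induction on the sum of the coordinates: a positive coordinate is lowered by
    one, and the unit vector is added back.\<close>
  have "x \<in> H" if H: "submonoid H (nat_vectors n)" "unit_vector n ` {..<n} \<subseteq> H" and x: "x \<in> {..<n} \<rightarrow>\<^sub>E UNIV" for H x
    using x
  proof (induction "\<Sum>i<n. x i" arbitrary: x)
    case 0
    then have "x = \<one>\<^bsub>nat_vectors n\<^esub>" by (intro funE_eqI[of x n UNIV]) auto
    then show ?case using submonoid.one_closed[OF H(1)] by (simp only:)
  next
    case (Suc k)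
    have "\<exists>j<n. x j \<noteq> 0"
    proof (rule ccontr)
      assume "\<not> ?thesis"
      then have "(\<Sum>i<n. x i) = 0" by simp
      then show False using Suc.hyps(2) by simp
    qed
    then obtain j where j: "j < n" "x j > 0" by blast
    let ?y = "x(j := x j - 1)"
    have "(\<Sum>i<n. x i) = x j + (\<Sum>i\<in>{..<n} - {j}. x i)" using j(1) by (intro sum.remove) auto
    moreover have "(\<Sum>i<n. ?y i) = ?y j + (\<Sum>i\<in>{..<n} - {j}. ?y i)" using j(1) by (intro sum.remove) auto
    moreover have "(\<Sum>i\<in>{..<n} - {j}. ?y i) = (\<Sum>i\<in>{..<n} - {j}. x i)" by (rule sum.cong) auto
    ultimately have "k = (\<Sum>i<n. ?y i)" using Suc.hyps(2) j(2) by simp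
    moreover have y: "?y \<in> {..<n} \<rightarrow>\<^sub>E UNIV" using Suc.prems j(1) by (auto simp: PiE_def extensional_def)
    ultimately have "?y \<in> H" by (rule Suc.hyps(1))
    moreover have "unit_vector n j \<in> H" using H(2) j(1) by blast
    ultimately have "unit_vector n j \<otimes>\<^bsub>nat_vectors n\<^esub> ?y \<in> H" by (intro submonoid.m_closed[OF H(1)])
    moreover have "unit_vector n j \<otimes>\<^bsub>nat_vectors n\<^esub> ?y = x"
      using Suc.prems j by (intro funE_eqI[of _ n UNIV x UNIV]) (auto simp: unit_vector_def)
    ultimately show ?case by simp
  qed
  then show "carrier (nat_vectors n) \<subseteq> (\<lambda>H. submonoid H (nat_vectors n)) hull (unit_vector n ` {..<n})"
    unfolding hull_def by auto
qed

lemma fg_nat_vectors: "fg_comm_monoid (nat_vectors n) (unit_vector n ` {..<n})"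
  by (simp add: fg_comm_monoid_def fg_comm_monoid_axioms_def comm_monoid_nat_vectors generated_nat_vectors)

text \<open>The differences \<open>a i - b i\<close> of a fraction are characters dual to the unit
  vectors, and a fraction at which all of them vanish is trivial.\<close>

lemma rk_nat_vectors: "rk (nat_vectors n) = n"
proof -
  let ?M = "nat_vectors n"
  interpret fg_comm_monoid "nat_vectors n" "unit_vector n ` {..<n}" by (rule fg_nat_vectors)
  let ?G = "group_completion (nat_vectors n)"
  define c where "c i P = (case (SOME p. p \<in> P) of (a, b) \<Rightarrow> int (a i) - int (b i))" for i and P :: "((nat \<Rightarrow> nat) \<times> (nat \<Rightarrow> nat)) set"
  have c: "c i (fraction ?M a b) = int (a i) - int (b i)"
    if i: "i < n" and ab: "a \<in> carrier ?M" "b \<in> carrier ?M" for i a b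
  proof -
    obtain a' b' where p: "(SOME p. p \<in> fraction ?M a b) = (a', b')" by force
    have "(a, b) \<in> fraction ?M a b"
      unfolding fraction_def using equiv_class_self[OF equiv_fraction_rel] ab by blast
    then have "(a', b') \<in> fraction ?M a b" unfolding p[symmetric] by (rule someI)
    then obtain d where "a \<otimes>\<^bsub>?M\<^esub> b' \<otimes>\<^bsub>?M\<^esub> d = a' \<otimes>\<^bsub>?M\<^esub> b \<otimes>\<^bsub>?M\<^esub> d"
      unfolding fraction_def fraction_rel_def by auto
    from fun_cong[OF this, of i] have "a i + b' i = a' i + b i" using i by simp
    then show ?thesis unfolding c_def p by simp
  qed
  define g where "g j = fraction ?M (unit_vector n j) \<one>\<^bsub>?M\<^esub>" for j
  note uc = unit_vector_closed[of n]
  have bi: "completion.biorth n c g"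
    unfolding completion.biorth_def
  proof (intro conjI allI impI)
    fix i assume i: "i < n"
    show "c i \<in> hom ?G integer_group"
    proof (rule homI)
      fix P Q assume "P \<in> carrier ?G" "Q \<in> carrier ?G"
      then obtain a b a' b' where P: "a \<in> carrier ?M" "b \<in> carrier ?M" "P = fraction ?M a b"
        and Q: "a' \<in> carrier ?M" "b' \<in> carrier ?M" "Q = fraction ?M a' b'"
        by (metis fraction_cases)
      have "c i (P \<otimes>\<^bsub>?G\<^esub> Q) = int ((a \<otimes>\<^bsub>?M\<^esub> a') i) - int ((b \<otimes>\<^bsub>?M\<^esub> b') i)"
        unfolding P(3) Q(3) fraction_mult[OF P(1,2) Q(1,2)] using P Q by (intro c[OF i] m_closed)
      then show "c i (P \<otimes>\<^bsub>?G\<^esub> Q) = c i P \<otimes>\<^bsub>integer_group\<^esub> c i Q"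
        unfolding P(3) Q(3) c[OF i P(1,2)] c[OF i Q(1,2)] using i by simp
    qed simp
    show "g i \<in> carrier ?G" unfolding g_def using uc by (intro fraction_closed one_closed)
  next
    fix i j assume i: "i < n" "j < n"
    show "c i (g j) = (if i = j then 1 else 0)"
      unfolding g_def c[OF i(1) uc one_closed] using i by (simp add: unit_vector_def)
  qed
  have "completion.ker n c \<subseteq> {\<one>\<^bsub>?G\<^esub>}"
  proof
    fix P assume "P \<in> completion.ker n c"
    then have P: "P \<in> carrier ?G" "\<And>i. i < n \<Longrightarrow> c i P = 0" unfolding completion.ker_def[OF bi] by blast+
    obtain a b where ab: "a \<in> carrier ?M" "b \<in> carrier ?M" "P = fraction ?M a b"
      using P(1) by (rule fraction_cases)
    have "a i = b i" if "i < n" for i using P(2)[OF that] c[OF that ab(1,2)] ab(3) by simp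
    then have "a = b" using ab(1,2) by (intro funE_eqI[of a n UNIV b UNIV]) auto
    then have "P = fraction ?M \<one>\<^bsub>?M\<^esub> \<one>\<^bsub>?M\<^esub>"
      unfolding ab(3) using ab(1) by (subst fraction_eq_iff) (auto simp: m_comm simp del: nat_vectors_simps)
    then show "P \<in> {\<one>\<^bsub>?G\<^esub>}" by (simp add: fraction_one)
  qed
  then have "finite (completion.ker n c)" by (rule finite_subset) simp
  with bi show ?thesis by (rule rk_biorth)
qed

lemma carrier_int_vectors: "carrier (int_vectors n) = {..<n} \<rightarrow>\<^sub>E UNIV"
  by simp

lemma translation_action: "monoid_action (nat_vectors n) (carrier (int_vectors n)) (translation n)"
  unfolding monoid_action_def carrier_int_vectors
proof (intro conjI ballI)
  fix x :: "nat \<Rightarrow> int" assume x: "x \<in> {..<n} \<rightarrow>\<^sub>E UNIV"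
  show "translation n \<one>\<^bsub>nat_vectors n\<^esub> x = x"
    by (rule funE_eqI[of _ n UNIV x]) (use x in \<open>auto simp: translation_def\<close>)
qed (auto simp: translation_def fun_eq_iff)

lemma fiber_translation:
  "finite (fiber (carrier (int_vectors n)) (translation n) a x) \<and>
   card (fiber (carrier (int_vectors n)) (translation n) a x) \<le> 1"
proof -
  have "fiber (carrier (int_vectors n)) (translation n) a x \<subseteq> {\<lambda>i\<in>{..<n}. x i - int (a i)}"
  proof
    fix y assume "y \<in> fiber (carrier (int_vectors n)) (translation n) a x"
    then have y: "y \<in> {..<n} \<rightarrow>\<^sub>E UNIV" "translation n a y = x" by (auto simp: fiber_def)
    have "y = (\<lambda>i\<in>{..<n}. x i - int (a i))"
    proof (rule funE_eqI[OF y(1)])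
      show "(\<lambda>i\<in>{..<n}. x i - int (a i)) \<in> {..<n} \<rightarrow>\<^sub>E UNIV" by simp
      show "y i = (\<lambda>i\<in>{..<n}. x i - int (a i)) i" if "i < n" for i
        using fun_cong[OF y(2), of i] that by (simp add: translation_def)
    qed
    then show "y \<in> {\<lambda>i\<in>{..<n}. x i - int (a i)}" by simp
  qed
  then show ?thesis using card_mono[of "{\<lambda>i\<in>{..<n}. x i - int (a i)}"] by (auto intro: finite_subset)
qed

lemma bounded_translation:
  "bounded_to_one_action (nat_vectors n) (carrier (int_vectors n)) (translation n)"
  unfolding bounded_to_one_action_def using translation_action fiber_translation by blast

locale nat_vectors_generators = fg_comm_monoid "nat_vectors n" S for n S
begin

abbreviation "X \<equiv> carrier (int_vectors n)"
abbreviation "d \<equiv> schreier_dist S X (translation n)"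

interpretation E: commuting S "ext_action S X (translation n)"
  by (rule commuting_ext[OF translation_action])

lemma near_iff_words:
  assumes "x \<in> X" "y \<in> X"
  shows "E.near k x y \<longleftrightarrow> (\<exists>u\<in>words. \<exists>v\<in>words. size u + size v \<le> k \<and>
    (\<forall>i<n. int (mval u i) + x i = int (mval v i) + y i))"
proof -
  have tr: "translation n a x = translation n b y \<longleftrightarrow> (\<forall>i<n. int (a i) + x i = int (b i) + y i)" for a b
    unfolding translation_def by (auto simp: fun_eq_iff restrict_def)
  have a: "act_word (ext_action S X (translation n)) w t = translation n (mval w) t" if "w \<in> words" "t \<in> X" for w t
    by (simp only: act_ext[OF translation_action that(1)] that(2) if_True)
  have "act_word (ext_action S X (translation n)) u x = act_word (ext_action S X (translation n)) v y \<longleftrightarrow>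
      (\<forall>i<n. int (mval u i) + x i = int (mval v i) + y i)" if "u \<in> words" "v \<in> words" for u v
    unfolding a[OF that(1) assms(1)] a[OF that(2) assms(2)] by (rule tr)
  then show ?thesis unfolding E.near_def by blast
qed

text \<open>A letter changes each coordinate by a bounded amount, so the coordinates are Lipschitz
  for every finite generating set.\<close>

lemma near_bound:
  obtains A where "\<And>k x y i. x \<in> X \<Longrightarrow> y \<in> X \<Longrightarrow> E.near k x y \<Longrightarrow> i < n \<Longrightarrow> \<bar>x i - y i\<bar> \<le> int (A * k)"
proof -
  define A where "A = (\<Sum>s\<in>S. \<Sum>i<n. s i)"
  have A: "s i \<le> A" if "s \<in> S" "i < n" for s i
  proof -
    have "s i \<le> (\<Sum>i<n. s i)" using that(2) by (intro member_le_sum) auto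
    also have "\<dots> \<le> A" unfolding A_def using that(1) fin_S by (intro member_le_sum[of s S "\<lambda>s. \<Sum>i<n. s i"]) auto
    finally show ?thesis .
  qed
  have B: "mval w i \<le> A * size w" if "w \<in> words" "i < n" for w i
    using that(1)
  proof (induction w)
    case empty
    show ?case using that(2) by simp
  next
    case (add s w)
    then have s: "s \<in> S" "w \<in> words" by simp_all
    then show ?case using A[OF s(1) that(2)] add.IH[OF s(2)] that(2) by (simp add: mval_add_mset)
  qed
  show thesis
  proof (rule that)
    fix k x y i assume xy: "x \<in> X" "y \<in> X" "E.near k x y" and i: "i < n"
    then obtain u v where uv: "u \<in> words" "v \<in> words" "size u + size v \<le> k" "int (mval u i) + x i = int (mval v i) + y i"
      unfolding near_iff_words[OF xy(1,2)] by blast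
    have "A * size u + A * size v \<le> A * k" using uv(3) by (metis add_mult_distrib2 mult_le_mono2)
    then have "mval u i + mval v i \<le> A * k" using B[OF uv(1) i] B[OF uv(2) i] by linarith
    then have "int (mval u i) + int (mval v i) \<le> int (A * k)" by (metis of_nat_add of_nat_le_iff)
    then show "\<bar>x i - y i\<bar> \<le> int (A * k)" using uv(4) by linarith
  qed
qed

text \<open>The difference \<open>x - y\<close> is \<open>b - a\<close> with entries of
  \<open>a\<close> and \<open>b\<close> in \<open>{0..2}\<close>; these finitely many vectors are
  values of words of bounded length. The tolerance two is the distance met in one grid cell
  below.\<close>

lemma close_near:
  obtains k where "\<And>x y. x \<in> X \<Longrightarrow> y \<in> X \<Longrightarrow> (\<And>i. i < n \<Longrightarrow> \<bar>x i - y i\<bar> \<le> 2) \<Longrightarrow> E.near k x y"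
proof -
  let ?V = "{..<n} \<rightarrow>\<^sub>E {0..2::nat}"
  have "\<forall>a\<in>?V. \<exists>w\<in>words. mval w = a"
  proof
    fix a assume "a \<in> ?V"
    then have "a \<in> carrier (nat_vectors n)" by (simp add: PiE_iff)
    from ex_word[OF this] show "\<exists>w\<in>words. mval w = a" by blast
  qed
  then obtain w where w: "\<And>a. a \<in> ?V \<Longrightarrow> w a \<in> words \<and> mval (w a) = a" by metis
  have fin: "finite ?V" by (simp add: finite_PiE)
  define k where "k = (\<Sum>a\<in>?V. size (w a))"
  have k: "size (w a) \<le> k" if "a \<in> ?V" for a unfolding k_def using that fin by (intro member_le_sum) auto
  show thesis
  proof (rule that[of "k + k"])
    fix x y assume xy: "x \<in> X" "y \<in> X" and cl: "\<And>i. i < n \<Longrightarrow> \<bar>x i - y i\<bar> \<le> 2"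
    define a where "a = (\<lambda>i\<in>{..<n}. nat (y i - x i))"
    define b where "b = (\<lambda>i\<in>{..<n}. nat (x i - y i))"
    have "nat (y i - x i) \<le> 2" "nat (x i - y i) \<le> 2" if "i < n" for i using cl[OF that] by linarith+
    then have ab: "a \<in> ?V" "b \<in> ?V" unfolding a_def b_def by auto
    have "\<forall>i<n. int (mval (w a) i) + x i = int (mval (w b) i) + y i"
      using w[OF ab(1)] w[OF ab(2)] by (simp add: a_def b_def)
    then show "E.near (k + k) x y"
      unfolding near_iff_words[OF xy] using w[OF ab(1)] w[OF ab(2)] k[OF ab(1)] k[OF ab(2)]
      by (intro bexI[of _ "w a"] bexI[of _ "w b"]) auto
  qed
qed

text \<open>A cover of a large cube with bounded components would give, colour by colour, a separation of
  opposite faces that is constant near every component, contradicting Kuhn's lemma.\<close>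
lemma asdim_lower:
  assumes "asdim_le_with_control X d m R"
  shows "n \<le> m"
proof (rule ccontr)
  assume "\<not> n \<le> m"
  then have mn: "m < n" by simp
  obtain A where A: "\<And>k x y i. x \<in> X \<Longrightarrow> y \<in> X \<Longrightarrow> E.near k x y \<Longrightarrow> i < n \<Longrightarrow> \<bar>x i - y i\<bar> \<le> int (A * k)"
    using near_bound by blast
  obtain k where k: "\<And>x y. x \<in> X \<Longrightarrow> y \<in> X \<Longrightarrow> (\<And>i. i < n \<Longrightarrow> \<bar>x i - y i\<bar> \<le> 2) \<Longrightarrow> E.near k x y"
    using close_near by blast
  define r where "r = real k + 1"
  have r1: "r > 0" "0 \<le> r" "nat \<lfloor>r\<rfloor> = k + 1" unfolding r_def by linarith+
  have r2: "d x y \<le> ennreal r" if "E.near k x y" for x y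
    unfolding dist_le_iff_near[OF translation_action r1(2)] r1(3) using that by (rule E.near.near_mono) simp
  note r = r1(1) r2
  obtain U where R: "0 \<le> R r" and U: "(\<Union>i\<le>m. U i) = X" "\<forall>i\<le>m. \<forall>(x, y)\<in>chain_rel d r (U i). d x y \<le> ennreal (R r)"
    using assms[unfolded asdim_le_with_control_iff[OF schreier_dist_sym], THEN spec, THEN mp, OF r(1)]
    by (elim exE conjE)
  have UX: "x \<in> X" if "x \<in> U i" "i \<le> m" for x i using U(1) that by blast
  define K where "K = A * nat \<lfloor>R r\<rfloor>"
  have far: "\<bar>x j - y j\<bar> \<le> int K" if "(x, y) \<in> chain_rel d r (U i)" "i \<le> m" "j < n" for x y i j
  proof -
    have "d x y \<le> ennreal (R r)" using U(2) that(1,2) by blast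
    then have "E.near (nat \<lfloor>R r\<rfloor>) x y" using dist_le_iff_near[OF translation_action R] by blast
    moreover have "x \<in> X" "y \<in> X" using that UX unfolding chain_rel_def by blast+
    ultimately show ?thesis unfolding K_def using A that(3) by blast
  qed
  \<comment> \<open>Points of the cover within one of the two faces have \<open>i\<close>-th
    coordinates at most \<open>1\<close> and at least \<open>p - 1\<close>. Their difference, at
    least \<open>K + 1\<close>, rules out a common component.\<close>
  define p where "p = K + 3"
  define z where "z q = (\<lambda>j\<in>{..<n}. int (q j))" for q :: "nat \<Rightarrow> nat"
  have zX: "z q \<in> X" for q unfolding z_def by simp
  define cl where "cl x y \<longleftrightarrow> (\<forall>j<n. \<bar>x j - y j\<bar> \<le> (1::int))" for x y :: "nat \<Rightarrow> int"
  define touch where "touch i c \<longleftrightarrow> (\<exists>c'. (c, c') \<in> chain_rel d r (U i) \<and> c' i \<le> 1)" for i c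
  \<comment> \<open>If a point of \<open>U i\<close> is next to \<open>z q\<close>, the label tells
    whether the component of such a point reaches the lower face. Otherwise it is \<open>0\<close>
    except on the upper face, where Kuhn's lemma prescribes \<open>1\<close>.\<close>
  define label where "label q i = (if i \<le> m \<and> (\<exists>c\<in>U i. cl c (z q))
      then (if \<exists>c\<in>U i. cl c (z q) \<and> touch i c then 0 else 1)
      else (if q i = p then 1 else 0 :: nat))" for q i
  obtain q where q: "\<forall>i<n. q i < p"
    and q2: "\<forall>i<n. \<exists>a b. (\<forall>j<n. q j \<le> a j \<and> a j \<le> q j + 1) \<and> (\<forall>j<n. q j \<le> b j \<and> b j \<le> q j + 1) \<and> label a i \<noteq> label b i"
  proof (rule kuhn_lemma[of p n label])
    show "0 < p" unfolding p_def by simp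
    show "\<forall>x. (\<forall>i<n. x i \<le> p) \<longrightarrow> (\<forall>i<n. label x i = 0 \<or> label x i = 1)" unfolding label_def by auto
    show "\<forall>x. (\<forall>i<n. x i \<le> p) \<longrightarrow> (\<forall>i<n. x i = 0 \<longrightarrow> label x i = 0)"
    proof (intro allI impI)
      fix x i assume i: "i < n" "x i = (0::nat)"
      have "touch i c" if c: "c \<in> U i" "cl c (z x)" for c
      proof -
        have "c i \<le> 1" using c(2) i unfolding cl_def z_def by auto
        then show ?thesis unfolding touch_def using c(1) by (intro exI[of _ c]) (simp add: chain_rel_def)
      qed
      then show "label x i = 0" unfolding label_def using i(2) by (auto simp: p_def)
    qed
    show "\<forall>x. (\<forall>i<n. x i \<le> p) \<longrightarrow> (\<forall>i<n. x i = p \<longrightarrow> label x i = 1)"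
    proof (intro allI impI)
      fix x i assume i: "i < n" "x i = p"
      have "\<not> touch i c" if c: "c \<in> U i" "cl c (z x)" "i \<le> m" for c
      proof
        assume "touch i c"
        then obtain c' where c': "(c, c') \<in> chain_rel d r (U i)" "c' i \<le> 1" unfolding touch_def by blast
        have "\<bar>c i - int p\<bar> \<le> 1" using c(2) i unfolding cl_def z_def by auto
        then show False using far[OF c'(1) c(3) i(1)] c'(2) unfolding p_def by simp
      qed
      then show "label x i = 1" unfolding label_def using i(2) by auto
    qed
  qed blast
  obtain i where i: "i \<le> m" "z q \<in> U i" using U(1) zX[of q] by blast
  \<comment> \<open>Every vertex \<open>z a\<close> of the cell is next to \<open>z q\<close>, which
    lies in \<open>U i\<close>; any point of \<open>U i\<close> next to \<open>z a\<close> is within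
    two of \<open>z q\<close>, hence in the same component. So label \<open>i\<close> cannot change
    within the cell.\<close>
  have const: "label a i = (if touch i (z q) then 0 else 1)" if a: "\<forall>j<n. q j \<le> a j \<and> a j \<le> q j + 1" for a
  proof -
    have az: "cl (z q) (z a)" unfolding cl_def z_def using a by auto
    have "touch i c \<longleftrightarrow> touch i (z q)" if c: "c \<in> U i" "cl c (z a)" for c
    proof -
      have "\<bar>c j - z q j\<bar> \<le> 2" if "j < n" for j
      proof -
        have "\<bar>c j - z a j\<bar> \<le> 1" "\<bar>z q j - z a j\<bar> \<le> 1" using c(2) az that unfolding cl_def by blast+
        then show ?thesis by linarith
      qed
      then have "d c (z q) \<le> ennreal r" using k[OF UX[OF c(1) i(1)] zX] r(2) by blast
      then have s: "(c, z q) \<in> chain_rel d r (U i)" "(z q, c) \<in> chain_rel d r (U i)"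
        unfolding chain_rel_def using c(1) i(2) schreier_dist_sym[of S X "translation n" c "z q"] by auto
      have trans: "(x, t) \<in> chain_rel d r (U i)" if "(x, y) \<in> chain_rel d r (U i)" "(y, t) \<in> chain_rel d r (U i)" for x y t
        using that unfolding chain_rel_def by auto
      show ?thesis unfolding touch_def using s trans by blast
    qed
    then have "(\<exists>c\<in>U i. cl c (z a) \<and> touch i c) \<longleftrightarrow> touch i (z q)" using i(2) az by blast
    moreover have "i \<le> m \<and> (\<exists>c\<in>U i. cl c (z a))" using i az by blast
    ultimately show ?thesis unfolding label_def by (simp only: if_True simp_thms)
  qed
  have "i < n" using i(1) mn by simp
  then show False using q2 const by metis
qed

lemma asdim_translation: "asdim X d = enat n"
proof (rule antisym)
  have "fiber_bounded 1 X (translation n)"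
    unfolding fiber_bounded_def using bounded_translation fiber_translation by blast
  then have "asdim_le_with_control X d (rk (nat_vectors n)) (uniform_control (nat_vectors n) S 1)"
    by (rule asdim_le_uniform_control) simp
  then show "asdim X d \<le> enat n"
    unfolding asdim_def rk_nat_vectors by (intro INF_lower) blast
  show "enat n \<le> asdim X d"
    unfolding asdim_def using asdim_lower by (intro INF_greatest) auto
qed

end

theorem theorem1p2:
  shows "(\<forall>(M :: ('m, 'b) monoid_scheme) S (K :: nat).
            comm_monoid M \<and> finite S \<and> monoid_generated_by M S \<and> 1 \<le> K \<longrightarrow>
            (\<exists>R :: real \<Rightarrow> real. R = uniform_control M S K \<and> (\<forall>r>0. 0 \<le> R r) \<and>
              (\<forall>(X :: 'x set) act.
                 bounded_to_one_action M X act \<and>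
                 (\<forall>x\<in>X. \<forall>s\<in>S. finite (fiber X act s x) \<and> card (fiber X act s x) \<le> K) \<longrightarrow>
                 asdim_le_with_control X (schreier_dist S X act) (rk M) R)))
       \<and> (\<forall>n. comm_monoid (nat_vectors n) \<and> finitely_generated_monoid (nat_vectors n) \<and>
              rk (nat_vectors n) = n \<and>
              bounded_to_one_action (nat_vectors n) (carrier (int_vectors n)) (translation n) \<and>
              (\<forall>S. finite S \<and> monoid_generated_by (nat_vectors n) S \<longrightarrow>
                 asdim (carrier (int_vectors n))
                   (schreier_dist S (carrier (int_vectors n)) (translation n)) = enat n))"
proof (intro conjI allI impI, goal_cases)
  case (1 M S K)
  then interpret fg_comm_monoid M S
    by (simp add: fg_comm_monoid_def fg_comm_monoid_axioms_def)
  have K: "1 \<le> K" using 1 by blast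
  show ?case
  proof (intro exI conjI refl allI impI)
    show "asdim_le_with_control X (schreier_dist S X act) (rk M) (uniform_control M S K)"
      if "bounded_to_one_action M X act \<and>
        (\<forall>x\<in>X. \<forall>s\<in>S. finite (fiber X act s x) \<and> card (fiber X act s x) \<le> K)" for X :: "'x set" and act
      using that K by (intro asdim_le_uniform_control) (simp_all add: fiber_bounded_def)
  qed (use uniform_control(1)[OF K] in auto)
next
  case (2 n)
  show ?case by (rule comm_monoid_nat_vectors)
next
  case (3 n)
  show ?case unfolding finitely_generated_monoid_def using generated_nat_vectors by blast
next
  case (4 n)
  show ?case by (rule rk_nat_vectors)
next
  case (5 n)
  show ?case by (rule bounded_translation)
next
  case (6 n S)
  then interpret nat_vectors_generators n S
    by (simp add: nat_vectors_generators_def fg_comm_monoid_def fg_comm_monoid_axioms_def comm_monoid_nat_vectors)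
  show ?case by (rule asdim_translation)
qed

end
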